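(* Let $m\ge2$ and $n\ge2$ be integers with $m$ odd and $2m<n$. For $k=0,1,\dots,2m-1$ let $\lambda_k$ be real constants with $\lambda_k<\frac{n}{n-2m+k}$ and let $g_k:B_2(0)\setminus\{0\}\to[1,\infty)$ be continuous. Let $u$ be a $C^{2m}$ nonnegative solution of $$0\le-\Delta^m u\le\sum_{k=0}^{2m-1}\left(|D^ku|+g_k\right)^{\lambda_k}\quad\text{in }B_2(0)\setminus\{0\}\subset\mathbb{R}^n.$$ Let $$b=\max\left\{0,\ \max_{0\le k\le 2m-1}\frac{\lambda_k(n-2+k)-(2m+n-2)}{n-\lambda_k(n-2m+k)}\right\}.$$ (i) If $b=0$ and $g_k(x)=O(|x|^{-(n-2+k)})$ as $x\to0$ for every $k=0,\dots,2m-1$, then for $i=0,1,\dots,2m-1$, $|D^iu(x)|=O(|x|^{-(n-2+i)})$ as $x\to0$. (ii) If $b>0$ and $g_k(x)=o(|x|^{-a(k)})$ as $x\to0$ for every $k=0,\dots,2m-1$, where $a(i)=(n-2m+i)b+(n-2+i)$, then for $i=0,1,\dots,2m-1$, $|D^iu(x)|=o(|x|^{-a(i)})$ as $x\to0$.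
   Context: $\Delta^m$ is the $m$-fold iterated Laplacian. For a function $u$, $|D^ku|$ denotes the (Euclidean) norm of the collection of all partial derivatives of $u$ of order exactly $k$; in particular $|D^0u|=|u|$. $B_r(0)$ is the open ball of radius $r$ about the origin. *)

theory Defs
  imports "HOL-Analysis.Analysis" "HOL-Library.Landau_Symbols"
begin

definition pderiv_coord :: "'n::finite \<Rightarrow> (real^'n \<Rightarrow> real) \<Rightarrow> real^'n \<Rightarrow> real" where
  "pderiv_coord i f x = deriv (\<lambda>t. f (x + t *\<^sub>R axis i 1)) 0"

fun Dlist :: "'n::finite list \<Rightarrow> (real^'n \<Rightarrow> real) \<Rightarrow> real^'n \<Rightarrow> real" where
  "Dlist [] f = f"
| "Dlist (i # is) f = pderiv_coord i (Dlist is f)"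

definition Ck_on :: "nat \<Rightarrow> (real^'n::finite) set \<Rightarrow> (real^'n \<Rightarrow> real) \<Rightarrow> bool" where
  "Ck_on k S f \<longleftrightarrow>
     (\<forall>is. length is \<le> k \<longrightarrow> continuous_on S (Dlist is f)) \<and>
     (\<forall>is i x. length is < k \<longrightarrow> x \<in> S \<longrightarrow>
        ((\<lambda>t. Dlist is f (x + t *\<^sub>R axis i 1)) has_real_derivative Dlist (i # is) f x) (at 0))"

definition laplacian :: "(real^'n::finite \<Rightarrow> real) \<Rightarrow> real^'n \<Rightarrow> real" where
  "laplacian f x = (\<Sum>i\<in>UNIV. Dlist [i, i] f x)"

definition poly_laplacian :: "nat \<Rightarrow> (real^'n::finite \<Rightarrow> real) \<Rightarrow> real^'n \<Rightarrow> real" where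
  "poly_laplacian m f = (laplacian ^^ m) f"

definition Dnorm :: "nat \<Rightarrow> (real^'n::finite \<Rightarrow> real) \<Rightarrow> real^'n \<Rightarrow> real" where
  "Dnorm k f x = sqrt (\<Sum>is\<in>{is :: 'n list. length is = k}. (Dlist is f x)\<^sup>2)"

end

theory Submission
  imports Defs
begin

text \<open>Write \<open>f = - \<Delta>\<^sup>m u \<ge> 0\<close>. Testing with radial functions supported in \<open>\<epsilon> \<le> |x| \<le> 2\<close> that grow like
  \<open>|x|\<^bsup>2m-2\<^esup>\<close> and whose \<open>m\<close>-fold Laplacian is nonnegative on the unit ball shows at once that
  \<open>|x|\<^bsup>2m-2\<^esup> f\<close> is integrable near the origin and that the mean of \<open>u\<close> over the annulus \<open>|x| \<approx> \<rho>\<close> is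
  \<open>O(\<rho>\<^bsup>2-n\<^esup>)\<close>. A local representation of \<open>u\<close> bounds \<open>|D\<^sup>k u|\<close> at a point by such a mean and by the masses
  of \<open>f\<close> on small balls around that point. At a maximum point of \<open>f\<close>, weighted by a power of the distance
  to the boundary of a ball of radius comparable to \<open>|x|\<close>, these masses are controlled by the value of
  \<open>f\<close> itself, and the differential inequality bounds \<open>f\<close> because \<open>\<lambda>\<^sub>k (n - 2m + k) < n\<close>. Inserting
  this bound into the local representation gives the bounds on the derivatives; the little-o comes from
  the integrals of \<open>|x|\<^bsup>2m-2\<^esup> f\<close> over shrinking annuli tending to zero.\<close>

subsection \<open>Functions of class \<open>C\<^sup>k\<close>\<close>

text \<open>Origin of the exponents: integrability of |x|^(2m-2) f leaves mass of order |x|^(2-2m)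
  in the annulus at distance |x|. Spread over a ball of radius |x|^(1+b), this mass has density
  |x|^(-q) with q = n b + 2m - 2 + n, and i-th derivatives of u then scale like |x|^(2-2m)
  |x|^(-(1+b)(n-2m+i)) = |x|^(-a(i)). The condition a(k) \<lambda>_k \<le> q says, after clearing
  denominators, that b dominates the k-th quotient in its definition; so b is the least nonnegative
  exponent for which the differential inequality is consistent with this density. The obstacle for
  the test functions: |x|^(2m-2) is annihilated by the m-fold Laplacian, so an ordinary cutoff at
  the origin would produce terms of either sign multiplied by u. The profile (1 -
  (e/|x|^2)^(1/(2m)))^(4m) cuts off with a nonnegative m-fold Laplacian, and terms of unknown sign
  survive only in the fixed shell 1 \<le> |x|^2 \<le> 2, uniformly in e. The local representation
  averages against compactly supported rescaled kernels, so no boundary terms arise and only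
  integrals of u and of f over balls enter.\<close>

lemma Dlist_append: "Dlist (is @ js) f = Dlist is (Dlist js f)"
  by (induction "is") auto

text \<open>The last entry of the list acts first. Splitting at the end therefore differentiates
  \<open>f\<close> itself, which turns claims about C^(k+1) into claims about C^k of the first
  partials.\<close>

lemma Dlist_snoc: "Dlist (is @ [i]) f = Dlist is (pderiv_coord i f)"
  by (simp add: Dlist_append)

lemma eventually_line_in_open:
  fixes S :: "(real^'n::finite) set"
  assumes "open S" "x \<in> S"
  shows "eventually (\<lambda>t. x + t *\<^sub>R axis i 1 \<in> S) (nhds 0)"
proof -
  have "((\<lambda>t::real. x + t *\<^sub>R axis i (1::real)) \<longlongrightarrow> x) (nhds 0)"
    by (rule tendsto_eq_intros filterlim_ident | simp)+
  then show ?thesis using assms by (metis topological_tendstoD)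
qed

lemma DERIV_line_cong:
  fixes f g :: "real^'n::finite \<Rightarrow> real"
  assumes "open S" "x \<in> S" "\<And>y. y \<in> S \<Longrightarrow> f y = g y"
  shows "((\<lambda>t. f (x + t *\<^sub>R axis i 1)) has_real_derivative d) (at 0) \<longleftrightarrow>
         ((\<lambda>t. g (x + t *\<^sub>R axis i 1)) has_real_derivative d) (at 0)"
  by (rule DERIV_cong_ev)
     (auto intro: eventually_mono[OF eventually_line_in_open[OF assms(1,2)]] assms(3))

lemma pderiv_coord_cong:
  fixes f g :: "real^'n::finite \<Rightarrow> real"
  assumes "open S" "x \<in> S" "\<And>y. y \<in> S \<Longrightarrow> f y = g y"
  shows "pderiv_coord i f x = pderiv_coord i g x"
  unfolding pderiv_coord_def
  by (rule deriv_cong_ev)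
     (auto intro: eventually_mono[OF eventually_line_in_open[OF assms(1,2)]] assms(3))

lemma Dlist_cong:
  fixes f g :: "real^'n::finite \<Rightarrow> real"
  assumes "open S" "\<And>y. y \<in> S \<Longrightarrow> f y = g y" "x \<in> S"
  shows "Dlist is f x = Dlist is g x"
  using assms(3)
proof (induction "is" arbitrary: x)
  case (Cons i "is")
  then show ?case using pderiv_coord_cong[OF assms(1) Cons.prems Cons.IH] by simp
qed (use assms in auto)

lemma Ck_on_cong:
  fixes f g :: "real^'n::finite \<Rightarrow> real"
  assumes "open S" "\<And>y. y \<in> S \<Longrightarrow> f y = g y"
  shows "Ck_on k S f \<longleftrightarrow> Ck_on k S g"
proof -
  have *: "Dlist is f x = Dlist is g x" if "x \<in> S" for "is" x
    using Dlist_cong[OF assms(1) _ that] assms(2) by blast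
  have 1: "continuous_on S (Dlist is f) \<longleftrightarrow> continuous_on S (Dlist is g)" for "is"
    by (rule continuous_on_cong) (auto simp: *)
  have 2: "((\<lambda>t. Dlist is f (x + t *\<^sub>R axis i 1)) has_real_derivative Dlist (i # is) f x) (at 0) \<longleftrightarrow>
    ((\<lambda>t. Dlist is g (x + t *\<^sub>R axis i 1)) has_real_derivative Dlist (i # is) g x) (at 0)"
    if "x \<in> S" for "is" i x
    unfolding *[OF that, of "i # is"] by (rule DERIV_line_cong[OF assms(1) that]) (rule *)
  show ?thesis unfolding Ck_on_def using 1 2 by blast
qed

lemma Ck_on_continuous: "Ck_on k S f \<Longrightarrow> continuous_on S f"
  unfolding Ck_on_def by (metis Dlist.simps(1) le0 list.size(3))

lemma Ck_on_0: "Ck_on 0 S f \<longleftrightarrow> continuous_on S f"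
  unfolding Ck_on_def by auto

lemma Ck_on_mono: "Ck_on k S f \<Longrightarrow> j \<le> k \<Longrightarrow> T \<subseteq> S \<Longrightarrow> Ck_on j T f"
  unfolding Ck_on_def by (meson continuous_on_subset order.trans order_less_le_trans subsetD)

lemma Ck_on_Suc_D: "Ck_on (Suc k) S f \<Longrightarrow> Ck_on k S (pderiv_coord i f)"
  unfolding Ck_on_def
proof safe
  fix "is" :: "'a list"
  assume *: "\<forall>is. length is \<le> Suc k \<longrightarrow> continuous_on S (Dlist is f)"
     "\<forall>is i x. length is < Suc k \<longrightarrow> x \<in> S \<longrightarrow>
        ((\<lambda>t. Dlist is f (x + t *\<^sub>R axis i 1)) has_real_derivative Dlist (i # is) f x) (at 0)"
  show "continuous_on S (Dlist is (pderiv_coord i f))" if "length is \<le> k"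
    using *(1)[rule_format, of "is @ [i]"] that by (simp add: Dlist_snoc)
  show "((\<lambda>t. Dlist is (pderiv_coord i f) (x + t *\<^sub>R axis j 1)) has_real_derivative
          Dlist (j # is) (pderiv_coord i f) x) (at 0)" if "length is < k" "x \<in> S" for x j
    using *(2)[rule_format, of "is @ [i]" x j] that by (simp add: Dlist_snoc)
qed

lemma Ck_on_DERIV:
  assumes "Ck_on (Suc k) S f" "x \<in> S"
  shows "((\<lambda>t. f (x + t *\<^sub>R axis i 1)) has_real_derivative pderiv_coord i f x) (at 0)"
proof -
  have "((\<lambda>t. Dlist [] f (x + t *\<^sub>R axis i 1)) has_real_derivative Dlist [i] f x) (at 0)"
    using assms unfolding Ck_on_def by (metis list.size(3) zero_less_Suc)
  then show ?thesis by simp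
qed

lemma Ck_on_Suc_pderiv:
  assumes "continuous_on S f" 
    "\<And>i x. x \<in> S \<Longrightarrow> ((\<lambda>t. f (x + t *\<^sub>R axis i 1)) has_real_derivative pderiv_coord i f x) (at 0)"
    "\<And>i. Ck_on k S (pderiv_coord i f)"
  shows "Ck_on (Suc k) S f"
  unfolding Ck_on_def
proof (intro conjI allI impI)
  fix "is" :: "'a list" assume l: "length is \<le> Suc k"
  show "continuous_on S (Dlist is f)"
  proof (cases "is" rule: rev_cases)
    case (snoc js j)
    then show ?thesis using assms(3)[of j] l by (auto simp: Dlist_snoc Ck_on_def)
  qed (use assms in simp)
next
  fix "is" :: "'a list" and i x assume l: "length is < Suc k" "x \<in> S"
  show "((\<lambda>t. Dlist is f (x + t *\<^sub>R axis i 1)) has_real_derivative Dlist (i # is) f x) (at 0)"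
  proof (cases "is" rule: rev_cases)
    case (snoc js j)
    then show ?thesis using assms(3)[of j] l by (auto simp: Dlist_snoc Ck_on_def)
  qed (use assms l in simp)
qed

lemma pderiv_coord_eqI:
  "((\<lambda>t. f (x + t *\<^sub>R axis i 1)) has_real_derivative d) (at 0) \<Longrightarrow> pderiv_coord i f x = d"
  unfolding pderiv_coord_def by (rule DERIV_imp_deriv)

text \<open>The recursion behind the regularity proofs below: it suffices to name candidate partials
  of class C^k. Openness of \<open>S\<close> matters because \<open>g i\<close> and
  \<open>pderiv_coord i f\<close> agree on \<open>S\<close> only.\<close>

lemma Ck_on_SucI:
  fixes f :: "real^'n::finite \<Rightarrow> real"
  assumes "open S" "continuous_on S f" 
    "\<And>i x. x \<in> S \<Longrightarrow> ((\<lambda>t. f (x + t *\<^sub>R axis i 1)) has_real_derivative g i x) (at 0)"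
    "\<And>i. Ck_on k S (g i)"
  shows "Ck_on (Suc k) S f"
proof (rule Ck_on_Suc_pderiv)
  have *: "pderiv_coord i f x = g i x" if "x \<in> S" for i x
    by (rule pderiv_coord_eqI) (rule assms(3)[OF that])
  show "((\<lambda>t. f (x + t *\<^sub>R axis i 1)) has_real_derivative pderiv_coord i f x) (at 0)" if "x \<in> S" for i x
    using assms(3)[OF that] *[OF that] by metis
  show "Ck_on k S (pderiv_coord i f)" for i
    using Ck_on_cong[OF assms(1), of "pderiv_coord i f" "g i" k] assms(4)[of i] * by blast
qed (use assms in simp)

lemma Ck_on_add:
  fixes f g :: "real^'n::finite \<Rightarrow> real"
  assumes "open S" "Ck_on k S f" "Ck_on k S g"
  shows "Ck_on k S (\<lambda>x. f x + g x)"
  using assms(2,3)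
proof (induction k arbitrary: f g)
  case 0
  then show ?case by (simp add: Ck_on_0 continuous_on_add)
next
  case (Suc k)
  show ?case
  proof (rule Ck_on_SucI[OF assms(1), where g="\<lambda>i x. pderiv_coord i f x + pderiv_coord i g x"])
    fix i
    show "Ck_on k S (\<lambda>x. pderiv_coord i f x + pderiv_coord i g x)"
      by (intro Suc.IH Ck_on_Suc_D[OF Suc.prems(1)] Ck_on_Suc_D[OF Suc.prems(2)])
    fix x assume x: "x \<in> S"
    show "((\<lambda>t. f (x + t *\<^sub>R axis i 1) + g (x + t *\<^sub>R axis i 1)) has_real_derivative
           pderiv_coord i f x + pderiv_coord i g x) (at 0)"
      by (intro DERIV_add Ck_on_DERIV[OF Suc.prems(1) x] Ck_on_DERIV[OF Suc.prems(2) x])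
  qed (intro continuous_on_add Ck_on_continuous[OF Suc.prems(1)] Ck_on_continuous[OF Suc.prems(2)])
qed

lemma Ck_on_const:
  fixes c :: real and S :: "(real^'n::finite) set"
  assumes "open S"
  shows "Ck_on k S (\<lambda>x. c)"
proof (induction k arbitrary: c)
  case 0
  then show ?case by (simp add: Ck_on_0)
next
  case (Suc k)
  show ?case
    by (rule Ck_on_SucI[OF assms(1), where g="\<lambda>i x. 0"]) (simp_all add: Suc.IH)
qed

lemma Ck_on_mult:
  fixes f g :: "real^'n::finite \<Rightarrow> real"
  assumes "open S" "Ck_on k S f" "Ck_on k S g"
  shows "Ck_on k S (\<lambda>x. f x * g x)"
  using assms(2,3)
proof (induction k arbitrary: f g)
  case 0
  then show ?case by (simp add: Ck_on_0 continuous_on_mult)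
next
  case (Suc k)
  have m: "Ck_on k S f" "Ck_on k S g"
    using Suc.prems Ck_on_mono by (metis le_SucI order_refl)+
  show ?case
  proof (rule Ck_on_SucI[OF assms(1), where g="\<lambda>i x. pderiv_coord i f x * g x + f x * pderiv_coord i g x"])
    fix i
    show "Ck_on k S (\<lambda>x. pderiv_coord i f x * g x + f x * pderiv_coord i g x)"
      by (intro Ck_on_add[OF assms(1)] Suc.IH m Ck_on_Suc_D[OF Suc.prems(1)] Ck_on_Suc_D[OF Suc.prems(2)])
    fix x assume x: "x \<in> S"
    show "((\<lambda>t. f (x + t *\<^sub>R axis i 1) * g (x + t *\<^sub>R axis i 1)) has_real_derivative
           pderiv_coord i f x * g x + f x * pderiv_coord i g x) (at 0)"
      using DERIV_mult[OF Ck_on_DERIV[OF Suc.prems(1) x, of i] Ck_on_DERIV[OF Suc.prems(2) x, of i]]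
      by (simp add: mult.commute add.commute)
  qed (intro continuous_on_mult Ck_on_continuous[OF Suc.prems(1)] Ck_on_continuous[OF Suc.prems(2)])
qed

lemma Ck_on_cmult:
  fixes f :: "real^'n::finite \<Rightarrow> real"
  assumes "open S" "Ck_on k S f"
  shows "Ck_on k S (\<lambda>x. c * f x)"
  by (rule Ck_on_mult[OF assms(1) Ck_on_const[OF assms(1)] assms(2)])

lemma Ck_on_sum:
  fixes f :: "'a \<Rightarrow> real^'n::finite \<Rightarrow> real"
  assumes "open S" "\<And>a. a \<in> A \<Longrightarrow> Ck_on k S (f a)"
  shows "Ck_on k S (\<lambda>x. \<Sum>a\<in>A. f a x)"
  using assms(2)
  by (induction A rule: infinite_finite_induct) (auto intro: Ck_on_add[OF assms(1)] Ck_on_const[OF assms(1)])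

text \<open>The outer function is given as a tower \<open>h 0, h 1, ...\<close> of successive
  derivatives, so the induction merely shifts the tower and needs no closed form for higher
  derivatives of a composition.\<close>

lemma Ck_on_compose:
  fixes f :: "real^'n::finite \<Rightarrow> real"
  assumes "open S" "Ck_on k S f" "\<And>x. x \<in> S \<Longrightarrow> f x \<in> U"
    and "\<And>j. j \<le> k \<Longrightarrow> continuous_on U (h j)"
    and "\<And>j s. j < k \<Longrightarrow> s \<in> U \<Longrightarrow> (h j has_real_derivative h (Suc j) s) (at s)"
  shows "Ck_on k S (\<lambda>x. h 0 (f x))"
  using assms(2-)
proof (induction k arbitrary: h)
  case 0
  then have "continuous_on U (h 0)" "continuous_on S f" "f ` S \<subseteq> U"
    by (auto simp: Ck_on_0)
  then show ?case unfolding Ck_on_0 by (rule continuous_on_compose2)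
next
  case (Suc k)
  have m: "Ck_on k S f"
    using Suc.prems Ck_on_mono by (metis le_SucI order_refl)
  show ?case
  proof (rule Ck_on_SucI[OF assms(1), where g="\<lambda>i x. h 1 (f x) * pderiv_coord i f x"])
    show "continuous_on S (\<lambda>x. h 0 (f x))"
      by (rule continuous_on_compose2[OF Suc.prems(3) Ck_on_continuous[OF Suc.prems(1)]]) (use Suc.prems(2) in auto)
    show "Ck_on k S (\<lambda>x. h 1 (f x) * pderiv_coord i f x)" for i
    proof (rule Ck_on_mult[OF assms(1) _ Ck_on_Suc_D[OF Suc.prems(1)]])
      have "Ck_on k S (\<lambda>x. (\<lambda>j. h (Suc j)) 0 (f x))"
        by (rule Suc.IH[of "\<lambda>j. h (Suc j)"]) (use Suc.prems m in auto)
      then show "Ck_on k S (\<lambda>x. h 1 (f x))" by simp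
    qed
    fix i x assume x: "x \<in> S"
    have d: "(h 0 has_real_derivative h 1 (f x)) (at (f (x + 0 *\<^sub>R axis i 1)))"
      using Suc.prems(4)[of 0 "f x"] Suc.prems(2)[OF x] by simp
    show "((\<lambda>t. h 0 (f (x + t *\<^sub>R axis i 1))) has_real_derivative h 1 (f x) * pderiv_coord i f x) (at 0)"
      by (rule DERIV_chain2[where g="\<lambda>t. f (x + t *\<^sub>R axis i 1)", OF d Ck_on_DERIV[OF Suc.prems(1) x]])
  qed
qed

lemma Ck_on_coord:
  assumes "open (S::(real^'n::finite) set)"
  shows "Ck_on k S (\<lambda>x. x $ i)"
proof (cases k)
  case 0
  then show ?thesis by (simp add: Ck_on_0 continuous_on_component continuous_on_id)
next
  case (Suc j)
  show ?thesis unfolding Suc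
  proof (rule Ck_on_SucI[OF assms, where g="\<lambda>j x. axis j 1 $ i"])
    show "((\<lambda>t. (x + t *\<^sub>R axis j 1) $ i) has_real_derivative axis j 1 $ i) (at 0)" for j x
      by (auto intro!: derivative_eq_intros)
  qed (simp_all add: Ck_on_const[OF assms] continuous_on_component continuous_on_id)
qed

lemma Ck_on_inner_self:
  assumes "open (S::(real^'n::finite) set)"
  shows "Ck_on k S (\<lambda>x. x \<bullet> x)"
  unfolding inner_vec_def inner_real_def
  by (intro Ck_on_sum Ck_on_mult Ck_on_coord assms)

lemma Ck_on_union:
  assumes "open S" "open T" "Ck_on k S f" "Ck_on k T f"
  shows "Ck_on k (S \<union> T) f"
  using assms unfolding Ck_on_def by (auto intro: continuous_on_open_Un)

lemma Ck_on_Dlist: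
  "Ck_on k S f \<Longrightarrow> length is + j \<le> k \<Longrightarrow> Ck_on j S (Dlist is f)"
proof (induction "is" arbitrary: k f rule: rev_induct)
  case Nil
  then show ?case using Ck_on_mono by fastforce
next
  case (snoc i "is")
  then obtain k' where k: "k = Suc k'" by (cases k) auto
  show ?case using snoc.IH[OF Ck_on_Suc_D[OF snoc.prems(1)[unfolded k]]] snoc.prems(2) k
    by (simp add: Dlist_snoc)
qed

lemma pderiv_coord_sum:
  fixes f :: "'a \<Rightarrow> real^'n::finite \<Rightarrow> real"
  assumes "\<And>a. a \<in> A \<Longrightarrow> Ck_on 1 S (f a)" "x \<in> S"
  shows "pderiv_coord i (\<lambda>x. \<Sum>a\<in>A. f a x) x = (\<Sum>a\<in>A. pderiv_coord i (f a) x)"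
  by (rule pderiv_coord_eqI)
     (intro DERIV_sum Ck_on_DERIV[where k=0 and S=S], use assms in simp_all)

lemma pderiv_coord_cmult:
  fixes f :: "real^'n::finite \<Rightarrow> real"
  assumes "Ck_on 1 S f" "x \<in> S"
  shows "pderiv_coord i (\<lambda>x. c * f x) x = c * pderiv_coord i f x"
  by (rule pderiv_coord_eqI, rule DERIV_cmult) (use Ck_on_DERIV[of 0, OF _ assms(2)] assms(1) in simp)

lemma Dlist_sum:
  fixes f :: "'a \<Rightarrow> real^'n::finite \<Rightarrow> real"
  assumes "open S" "\<And>a. a \<in> A \<Longrightarrow> Ck_on (length is) S (f a)" "x \<in> S"
  shows "Dlist is (\<lambda>x. \<Sum>a\<in>A. f a x) x = (\<Sum>a\<in>A. Dlist is (f a) x)"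
  using assms(2,3)
proof (induction "is" arbitrary: x)
  case (Cons i "is")
  have "Dlist (i # is) (\<lambda>x. \<Sum>a\<in>A. f a x) x = pderiv_coord i (\<lambda>x. \<Sum>a\<in>A. Dlist is (f a) x) x"
    by (simp, rule pderiv_coord_cong[OF assms(1) Cons.prems(2)], rule Cons.IH)
       (auto intro: Ck_on_mono[OF Cons.prems(1)])
  also have "\<dots> = (\<Sum>a\<in>A. Dlist (i # is) (f a) x)"
    by (subst pderiv_coord_sum[of _ S]) (use Cons.prems in \<open>auto intro!: Ck_on_Dlist[OF Cons.prems(1)]\<close>)
  finally show ?case .
qed auto

lemma Dlist_cmult:
  fixes f :: "real^'n::finite \<Rightarrow> real"
  assumes "open S" "Ck_on (length is) S f" "x \<in> S"
  shows "Dlist is (\<lambda>x. c * f x) x = c * Dlist is f x"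
  using assms(2,3)
proof (induction "is" arbitrary: x)
  case (Cons i "is")
  have "Dlist (i # is) (\<lambda>x. c * f x) x = pderiv_coord i (\<lambda>x. c * Dlist is f x) x"
    by (simp, rule pderiv_coord_cong[OF assms(1) Cons.prems(2)], rule Cons.IH)
       (auto intro: Ck_on_mono[OF Cons.prems(1)])
  also have "\<dots> = c * (Dlist (i # is) f x)"
    by (subst pderiv_coord_cmult[of S]) (use Cons.prems in \<open>auto intro!: Ck_on_Dlist[OF Cons.prems(1)]\<close>)
  finally show ?case .
qed auto

subsection \<open>The iterated Laplacian\<close>

lemma laplacian_cong:
  fixes f g :: "real^'n::finite \<Rightarrow> real"
  assumes "open S" "\<And>y. y \<in> S \<Longrightarrow> f y = g y" "x \<in> S"
  shows "laplacian f x = laplacian g x"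
  unfolding laplacian_def by (intro sum.cong refl Dlist_cong[OF assms]) auto

lemma poly_laplacian_0: "poly_laplacian 0 f = f"
  by (simp add: poly_laplacian_def)

lemma poly_laplacian_Suc: "poly_laplacian (Suc m) f = laplacian (poly_laplacian m f)"
  by (simp add: poly_laplacian_def)

lemma poly_laplacian_Suc': "poly_laplacian (Suc m) f = poly_laplacian m (laplacian f)"
  by (simp add: poly_laplacian_def funpow_swap1)

lemma poly_laplacian_cong:
  fixes f g :: "real^'n::finite \<Rightarrow> real"
  assumes "open S" "\<And>y. y \<in> S \<Longrightarrow> f y = g y" "x \<in> S"
  shows "poly_laplacian m f x = poly_laplacian m g x"
  using assms(3)
proof (induction m arbitrary: x)
  case (Suc m)
  then show ?case using laplacian_cong[OF assms(1) Suc.IH Suc.prems] by (simp add: poly_laplacian_Suc)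
qed (use assms in \<open>auto simp: poly_laplacian_0\<close>)

lemma Ck_on_laplacian:
  assumes "open S" "Ck_on k S f" "j + 2 \<le> k"
  shows "Ck_on j S (laplacian f)"
proof -
  have "Ck_on j S (\<lambda>x. \<Sum>i\<in>UNIV. Dlist [i, i] f x)"
    by (intro Ck_on_sum assms(1) Ck_on_Dlist[OF assms(2)]) (use assms(3) in auto)
  then show ?thesis by (simp add: laplacian_def[abs_def])
qed

lemma Ck_on_poly_laplacian:
  assumes "open S" "Ck_on k S f" "j + 2 * m \<le> k"
  shows "Ck_on j S (poly_laplacian m f)"
  using assms(3)
proof (induction m arbitrary: j)
  case 0
  then show ?case using assms(2) Ck_on_mono[of k S f j S] by (simp add: poly_laplacian_0)
next
  case (Suc m)
  have "Ck_on (j + 2) S (poly_laplacian m f)" by (rule Suc.IH) (use Suc.prems in simp)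
  then show ?case unfolding poly_laplacian_Suc by (rule Ck_on_laplacian[OF assms(1)]) simp
qed

lemma laplacian_sum:
  fixes f :: "'a \<Rightarrow> real^'n::finite \<Rightarrow> real"
  assumes "open S" "\<And>a. a \<in> A \<Longrightarrow> Ck_on 2 S (f a)" "x \<in> S"
  shows "laplacian (\<lambda>x. \<Sum>a\<in>A. f a x) x = (\<Sum>a\<in>A. laplacian (f a) x)"
proof -
  have "laplacian (\<lambda>x. \<Sum>a\<in>A. f a x) x = (\<Sum>i\<in>UNIV. \<Sum>a\<in>A. Dlist [i, i] (f a) x)"
    unfolding laplacian_def
    by (intro sum.cong refl Dlist_sum[OF assms(1) _ assms(3)]) (use assms(2) in \<open>simp add: numeral_2_eq_2\<close>)
  also have "\<dots> = (\<Sum>a\<in>A. laplacian (f a) x)" unfolding laplacian_def by (rule sum.swap)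
  finally show ?thesis .
qed

lemma laplacian_cmult:
  fixes f :: "real^'n::finite \<Rightarrow> real"
  assumes "open S" "Ck_on 2 S f" "x \<in> S"
  shows "laplacian (\<lambda>x. c * f x) x = c * laplacian f x"
  unfolding laplacian_def sum_distrib_left
  by (intro sum.cong refl Dlist_cmult[OF assms(1) _ assms(3)]) (use assms(2) in \<open>simp add: numeral_2_eq_2\<close>)

lemma poly_laplacian_sum:
  fixes f :: "'a \<Rightarrow> real^'n::finite \<Rightarrow> real"
  assumes "open S" "\<And>a. a \<in> A \<Longrightarrow> Ck_on (2 * m) S (f a)" "x \<in> S"
  shows "poly_laplacian m (\<lambda>x. \<Sum>a\<in>A. f a x) x = (\<Sum>a\<in>A. poly_laplacian m (f a) x)"
  using assms(2,3)
proof (induction m arbitrary: x)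
  case (Suc m)
  have "poly_laplacian (Suc m) (\<lambda>x. \<Sum>a\<in>A. f a x) x = laplacian (\<lambda>x. \<Sum>a\<in>A. poly_laplacian m (f a) x) x"
    unfolding poly_laplacian_Suc
    by (rule laplacian_cong[OF assms(1) Suc.IH Suc.prems(2)]) (auto intro: Ck_on_mono[OF Suc.prems(1)])
  also have "\<dots> = (\<Sum>a\<in>A. laplacian (poly_laplacian m (f a)) x)"
    by (rule laplacian_sum[OF assms(1) Ck_on_poly_laplacian[OF assms(1) Suc.prems(1)] Suc.prems(2)]) auto
  finally show ?case by (simp add: poly_laplacian_Suc)
qed (auto simp: poly_laplacian_0)

lemma poly_laplacian_cmult:
  fixes f :: "real^'n::finite \<Rightarrow> real"
  assumes "open S" "Ck_on (2 * m) S f" "x \<in> S"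
  shows "poly_laplacian m (\<lambda>x. c * f x) x = c * poly_laplacian m f x"
  using assms(2,3)
proof (induction m arbitrary: x)
  case (Suc m)
  have "poly_laplacian (Suc m) (\<lambda>x. c * f x) x = laplacian (\<lambda>x. c * poly_laplacian m f x) x"
    unfolding poly_laplacian_Suc
    by (rule laplacian_cong[OF assms(1) Suc.IH Suc.prems(2)]) (auto intro: Ck_on_mono[OF Suc.prems(1)])
  also have "\<dots> = c * laplacian (poly_laplacian m f) x"
    by (rule laplacian_cmult[OF assms(1) Ck_on_poly_laplacian[OF assms(1) Suc.prems(1)] Suc.prems(2)]) auto
  finally show ?case by (simp add: poly_laplacian_Suc)
qed (auto simp: poly_laplacian_0)

section \<open>Symmetry of mixed derivatives and commutation with the Laplacian\<close>

lemma DERIV_line: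
  fixes f :: "real^'n::finite \<Rightarrow> real"
  assumes "Ck_on (Suc k) UNIV f"
  shows "((\<lambda>t. f (x + t *\<^sub>R axis i 1)) has_real_derivative pderiv_coord i f (x + t *\<^sub>R axis i 1)) (at t)"
  using Ck_on_DERIV[OF assms, of "x + t *\<^sub>R axis i 1" i]
    DERIV_shift[of "\<lambda>t. f (x + t *\<^sub>R axis i 1)" "pderiv_coord i f (x + t *\<^sub>R axis i 1)" 0 t]
  by (simp add: algebra_simps)

text \<open>The second difference is symmetric in the two coordinate directions, so that applying the mean
  value theorem in either order identifies the two mixed derivatives in the limit.\<close>

lemma second_difference_mvt:
  fixes f :: "real^'n::finite \<Rightarrow> real"
  assumes "Ck_on 2 UNIV f" "h > 0"
  shows "\<exists>a b. 0 < a \<and> a < h \<and> 0 < b \<and> b < h \<and>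
     f (x + h *\<^sub>R axis i 1 + h *\<^sub>R axis j 1) - f (x + h *\<^sub>R axis i 1) - f (x + h *\<^sub>R axis j 1) + f x
     = h\<^sup>2 * pderiv_coord j (pderiv_coord i f) (x + a *\<^sub>R axis i 1 + b *\<^sub>R axis j 1)"
proof -
  have f: "Ck_on (Suc 1) UNIV f" using assms by (simp add: numeral_2_eq_2)
  let ?G = "\<lambda>t. f (x + h *\<^sub>R axis j 1 + t *\<^sub>R axis i 1) - f (x + t *\<^sub>R axis i 1)"
  have "\<exists>a. a > 0 \<and> a < h \<and> ?G h - ?G 0 = (h - 0) * 
     (pderiv_coord i f (x + h *\<^sub>R axis j 1 + a *\<^sub>R axis i 1) - pderiv_coord i f (x + a *\<^sub>R axis i 1))"
    by (rule MVT2[OF assms(2)]) (intro DERIV_diff DERIV_line[OF f])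
  then obtain a where a: "a > 0" "a < h" and 1: "?G h - ?G 0 = (h - 0) * 
     (pderiv_coord i f (x + h *\<^sub>R axis j 1 + a *\<^sub>R axis i 1) - pderiv_coord i f (x + a *\<^sub>R axis i 1))" by blast
  let ?H = "\<lambda>t. pderiv_coord i f (x + a *\<^sub>R axis i 1 + t *\<^sub>R axis j 1)"
  have "\<exists>b. b > 0 \<and> b < h \<and> ?H h - ?H 0 = (h - 0) * 
     pderiv_coord j (pderiv_coord i f) (x + a *\<^sub>R axis i 1 + b *\<^sub>R axis j 1)"
    by (rule MVT2[OF assms(2)]) (intro DERIV_line[of 0], use Ck_on_Suc_D[OF f] in simp)
  then obtain b where b: "b > 0" "b < h" and 2: "?H h - ?H 0 = (h - 0) * 
     pderiv_coord j (pderiv_coord i f) (x + a *\<^sub>R axis i 1 + b *\<^sub>R axis j 1)" by blast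
  show ?thesis
    by (rule exI[of _ a], rule exI[of _ b]) (use a b 1 2 in \<open>simp add: algebra_simps power2_eq_square\<close>)
qed

lemma pderiv_coord_commute:
  fixes f :: "real^'n::finite \<Rightarrow> real"
  assumes "Ck_on 2 UNIV f"
  shows "pderiv_coord i (pderiv_coord j f) x = pderiv_coord j (pderiv_coord i f) x"
proof -
  have f: "Ck_on (Suc 1) UNIV f" using assms by (simp add: numeral_2_eq_2)
  have c: "continuous_on UNIV (pderiv_coord j (pderiv_coord i f))" for i j
    using Ck_on_Suc_D[of 0] Ck_on_Suc_D[OF f] by (metis Ck_on_continuous One_nat_def)
  define h where "h = (\<lambda>k. inverse (real (Suc k)))"
  have h: "h k > 0" for k by (simp add: h_def)
  have h0: "h \<longlonglongrightarrow> 0" unfolding h_def by (rule LIMSEQ_inverse_real_of_nat)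
  let ?D = "\<lambda>h. f (x + h *\<^sub>R axis i 1 + h *\<^sub>R axis j 1) - f (x + h *\<^sub>R axis i 1) - f (x + h *\<^sub>R axis j 1) + f x"
  \<comment> \<open>Both orders of \<open>i\<close> and \<open>j\<close> are treated at once: the
    second difference \<open>?D\<close> is the same expression for either, only the mean value
    points differ.\<close>
  have lim: "(\<lambda>k. ?D (h k) / (h k)\<^sup>2) \<longlonglongrightarrow> pderiv_coord q (pderiv_coord p f) x"
    if pq: "(p, q) = (i, j) \<or> (p, q) = (j, i)" for p q
  proof -
    have "\<forall>k. \<exists>a b. 0 < a \<and> a < h k \<and> 0 < b \<and> b < h k \<and>
       ?D (h k) / (h k)\<^sup>2 = pderiv_coord q (pderiv_coord p f) (x + a *\<^sub>R axis p 1 + b *\<^sub>R axis q 1)"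
    proof
      fix k
      from second_difference_mvt[OF assms h[of k], of x p q] obtain a b where
        "0 < a \<and> a < h k \<and> 0 < b \<and> b < h k \<and>
        f (x + h k *\<^sub>R axis p 1 + h k *\<^sub>R axis q 1) - f (x + h k *\<^sub>R axis p 1) - f (x + h k *\<^sub>R axis q 1) + f x
     = (h k)\<^sup>2 * pderiv_coord q (pderiv_coord p f) (x + a *\<^sub>R axis p 1 + b *\<^sub>R axis q 1)" by blast
      then show "\<exists>a b. 0 < a \<and> a < h k \<and> 0 < b \<and> b < h k \<and>
       ?D (h k) / (h k)\<^sup>2 = pderiv_coord q (pderiv_coord p f) (x + a *\<^sub>R axis p 1 + b *\<^sub>R axis q 1)"
        using pq h[of k] by (intro exI[of _ a] exI[of _ b]) (auto simp: field_simps)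
    qed
    then obtain a b where ab: "\<And>k. 0 < a k" "\<And>k. a k < h k" "\<And>k. 0 < b k" "\<And>k. b k < h k"
      and e: "\<And>k. ?D (h k) / (h k)\<^sup>2 = pderiv_coord q (pderiv_coord p f) (x + a k *\<^sub>R axis p 1 + b k *\<^sub>R axis q 1)"
      by metis
    have "a \<longlonglongrightarrow> 0" by (rule tendsto_sandwich[OF _ _ tendsto_const h0]) (auto intro!: always_eventually less_imp_le ab)
    moreover have "b \<longlonglongrightarrow> 0" by (rule tendsto_sandwich[OF _ _ tendsto_const h0]) (auto intro!: always_eventually less_imp_le ab)
    ultimately have "(\<lambda>k. x + a k *\<^sub>R axis p 1 + b k *\<^sub>R axis q 1) \<longlonglongrightarrow> x + 0 *\<^sub>R axis p 1 + 0 *\<^sub>R axis q 1"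
      by (intro tendsto_intros)
    then have l: "(\<lambda>k. x + a k *\<^sub>R axis p 1 + b k *\<^sub>R axis q 1) \<longlonglongrightarrow> x" by simp
    show ?thesis unfolding e
      by (rule continuous_on_tendsto_compose[OF c l]) auto
  qed
  show ?thesis
    using LIMSEQ_unique[OF lim[of j i] lim[of i j]] by simp
qed

lemma laplacian_pderiv_commute:
  fixes f :: "real^'n::finite \<Rightarrow> real"
  assumes "Ck_on 3 UNIV f"
  shows "laplacian (pderiv_coord i f) x = pderiv_coord i (laplacian f) x"
proof -
  have f: "Ck_on (Suc 2) UNIV f" using assms by (simp add: numeral_3_eq_3)
  have c2: "Ck_on 2 UNIV f" using assms by (rule Ck_on_mono) auto
  have "pderiv_coord i (laplacian f) x = (\<Sum>j\<in>UNIV. pderiv_coord i (Dlist [j, j] f) x)"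
    unfolding laplacian_def[abs_def]
    by (rule pderiv_coord_sum[of _ UNIV]) (auto intro!: Ck_on_Dlist[OF assms, of "[_, _]" 1, simplified])
  also have "\<dots> = (\<Sum>j\<in>UNIV. Dlist [j, j] (pderiv_coord i f) x)"
  proof (rule sum.cong[OF refl])
    fix j
    have 1: "pderiv_coord i (pderiv_coord j f) = pderiv_coord j (pderiv_coord i f)"
      using pderiv_coord_commute[OF c2] by blast
    show "pderiv_coord i (Dlist [j, j] f) x = Dlist [j, j] (pderiv_coord i f) x"
      using pderiv_coord_commute[OF Ck_on_Suc_D[OF f], of i j] 1 by simp
  qed
  finally show ?thesis unfolding laplacian_def by simp
qed

lemma laplacian_Dlist_commute:
  fixes f :: "real^'n::finite \<Rightarrow> real"
  assumes "Ck_on (length is + 2) UNIV f"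
  shows "laplacian (Dlist is f) = Dlist is (laplacian f)"
  using assms
proof (induction "is")
  case (Cons i "is")
  have "laplacian (Dlist (i # is) f) x = pderiv_coord i (laplacian (Dlist is f)) x" for x
    by simp (rule laplacian_pderiv_commute, rule Ck_on_Dlist[OF Cons.prems], simp)
  then show ?case using Cons.IH Ck_on_mono[OF Cons.prems] by (auto simp: fun_eq_iff)
qed auto

text \<open>Meant for the kernel, which has \<open>length is + 2 * m\<close> derivatives on the
  whole space. It is not applied to the solution, which has only \<open>2 * m\<close>.\<close>

lemma poly_laplacian_Dlist_commute:
  fixes f :: "real^'n::finite \<Rightarrow> real"
  assumes "Ck_on (length is + 2 * m) UNIV f"
  shows "poly_laplacian m (Dlist is f) = Dlist is (poly_laplacian m f)"
  using assms
proof (induction m)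
  case (Suc m)
  have "poly_laplacian (Suc m) (Dlist is f) = laplacian (Dlist is (poly_laplacian m f))"
    unfolding poly_laplacian_Suc using Suc.IH Ck_on_mono[OF Suc.prems] by auto
  also have "\<dots> = Dlist is (poly_laplacian (Suc m) f)"
    unfolding poly_laplacian_Suc
    by (rule laplacian_Dlist_commute, rule Ck_on_poly_laplacian[OF open_UNIV Suc.prems]) simp
  finally show ?case .
qed (simp add: poly_laplacian_0)

subsection \<open>Integration by parts against compactly supported functions\<close>

text \<open>\<open>v\<close> may behave arbitrarily off \<open>S\<close>, for instance at the
  singular point. The open sets \<open>S\<close> and \<open>- K\<close> cover the space, and the
  product vanishes on the second.\<close>

lemma continuous_mult_compact_support:
  fixes v g :: "'a::t2_space \<Rightarrow> real"
  assumes "open S" "continuous_on S v" "compact K" "K \<subseteq> S" "continuous_on UNIV g" "\<And>x. x \<notin> K \<Longrightarrow> g x = 0"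
  shows "continuous_on UNIV (\<lambda>x. v x * g x)"
proof -
  have "continuous_on (S \<union> - K) (\<lambda>x. v x * g x)"
  proof (rule continuous_on_open_Un)
    show "continuous_on S (\<lambda>x. v x * g x)"
      by (intro continuous_on_mult assms(2) continuous_on_subset[OF assms(5)]) auto
    show "continuous_on (- K) (\<lambda>x. v x * g x)"
      by (subst continuous_on_cong[OF refl, where g="\<lambda>x. 0"]) (auto simp: assms(6))
  qed (use assms in \<open>auto intro: compact_imp_closed\<close>)
  moreover have "S \<union> - K = UNIV" using assms(4) by auto
  ultimately show ?thesis by simp
qed

lemma integrable_compact_support:
  fixes g :: "'a::euclidean_space \<Rightarrow> real"
  assumes "continuous_on K g" "compact K" "\<And>x. x \<notin> K \<Longrightarrow> g x = 0"
  shows "integrable lborel g"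
proof -
  have "integrable lborel (\<lambda>x. indicator K x *\<^sub>R g x)"
    by (rule borel_integrable_compact[OF assms(2,1)])
  moreover have "(\<lambda>x. indicator K x *\<^sub>R g x) = g"
    using assms(3) by (auto simp: fun_eq_iff indicator_def)
  ultimately show ?thesis by simp
qed

lemma integral_lborel_cbox:
  fixes g :: "'a::euclidean_space \<Rightarrow> real"
  assumes "continuous_on UNIV g" "\<And>x. x \<notin> cbox a b \<Longrightarrow> g x = 0"
  shows "integral\<^sup>L lborel g = integral (cbox a b) g"
proof -
  have "integrable lborel g"
    by (rule integrable_compact_support[OF continuous_on_subset[OF assms(1)] compact_cbox assms(2)]) auto
  then have "integral\<^sup>L lborel g = integral UNIV g" by (simp add: integral_lborel)
  moreover have "g = (\<lambda>x. if x \<in> cbox a b then g x else 0)" using assms(2) by auto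
  ultimately show ?thesis using integral_restrict_UNIV[of "cbox a b" g] by simp
qed

text \<open>Compact support reduces the integrals to a box, where the Leibniz rule applies. The
  derivative \<open>F'\<close> inherits the support because \<open>F\<close> vanishes off
  \<open>K\<close> for all parameters in the interval.\<close>

lemma DERIV_integral_compact_support:
  fixes F F' :: "real \<Rightarrow> 'a::euclidean_space \<Rightarrow> real"
  assumes "t0 \<in> {a<..<b}" "compact K"
    and D: "\<And>t y. t \<in> {a<..<b} \<Longrightarrow> ((\<lambda>t. F t y) has_real_derivative F' t y) (at t)"
    and c': "continuous_on ({a<..<b} \<times> UNIV) (\<lambda>(t, y). F' t y)"
    and c: "\<And>t. t \<in> {a<..<b} \<Longrightarrow> continuous_on UNIV (F t)"
    and supp: "\<And>t y. t \<in> {a<..<b} \<Longrightarrow> y \<notin> K \<Longrightarrow> F t y = 0"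
  shows "((\<lambda>t. integral\<^sup>L lborel (F t)) has_real_derivative integral\<^sup>L lborel (F' t0)) (at t0)"
proof -
  obtain p where p: "K \<subseteq> cbox (-p) p"
    using bounded_subset_cbox_symmetric[OF compact_imp_bounded[OF assms(2)]] by blast
  have s': "F' t y = 0" if "t \<in> {a<..<b}" "y \<notin> K" for t y
  proof -
    have "((\<lambda>t. 0) has_real_derivative F' t y) (at t) \<longleftrightarrow> ((\<lambda>t. F t y) has_real_derivative F' t y) (at t)"
      by (rule DERIV_cong_ev) (use that supp in \<open>auto intro!: eventually_nhds_in_open[of "{a<..<b}", THEN eventually_mono]\<close>)
    then have "((\<lambda>t. 0) has_real_derivative F' t y) (at t)" using D[OF that(1)] by simp
    then show ?thesis by (rule DERIV_unique[OF _ DERIV_const])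
  qed
  have c2: "continuous_on UNIV (F' t)" if "t \<in> {a<..<b}" for t
    by (rule continuous_on_compose2[OF c', of _ "\<lambda>y. (t, y)", simplified]) (use that in \<open>auto intro!: continuous_intros\<close>)
  have "((\<lambda>t. integral (cbox (-p) p) (F t)) has_real_derivative integral (cbox (-p) p) (F' t0)) (at t0 within {a<..<b})"
  proof (rule leibniz_rule_field_derivative)
    fix t y assume "t \<in> {a<..<b}"
    then show "((\<lambda>x. F x y) has_real_derivative F' t y) (at t within {a<..<b})"
      by (rule DERIV_subset[OF D]) auto
  next
    show "F t integrable_on cbox (-p) p" if "t \<in> {a<..<b}" for t
      by (rule integrable_continuous, rule continuous_on_subset[OF c[OF that]]) auto
    show "continuous_on ({a<..<b} \<times> cbox (-p) p) (\<lambda>(x, t). F' x t)"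
      by (rule continuous_on_subset[OF c']) auto
  qed (use assms(1) in auto)
  then have "((\<lambda>t. integral (cbox (-p) p) (F t)) has_real_derivative integral (cbox (-p) p) (F' t0)) (at t0)"
    unfolding at_within_open[OF assms(1) open_greaterThanLessThan] .
  moreover have "integral\<^sup>L lborel (F t) = integral (cbox (-p) p) (F t)" if "t \<in> {a<..<b}" for t
    by (rule integral_lborel_cbox[OF c[OF that]]) (use supp[OF that] p in auto)
  moreover have "integral\<^sup>L lborel (F' t0) = integral (cbox (-p) p) (F' t0)"
    by (rule integral_lborel_cbox[OF c2[OF assms(1)]]) (use s'[OF assms(1)] p in auto)
  moreover have "((\<lambda>t. integral\<^sup>L lborel (F t)) has_real_derivative d) (at t0) \<longleftrightarrow>
     ((\<lambda>t. integral (cbox (-p) p) (F t)) has_real_derivative d) (at t0)" for d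
    by (rule DERIV_cong_ev) 
      (use assms(1) calculation(2) in \<open>auto intro!: eventually_nhds_in_open[of "{a<..<b}", THEN eventually_mono]\<close>)
  ultimately show ?thesis by simp
qed

lemma lborel_integral_translate:
  fixes g :: "'a::euclidean_space \<Rightarrow> real"
  assumes "g \<in> borel_measurable borel"
  shows "(\<integral>y. g (y + c) \<partial>lborel) = (\<integral>y. g y \<partial>lborel)"
proof -
  have "(\<integral>y. g y \<partial>lborel) = (\<integral>y. g y \<partial>(distr lborel borel ((+) c)))"
    by (simp add: lborel_distr_plus)
  also have "\<dots> = (\<integral>y. g (c + y) \<partial>lborel)"
    by (rule integral_distr) (use assms in auto)
  finally show ?thesis by (simp add: add.commute)
qed

text \<open>By translation invariance the integral of the shifted function \<open>w\<close> does not
  depend on the shift; the integral of \<open>w'\<close> is its derivative with respect to the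
  shift.\<close>

lemma integral_directional_derivative_zero:
  fixes w w' :: "real^'n::finite \<Rightarrow> real"
  assumes "compact K" "continuous_on UNIV w" "continuous_on UNIV w'" "\<And>x. x \<notin> K \<Longrightarrow> w x = 0"
    and D: "\<And>x. ((\<lambda>t. w (x + t *\<^sub>R axis i 1)) has_real_derivative w' x) (at 0)"
  shows "(\<integral>y. w' y \<partial>lborel) = 0"
proof -
  let ?e = "axis i 1 :: real^'n"
  \<comment> \<open>One compact set that supports all translates by \<open>t\<close> in
    [-1, 1].\<close>
  define K' where "K' = (\<lambda>(x, t). x - t *\<^sub>R ?e) ` (K \<times> {-1..1::real})"
  have K': "compact K'" unfolding K'_def
    by (intro compact_continuous_image compact_Times assms(1) compact_Icc)
       (auto simp: case_prod_unfold intro!: continuous_intros)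
  have "((\<lambda>t. \<integral>y. w (y + t *\<^sub>R ?e) \<partial>lborel) has_real_derivative (\<integral>y. w' (y + 0 *\<^sub>R ?e) \<partial>lborel)) (at 0)"
  proof (rule DERIV_integral_compact_support[where a="-1" and b=1 and K=K' and F="\<lambda>t y. w (y + t *\<^sub>R ?e)" and F'="\<lambda>t y. w' (y + t *\<^sub>R ?e)"])
    fix t :: real and y assume t: "t \<in> {-1<..<1}"
    show "((\<lambda>t. w (y + t *\<^sub>R ?e)) has_real_derivative w' (y + t *\<^sub>R ?e)) (at t)"
      using D[of "y + t *\<^sub>R ?e"] DERIV_shift[of "\<lambda>t. w (y + t *\<^sub>R ?e)" "w' (y + t *\<^sub>R ?e)" 0 t]
      by (simp add: algebra_simps)
    show "w (y + t *\<^sub>R ?e) = 0" if "y \<notin> K'"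
    proof (rule assms(4))
      show "y + t *\<^sub>R ?e \<notin> K"
      proof
        assume "y + t *\<^sub>R ?e \<in> K"
        then have "(\<lambda>(x, t). x - t *\<^sub>R ?e) (y + t *\<^sub>R ?e, t) \<in> K'"
          unfolding K'_def by (rule imageI[OF SigmaI]) (use t in auto)
        then show False using that by simp
      qed
    qed
  next
    show "continuous_on ({- 1<..<1} \<times> UNIV) (\<lambda>(t, y). w' (y + t *\<^sub>R ?e))"
      unfolding case_prod_unfold by (rule continuous_on_compose2[OF assms(3)]) (auto intro!: continuous_intros)
    show "continuous_on UNIV (\<lambda>y. w (y + t *\<^sub>R ?e))" for t
      by (rule continuous_on_compose2[OF assms(2)]) (auto intro!: continuous_intros)
  qed (use K' in auto)
  moreover have "(\<integral>y. w (y + t *\<^sub>R ?e) \<partial>lborel) = (\<integral>y. w y \<partial>lborel)" for t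
    by (rule lborel_integral_translate) (use assms(2) in \<open>auto intro: borel_measurable_continuous_onI\<close>)
  ultimately have "((\<lambda>t::real. \<integral>y. w y \<partial>lborel) has_real_derivative (\<integral>y. w' y \<partial>lborel)) (at 0)"
    by simp
  then show ?thesis by (rule DERIV_unique[OF _ DERIV_const])
qed

lemma Dlist_zero: "Dlist is (\<lambda>x. 0) = (\<lambda>x. 0)"
  by (induction "is") (auto simp: pderiv_coord_def fun_eq_iff)

lemma Dlist_outside_support:
  assumes "closed K" "\<And>x. x \<notin> K \<Longrightarrow> f x = 0" "x \<notin> K"
  shows "Dlist is f x = 0"
  using Dlist_cong[of "- K" f "\<lambda>x. 0" x "is"] assms by (simp add: Dlist_zero open_Compl)

lemma laplacian_outside_support:
  assumes "closed K" "\<And>x. x \<notin> K \<Longrightarrow> f x = 0" "x \<notin> K"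
  shows "laplacian f x = 0"
  unfolding laplacian_def by (intro sum.neutral ballI Dlist_outside_support[of K]) (use assms in auto)

lemma poly_laplacian_outside_support:
  assumes "closed K" "\<And>x. x \<notin> K \<Longrightarrow> f x = 0" "x \<notin> K"
  shows "poly_laplacian m f x = 0"
  using assms(3)
  by (induction m arbitrary: x) 
     (auto simp: poly_laplacian_0 poly_laplacian_Suc assms(2) intro: laplacian_outside_support[OF assms(1)])

text \<open>The product of \<open>v\<close> and the test function, read as zero off the support, is
  differentiable everywhere: on \<open>S\<close> by the product rule, off \<open>S\<close> because
  it vanishes near the point. Its directional derivative has integral zero.\<close>

lemma ibp_pderiv:
  fixes v \<phi> :: "real^'n::finite \<Rightarrow> real"
  assumes S: "open S" "compact K" "K \<subseteq> S" and v: "Ck_on 1 S v"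
    and p: "Ck_on 1 UNIV \<phi>" "\<And>x. x \<notin> K \<Longrightarrow> \<phi> x = 0"
  shows "(\<integral>x. v x * pderiv_coord i \<phi> x \<partial>lborel) = - (\<integral>x. pderiv_coord i v x * \<phi> x \<partial>lborel)"
proof -
  have cl: "closed K" using S compact_imp_closed by blast
  have p': "pderiv_coord i \<phi> x = 0" if "x \<notin> K" for x
    using Dlist_outside_support[of K \<phi> x "[i]"] cl p(2) that by simp
  have c: "continuous_on S (pderiv_coord i v)" "continuous_on S v"
      "continuous_on UNIV \<phi>" "continuous_on UNIV (pderiv_coord i \<phi>)"
    using v p(1) Ck_on_continuous Ck_on_Suc_D[of 0] by (metis One_nat_def)+
  have c1: "continuous_on UNIV (\<lambda>x. v x * pderiv_coord i \<phi> x)"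
    by (rule continuous_mult_compact_support[OF S(1) c(2) S(2,3) c(4) p'])
  have c2: "continuous_on UNIV (\<lambda>x. pderiv_coord i v x * \<phi> x)"
    by (rule continuous_mult_compact_support[OF S(1) c(1) S(2,3) c(3) p(2)])
  have c3: "continuous_on UNIV (\<lambda>x. v x * \<phi> x)"
    by (rule continuous_mult_compact_support[OF S(1) c(2) S(2,3) c(3) p(2)])
  have "(\<integral>x. v x * pderiv_coord i \<phi> x + pderiv_coord i v x * \<phi> x \<partial>lborel) = 0"
  proof (rule integral_directional_derivative_zero[OF S(2) c3])
    fix x
    show "((\<lambda>t. v (x + t *\<^sub>R axis i 1) * \<phi> (x + t *\<^sub>R axis i 1)) has_real_derivative
          v x * pderiv_coord i \<phi> x + pderiv_coord i v x * \<phi> x) (at 0)"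
    proof (cases "x \<in> S")
      case True
      show ?thesis
        using DERIV_mult[OF Ck_on_DERIV[of 0 S v x i] Ck_on_DERIV[of 0 UNIV \<phi> x i]] v p(1) True
        by (simp add: mult.commute add.commute)
    next
      case False
      then have x: "x \<in> - K" using S by auto
      have "((\<lambda>t. v (x + t *\<^sub>R axis i 1) * \<phi> (x + t *\<^sub>R axis i 1)) has_real_derivative 0) (at 0)"
        using DERIV_line_cong[OF _ x, of "\<lambda>x. v x * \<phi> x" "\<lambda>x. 0" i 0] cl p(2) by auto
      then show ?thesis using p' p(2) x by simp
    qed
  qed (use c1 c2 p(2) in \<open>auto intro: continuous_on_add\<close>)
  moreover have "integrable lborel (\<lambda>x. v x * pderiv_coord i \<phi> x)" "integrable lborel (\<lambda>x. pderiv_coord i v x * \<phi> x)"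
    by (rule integrable_compact_support[OF continuous_on_subset[OF c1] S(2)]; simp add: p')
       (rule integrable_compact_support[OF continuous_on_subset[OF c2] S(2)]; simp add: p)
  ultimately show ?thesis by simp
qed

text \<open>The outermost derivative of \<open>v\<close> is moved first and becomes the innermost
  one on the test function, hence the reversed list.\<close>

lemma ibp_Dlist:
  fixes v \<phi> :: "real^'n::finite \<Rightarrow> real"
  assumes S: "open S" "compact K" "K \<subseteq> S" and v: "Ck_on (length is) S v"
    and p: "Ck_on (length is) UNIV \<phi>" "\<And>x. x \<notin> K \<Longrightarrow> \<phi> x = 0"
  shows "(\<integral>x. Dlist is v x * \<phi> x \<partial>lborel) = (-1) ^ length is * (\<integral>x. v x * Dlist (rev is) \<phi> x \<partial>lborel)"
  using v p
proof (induction "is" arbitrary: \<phi>)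
  case (Cons i "is")
  have "Ck_on 1 S (Dlist is v)"
    by (rule Ck_on_Dlist[OF Cons.prems(1)]) simp
  moreover have "Ck_on 1 UNIV \<phi>" by (rule Ck_on_mono[OF Cons.prems(2)]) auto
  ultimately have "(\<integral>x. Dlist (i # is) v x * \<phi> x \<partial>lborel) = - (\<integral>x. Dlist is v x * pderiv_coord i \<phi> x \<partial>lborel)"
    using ibp_pderiv[OF S, of "Dlist is v" \<phi> i] Cons.prems(3) by simp
  also have "(\<integral>x. Dlist is v x * pderiv_coord i \<phi> x \<partial>lborel) =
     (-1) ^ length is * (\<integral>x. v x * Dlist (rev is) (pderiv_coord i \<phi>) x \<partial>lborel)"
  proof (rule Cons.IH)
    show "Ck_on (length is) S v" by (rule Ck_on_mono[OF Cons.prems(1)]) auto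
    show "Ck_on (length is) UNIV (pderiv_coord i \<phi>)" using Ck_on_Suc_D Cons.prems(2) by simp
    show "pderiv_coord i \<phi> x = 0" if "x \<notin> K" for x
      using Dlist_outside_support[of K \<phi> x "[i]"] compact_imp_closed[OF S(2)] Cons.prems(3) that by simp
  qed
  finally show ?case by (simp add: Dlist_append)
qed simp

lemma ibp_laplacian:
  fixes v \<phi> :: "real^'n::finite \<Rightarrow> real"
  assumes S: "open S" "compact K" "K \<subseteq> S" and v: "Ck_on 2 S v"
    and p: "Ck_on 2 UNIV \<phi>" "\<And>x. x \<notin> K \<Longrightarrow> \<phi> x = 0"
  shows "(\<integral>x. v x * laplacian \<phi> x \<partial>lborel) = (\<integral>x. laplacian v x * \<phi> x \<partial>lborel)"
proof -
  have cl: "closed K" using S compact_imp_closed by blast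
  have c: "continuous_on S (Dlist [i, i] v)" "continuous_on UNIV (Dlist [i, i] \<phi>)" for i
    using v p(1) unfolding Ck_on_def by (simp_all del: Dlist.simps)
  have i1: "integrable lborel (\<lambda>x. v x * Dlist [i, i] \<phi> x)" for i
    by (rule integrable_compact_support[OF continuous_on_subset[OF continuous_mult_compact_support[OF S(1) Ck_on_continuous[OF v] S(2,3) c(2)]] S(2)])
       (use Dlist_outside_support[of K \<phi> _ "[i,i]"] cl p(2) in auto)
  have i2: "integrable lborel (\<lambda>x. Dlist [i, i] v x * \<phi> x)" for i
    by (rule integrable_compact_support[OF continuous_on_subset[OF continuous_mult_compact_support[OF S(1) c(1) S(2,3) Ck_on_continuous[OF p(1)]]] S(2)])
       (use p(2) in auto)
  have "(\<integral>x. v x * laplacian \<phi> x \<partial>lborel) = (\<Sum>i\<in>UNIV. \<integral>x. v x * Dlist [i, i] \<phi> x \<partial>lborel)"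
    unfolding laplacian_def sum_distrib_left by (rule Bochner_Integration.integral_sum) (rule i1)
  also have "\<dots> = (\<Sum>i\<in>UNIV. \<integral>x. Dlist [i, i] v x * \<phi> x \<partial>lborel)"
  proof (rule sum.cong[OF refl])
    fix i
    show "(\<integral>x. v x * Dlist [i, i] \<phi> x \<partial>lborel) = (\<integral>x. Dlist [i, i] v x * \<phi> x \<partial>lborel)"
      using ibp_Dlist[OF S, of "[i, i]" v \<phi>] v p by (simp add: numeral_2_eq_2)
  qed
  also have "\<dots> = (\<integral>x. laplacian v x * \<phi> x \<partial>lborel)"
    unfolding laplacian_def sum_distrib_right by (rule Bochner_Integration.integral_sum[symmetric]) (rule i2)
  finally show ?thesis .
qed

lemma ibp_poly_laplacian:
  fixes v \<phi> :: "real^'n::finite \<Rightarrow> real"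
  assumes S: "open S" "compact K" "K \<subseteq> S" and v: "Ck_on (2 * m) S v"
    and p: "Ck_on (2 * m) UNIV \<phi>" "\<And>x. x \<notin> K \<Longrightarrow> \<phi> x = 0"
  shows "(\<integral>x. v x * poly_laplacian m \<phi> x \<partial>lborel) = (\<integral>x. poly_laplacian m v x * \<phi> x \<partial>lborel)"
  using v p(1)
proof (induction m arbitrary: v)
  case (Suc m)
  have cl: "closed K" using S compact_imp_closed by blast
  have "Ck_on 2 S v" by (rule Ck_on_mono[OF Suc.prems(1)]) auto
  moreover have "Ck_on 2 UNIV (poly_laplacian m \<phi>)" by (rule Ck_on_poly_laplacian[OF open_UNIV Suc.prems(2)]) auto
  ultimately have "(\<integral>x. v x * poly_laplacian (Suc m) \<phi> x \<partial>lborel) = (\<integral>x. laplacian v x * poly_laplacian m \<phi> x \<partial>lborel)"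
    unfolding poly_laplacian_Suc by (rule ibp_laplacian[OF S]) (rule poly_laplacian_outside_support[of K], use cl p(2) in auto)
  also have "\<dots> = (\<integral>x. poly_laplacian m (laplacian v) x * \<phi> x \<partial>lborel)"
    by (rule Suc.IH) (auto intro: Ck_on_laplacian[OF S(1) Suc.prems(1)] Ck_on_mono[OF Suc.prems(2)])
  finally show ?case by (simp add: poly_laplacian_Suc')
qed (simp add: poly_laplacian_0)

subsection \<open>Truncated polynomials and radial functions\<close>

text \<open>Only finitely many derivatives are ever needed, so polynomials cut off at s = 1 replace
  smooth bumps. The order of vanishing at 1, recorded as divisibility by a power of 1 - s, measures
  the smoothness, and all computations remain in the polynomial ring.\<close>

definition trunc_poly :: "real poly \<Rightarrow> real \<Rightarrow> real" where
  "trunc_poly q s = (if s < 1 then poly q s else 0)"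

abbreviation one_minus_X :: "real poly" where "one_minus_X \<equiv> [:1, -1:]"

lemma poly_eq_0_one_minus_X: "one_minus_X dvd q \<Longrightarrow> poly q 1 = 0"
  by (auto simp: dvd_def)

lemma one_minus_X_power_dvd_pderiv:
  assumes "one_minus_X ^ Suc k dvd q"
  shows "one_minus_X ^ k dvd pderiv q"
proof -
  obtain r where q: "q = one_minus_X ^ Suc k * r" using assms by (auto simp: dvd_def)
  have "pderiv q = one_minus_X ^ k * (one_minus_X * pderiv r + of_nat (Suc k) * pderiv one_minus_X * r)"
    unfolding q pderiv_mult pderiv_power_Suc by (simp add: algebra_simps of_nat_poly)
  then show ?thesis by simp
qed

lemma one_minus_X_power_dvd_pderiv_funpow:
  assumes "one_minus_X ^ (k + j) dvd q"
  shows "one_minus_X ^ k dvd (pderiv ^^ j) q"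
  using assms by (induction j arbitrary: k) (auto intro!: one_minus_X_power_dvd_pderiv simp del: power_Suc simp: power_Suc[symmetric])

lemma continuous_on_trunc_poly:
  assumes "one_minus_X dvd q"
  shows "continuous_on S (trunc_poly q)"
proof -
  have "trunc_poly q s = poly q (min s 1)" for s
    using poly_eq_0_one_minus_X[OF assms] by (auto simp: trunc_poly_def min_def)
  then have "trunc_poly q = (\<lambda>s. poly q (min s 1))" by auto
  then show ?thesis by (auto intro!: continuous_intros)
qed

lemma DERIV_trunc_poly:
  assumes "one_minus_X ^ 2 dvd q"
  shows "(trunc_poly q has_real_derivative trunc_poly (pderiv q) s) (at s)"
proof -
  have q1: "poly q 1 = 0"
    by (rule poly_eq_0_one_minus_X) (use assms dvd_power[of 2 one_minus_X] dvd_trans in auto)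
  have "one_minus_X ^ 1 dvd pderiv q"
    by (rule one_minus_X_power_dvd_pderiv) (use assms in \<open>simp add: numeral_2_eq_2\<close>)
  then have q2: "poly (pderiv q) 1 = 0" by (intro poly_eq_0_one_minus_X) simp
  consider "s < 1" | "s > 1" | "s = 1" by linarith
  then show ?thesis
  proof cases
    case 1
    have "(trunc_poly q has_real_derivative d) (at s) \<longleftrightarrow> (poly q has_real_derivative d) (at s)" for d
      by (rule DERIV_cong_ev) 
        (use 1 in \<open>auto simp: trunc_poly_def intro!: eventually_nhds_in_open[of "{..<1}", THEN eventually_mono]\<close>)
    then show ?thesis using 1 by (simp add: trunc_poly_def poly_DERIV)
  next
    case 2
    have "(trunc_poly q has_real_derivative d) (at s) \<longleftrightarrow> ((\<lambda>_. 0) has_real_derivative d) (at s)" for d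
      by (rule DERIV_cong_ev) 
        (use 2 in \<open>auto simp: trunc_poly_def intro!: eventually_nhds_in_open[of "{1<..}", THEN eventually_mono]\<close>)
    then show ?thesis using 2 by (simp add: trunc_poly_def)
  next
    \<comment> \<open>At the joint the truncated difference quotient is either that of the
      polynomial or 0, so it is dominated by the former, which tends to q'(1) = 0.\<close>
    case 3
    have "((\<lambda>h. (poly q (1 + h) - poly q 1) / h) \<longlongrightarrow> poly (pderiv q) 1) (at 0)"
      using poly_DERIV[of q 1] unfolding DERIV_def .
    then have "((\<lambda>h. poly q (1 + h) / h) \<longlongrightarrow> 0) (at 0)"
      unfolding q1 q2 diff_zero .
    then have "((\<lambda>h. \<bar>poly q (1 + h) / h\<bar>) \<longlongrightarrow> 0) (at 0)" by (rule tendsto_rabs_zero)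
    moreover have "\<forall>\<^sub>F h in at 0. norm ((trunc_poly q (1 + h) - trunc_poly q 1) / h) \<le> \<bar>poly q (1 + h) / h\<bar>"
    proof (rule always_eventually, rule allI)
      fix h
      have "trunc_poly q (1 + h) = poly q (1 + h) \<or> trunc_poly q (1 + h) = 0" "trunc_poly q 1 = 0"
        unfolding trunc_poly_def by simp_all
      then show "norm ((trunc_poly q (1 + h) - trunc_poly q 1) / h) \<le> \<bar>poly q (1 + h) / h\<bar>"
        by (elim disjE) simp_all
    qed
    ultimately have "((\<lambda>h. (trunc_poly q (1 + h) - trunc_poly q 1) / h) \<longlongrightarrow> 0) (at 0)"
      by (rule Lim_null_comparison[rotated])
    then show ?thesis using 3 by (simp add: DERIV_def trunc_poly_def)
  qed
qed

lemma Ck_on_trunc_poly: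
  fixes f :: "real^'n::finite \<Rightarrow> real"
  assumes "open S" "Ck_on k S f" "one_minus_X ^ Suc k dvd q"
  shows "Ck_on k S (\<lambda>x. trunc_poly q (f x))"
proof -
  have d: "one_minus_X ^ j dvd (pderiv ^^ i) q" if "j + i \<le> Suc k" for i j
    by (rule one_minus_X_power_dvd_pderiv_funpow) (use assms(3) that le_imp_power_dvd dvd_trans in blast)
  have "Ck_on k S (\<lambda>x. (\<lambda>j. trunc_poly ((pderiv ^^ j) q)) 0 (f x))"
  proof (rule Ck_on_compose[OF assms(1,2), of UNIV])
    show "continuous_on UNIV (trunc_poly ((pderiv ^^ j) q))" if "j \<le> k" for j
      by (rule continuous_on_trunc_poly) (use d[of 1 j] that in simp)
    show "(trunc_poly ((pderiv ^^ j) q) has_real_derivative trunc_poly ((pderiv ^^ Suc j) q) s) (at s)" if "j < k" for j s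
      using DERIV_trunc_poly[OF d[of 2 j]] that by simp
  qed auto
  then show ?thesis by simp
qed

section \<open>The Laplacian on functions of |x|^2\<close>

lemma DERIV_inner_self_line:
  fixes x :: "real^'n::finite"
  shows "((\<lambda>t. (x + t *\<^sub>R axis i 1) \<bullet> (x + t *\<^sub>R axis i 1)) has_real_derivative 2 * x $ i) (at 0)"
proof -
  have "(x + t *\<^sub>R axis i 1) \<bullet> (x + t *\<^sub>R axis i 1) = x \<bullet> x + 2 * t * x $ i + t\<^sup>2" for t :: real
    by (simp add: inner_add_left inner_add_right inner_axis inner_axis' power2_eq_square algebra_simps)
  then show ?thesis by (auto intro!: derivative_eq_intros)
qed

lemma sum_sq_coords: "(\<Sum>i\<in>UNIV. (x $ i)\<^sup>2) = x \<bullet> (x :: real^'n::finite)"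
  by (simp add: inner_vec_def power2_eq_square)

lemma laplacian_radial:
  fixes x :: "real^'n::finite"
  assumes S: "open S" "x \<in> S"
    and 1: "\<And>y. y \<in> S \<Longrightarrow> (h has_real_derivative h1 (y \<bullet> y)) (at (y \<bullet> y))"
    and 2: "(h1 has_real_derivative h2 (x \<bullet> x)) (at (x \<bullet> x))"
  shows "laplacian (\<lambda>y. h (y \<bullet> y)) x = 4 * (x \<bullet> x) * h2 (x \<bullet> x) + 2 * real CARD('n) * h1 (x \<bullet> x)"
proof -
  have d1: "pderiv_coord i (\<lambda>y. h (y \<bullet> y)) y = h1 (y \<bullet> y) * (2 * y $ i)" if "y \<in> S" for i y
    by (rule pderiv_coord_eqI, rule DERIV_chain2[where g="\<lambda>t. (y + t *\<^sub>R axis i 1) \<bullet> (y + t *\<^sub>R axis i 1)"])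
       (use 1[OF that] DERIV_inner_self_line in auto)
  have "Dlist [i, i] (\<lambda>y. h (y \<bullet> y)) x = 4 * (x $ i)\<^sup>2 * h2 (x \<bullet> x) + 2 * h1 (x \<bullet> x)" for i
  proof -
    have "Dlist [i, i] (\<lambda>y. h (y \<bullet> y)) x = pderiv_coord i (\<lambda>y. h1 (y \<bullet> y) * (2 * y $ i)) x"
      using pderiv_coord_cong[OF S, of "pderiv_coord i (\<lambda>y. h (y \<bullet> y))", OF d1] by simp
    also have "\<dots> = h2 (x \<bullet> x) * (2 * x $ i) * (2 * x $ i) + 2 * h1 (x \<bullet> x)"
    proof (rule pderiv_coord_eqI)
      have a: "((\<lambda>t. h1 ((x + t *\<^sub>R axis i 1) \<bullet> (x + t *\<^sub>R axis i 1))) has_real_derivative h2 (x \<bullet> x) * (2 * x $ i)) (at 0)"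
        by (rule DERIV_chain2[where g="\<lambda>t. (x + t *\<^sub>R axis i 1) \<bullet> (x + t *\<^sub>R axis i 1)"])
           (use 2 DERIV_inner_self_line in auto)
      have b: "((\<lambda>t. 2 * (x + t *\<^sub>R axis i 1) $ i) has_real_derivative 2) (at 0)"
        by (auto intro!: derivative_eq_intros)
      show "((\<lambda>t. h1 ((x + t *\<^sub>R axis i 1) \<bullet> (x + t *\<^sub>R axis i 1)) * (2 * (x + t *\<^sub>R axis i 1) $ i)) has_real_derivative
         h2 (x \<bullet> x) * (2 * x $ i) * (2 * x $ i) + 2 * h1 (x \<bullet> x)) (at 0)"
        using DERIV_mult[OF a b] by simp
    qed
    finally show ?thesis by (simp add: power2_eq_square)
  qed
  then show ?thesis unfolding laplacian_def
    by (simp add: sum.distrib sum_distrib_left[symmetric] sum_distrib_right[symmetric] sum_sq_coords)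
qed

text \<open>The Laplacian of R^n in the variable s = |x|^2, namely 4 s q'' + 2 n q'.\<close>

definition radial_lap :: "real \<Rightarrow> real poly \<Rightarrow> real poly" where
  "radial_lap n q = smult 4 (pCons 0 (pderiv (pderiv q))) + smult (2 * n) (pderiv q)"

lemma one_minus_X_dvd_radial_lap:
  assumes "one_minus_X ^ (k + 2) dvd q"
  shows "one_minus_X ^ k dvd radial_lap n q"
proof -
  have 1: "one_minus_X ^ Suc k dvd pderiv q" using one_minus_X_power_dvd_pderiv[of "Suc k" q] assms by simp
  have 2: "one_minus_X ^ k dvd pderiv (pderiv q)" by (rule one_minus_X_power_dvd_pderiv[OF 1])
  have 3: "one_minus_X ^ k dvd pderiv q" using 1 by (rule power_le_dvd) simp
  have "radial_lap n q = [:0, 4:] * pderiv (pderiv q) + smult (2 * n) (pderiv q)"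
    by (simp add: radial_lap_def)
  then show ?thesis using 2 3 by (simp only: dvd_add dvd_mult dvd_smult)
qed

text \<open>Each Laplacian costs two orders of contact at s = 1. The remaining divisibility is part
  of the conclusion because continuity of the resulting profile is needed later.\<close>

lemma poly_laplacian_trunc_poly:
  fixes x :: "real^'n::finite"
  assumes "one_minus_X ^ (2 * m + 1) dvd q"
  shows "poly_laplacian m (\<lambda>y::real^'n. trunc_poly q (y \<bullet> y)) x = trunc_poly ((radial_lap (real CARD('n)) ^^ m) q) (x \<bullet> x)
     \<and> one_minus_X dvd (radial_lap (real CARD('n)) ^^ m) q"
  using assms
proof (induction m arbitrary: q)
  case (Suc m)
  have d: "one_minus_X ^ 2 dvd q" "one_minus_X ^ 2 dvd pderiv q"
    using power_le_dvd[OF Suc.prems, of 2] one_minus_X_power_dvd_pderiv[of 2 q] power_le_dvd[OF Suc.prems, of 3]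
    by (auto simp: numeral_3_eq_3)
  have "laplacian (\<lambda>y::real^'n. trunc_poly q (y \<bullet> y)) x = trunc_poly (radial_lap (real CARD('n)) q) (x \<bullet> x)" for x
  proof -
    have "laplacian (\<lambda>y::real^'n. trunc_poly q (y \<bullet> y)) x = 4 * (x \<bullet> x) * trunc_poly (pderiv (pderiv q)) (x \<bullet> x) + 2 * real CARD('n) * trunc_poly (pderiv q) (x \<bullet> x)"
      by (rule laplacian_radial[OF open_UNIV]) (auto intro: DERIV_trunc_poly d)
    then show ?thesis by (simp add: trunc_poly_def radial_lap_def)
  qed
  then have "laplacian (\<lambda>y::real^'n. trunc_poly q (y \<bullet> y)) = (\<lambda>x. trunc_poly (radial_lap (real CARD('n)) q) (x \<bullet> x))"
    by auto
  moreover have "one_minus_X ^ (2 * m + 1) dvd radial_lap (real CARD('n)) q"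
    by (rule one_minus_X_dvd_radial_lap) (use Suc.prems in simp)
  ultimately show ?case using Suc.IH[of "radial_lap (real CARD('n)) q"]
    by (simp add: poly_laplacian_Suc' funpow_swap1)
qed (simp add: poly_laplacian_0)

text \<open>The operator \<theta> + c with \<theta> = s d/ds. Pulling a power s^k out of its
  argument shifts c by k.\<close>

definition euler :: "real \<Rightarrow> real poly \<Rightarrow> real poly" where
  "euler c q = pCons 0 (pderiv q) + smult c q"

lemma one_minus_X_dvd_euler:
  assumes "one_minus_X ^ Suc k dvd q"
  shows "one_minus_X ^ k dvd euler c q"
proof -
  have "euler c q = [:0, 1:] * pderiv q + smult c q" by (simp add: euler_def)
  moreover have "one_minus_X ^ k dvd q" using assms by (rule power_le_dvd) simp
  ultimately show ?thesis using one_minus_X_power_dvd_pderiv[OF assms] by (simp only: dvd_add dvd_mult dvd_smult)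
qed

lemma euler_add_const: "euler (c + d) q = euler c q + smult d q"
  by (simp add: euler_def smult_add_left)

lemma pderiv_monom_mult: "pderiv (monom 1 (Suc k) * q) = monom 1 k * euler (real (Suc k)) q"
proof -
  have *: "pderiv (monom 1 (Suc k)) = smult (real (Suc k)) (monom 1 k)"
    by (simp add: pderiv_monom smult_monom)
  show ?thesis unfolding pderiv_mult * euler_def
    by (simp add: monom_Suc algebra_simps)
qed

lemma X_pderiv_monom_mult: "pCons 0 (pderiv (monom 1 k * q)) = monom 1 k * euler (real k) q"
proof (cases k)
  case 0
  then show ?thesis by (simp add: euler_def)
next
  case (Suc j)
  then show ?thesis using pderiv_monom_mult[of j q] by (simp add: monom_Suc)
qed

text \<open>The radial Laplacian is 4 s^(-1) \<theta> (\<theta> + n/2 - 1); moving it past s^(k+1)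
  shifts \<theta> by k + 1.\<close>

lemma radial_lap_monom_mult:
  "radial_lap n (monom 1 (Suc k) * q) = monom 1 k * smult 4 (euler (real k + n / 2) (euler (real (Suc k)) q))"
  unfolding radial_lap_def pderiv_monom_mult X_pderiv_monom_mult euler_add_const
  by (simp add: algebra_simps smult_add_right)

text \<open>The field z Q(|z|^2) is compactly supported, so its divergence n Q + 2 \<theta>Q
  integrates to zero; thus \<theta> acts under the integral as multiplication by -n/2.\<close>

lemma integral_trunc_poly_euler:
  assumes "one_minus_X ^ 2 dvd q"
  shows "(\<integral>z. trunc_poly (euler c q) ((z::real^'n) \<bullet> z) \<partial>lborel) =
     (c - real CARD('n) / 2) * (\<integral>z. trunc_poly q ((z::real^'n) \<bullet> z) \<partial>lborel)"
proof -
  let ?K = "cball 0 1 :: (real^'n) set"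
  have q1: "one_minus_X dvd q" "one_minus_X dvd pderiv q"
    using power_le_dvd[OF assms, of 1] one_minus_X_power_dvd_pderiv[of 1 q] assms by (auto simp: numeral_2_eq_2)
  have s: "trunc_poly p (z \<bullet> z) = 0" if "z \<notin> ?K" for p and z :: "real^'n"
    using that by (auto simp: trunc_poly_def power2_norm_eq_inner[symmetric] abs_square_less_1)
  have ci: "continuous_on UNIV (\<lambda>z::real^'n. trunc_poly p (z \<bullet> z))" if "one_minus_X dvd p" for p
    by (rule continuous_on_compose2[OF continuous_on_trunc_poly[OF that, of UNIV]]) (auto intro!: continuous_intros)
  let ?w' = "\<lambda>i z::real^'n. trunc_poly q (z \<bullet> z) + 2 * (z $ i)\<^sup>2 * trunc_poly (pderiv q) (z \<bullet> z)"
  have z: "(\<integral>z. ?w' i z \<partial>lborel) = 0" for i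
  proof (rule integral_directional_derivative_zero[where K="?K" and w="\<lambda>z. z $ i * trunc_poly q (z \<bullet> z)"])
    show "continuous_on UNIV (\<lambda>z. z $ i * trunc_poly q (z \<bullet> z))"
      by (intro continuous_on_mult ci q1 continuous_on_component continuous_on_id)
    show "continuous_on UNIV (?w' i)"
      by (intro continuous_on_add continuous_on_mult ci q1 continuous_on_component continuous_on_id continuous_on_const continuous_on_power)
    fix x :: "real^'n"
    have a: "((\<lambda>t. trunc_poly q ((x + t *\<^sub>R axis i 1) \<bullet> (x + t *\<^sub>R axis i 1))) has_real_derivative trunc_poly (pderiv q) (x \<bullet> x) * (2 * x $ i)) (at 0)"
      by (rule DERIV_chain2[where g="\<lambda>t. (x + t *\<^sub>R axis i 1) \<bullet> (x + t *\<^sub>R axis i 1)"])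
         (use DERIV_trunc_poly[OF assms] DERIV_inner_self_line in auto)
    have b: "((\<lambda>t. (x + t *\<^sub>R axis i 1) $ i) has_real_derivative 1) (at 0)"
      by (auto intro!: derivative_eq_intros)
    show "((\<lambda>t. (x + t *\<^sub>R axis i 1) $ i * trunc_poly q ((x + t *\<^sub>R axis i 1) \<bullet> (x + t *\<^sub>R axis i 1))) has_real_derivative ?w' i x) (at 0)"
      using DERIV_mult[OF b a] by (simp add: power2_eq_square algebra_simps)
  qed (auto simp: s)
  have ig: "integrable lborel (?w' i)" for i
    by (rule integrable_compact_support[of ?K])
       (auto simp: s intro!: continuous_on_add continuous_on_mult continuous_on_subset[OF ci] q1 continuous_on_component continuous_on_id continuous_on_const continuous_on_power)
  have iq: "integrable lborel (\<lambda>z::real^'n. trunc_poly p (z \<bullet> z))" if "one_minus_X dvd p" for p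
    by (rule integrable_compact_support[of ?K]) (auto simp: s intro!: continuous_on_subset[OF ci[OF that]])
  have "one_minus_X dvd euler c q"
    using one_minus_X_dvd_euler[of 1 q c] assms by (simp add: numeral_2_eq_2)
  note ie = iq[OF this]
  have "(\<Sum>i\<in>UNIV. ?w' i z) = 2 * trunc_poly (euler c q) (z \<bullet> z) - (2 * c - real CARD('n)) * trunc_poly q (z \<bullet> z)" for z
    by (simp add: sum.distrib sum_distrib_left[symmetric] sum_distrib_right[symmetric] sum_sq_coords trunc_poly_def euler_def algebra_simps)
  moreover have "(\<integral>z. (\<Sum>i\<in>UNIV. ?w' i z) \<partial>lborel) = 0"
    by (subst Bochner_Integration.integral_sum) (auto simp only: ig z sum.neutral_const)
  ultimately have "0 = (\<integral>z. 2 * trunc_poly (euler c q) ((z::real^'n) \<bullet> z) - (2 * c - real CARD('n)) * trunc_poly q (z \<bullet> z) \<partial>lborel)"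
    by simp
  also have "\<dots> = 2 * (\<integral>z. trunc_poly (euler c q) ((z::real^'n) \<bullet> z) \<partial>lborel) - (2 * c - real CARD('n)) * (\<integral>z. trunc_poly q ((z::real^'n) \<bullet> z) \<partial>lborel)"
    using ie iq[OF q1(1)] by (subst Bochner_Integration.integral_diff) auto
  finally show ?thesis by (simp add: field_simps)
qed

lemma integral_trunc_poly_power_pos:
  assumes "N \<ge> 1"
  shows "(\<integral>z. trunc_poly (one_minus_X ^ N) ((z::real^'n) \<bullet> z) \<partial>lborel) > 0"
proof -
  let ?g = "\<lambda>z::real^'n. trunc_poly (one_minus_X ^ N) (z \<bullet> z)"
  let ?K = "cball 0 1 :: (real^'n) set"
  have d: "one_minus_X dvd one_minus_X ^ N" using assms by (simp add: dvd_power)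
  have c: "continuous_on UNIV ?g"
    by (rule continuous_on_compose2[OF continuous_on_trunc_poly[OF d, of UNIV]]) (auto intro!: continuous_intros)
  have i: "integrable lborel ?g"
    by (rule integrable_compact_support[OF continuous_on_subset[OF c], of ?K])
       (auto simp: trunc_poly_def power2_norm_eq_inner[symmetric] abs_square_less_1)
  have nn: "?g z \<ge> 0" for z by (auto simp: trunc_poly_def poly_power)
  have "(\<integral>z. ?g z \<partial>lborel) \<noteq> 0"
  proof
    assume "(\<integral>z. ?g z \<partial>lborel) = 0"
    then have "AE z in lborel. ?g z = 0"
      using integral_nonneg_eq_0_iff_AE[OF i] nn by auto
    then have "AE z in lborel. z \<in> - ball (0::real^'n) 1"
    proof eventually_elim
      case (elim z)
      have "trunc_poly (one_minus_X ^ N) (z \<bullet> z) > 0" if "norm z < 1"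
        using that by (simp add: trunc_poly_def poly_power power2_norm_eq_inner[symmetric] abs_square_less_1)
      then show ?case using elim by auto
    qed
    then have "emeasure lborel (ball 0 1 :: (real^'n) set) = 0"
      by (subst (asm) AE_iff_measurable[where N="ball 0 1"]) (auto simp: ball_def)
    moreover have "emeasure lborel (ball 0 1 :: (real^'n) set) > 0"
      using content_ball_pos[of 1 "0::real^'n"] by (auto simp: measure_def zero_less_iff_neq_zero)
    ultimately show False by simp
  qed
  moreover have "(\<integral>z. ?g z \<partial>lborel) \<ge> 0" by (rule integral_nonneg_AE) (use nn in auto)
  ultimately show ?thesis by simp
qed

text \<open>A kernel \<open>\<eta>\<close> with nonzero integral whose rescalings \<open>t\<^sup>-\<^sup>n \<eta>(z / t)\<close> have a \<open>t\<close>-derivative that is an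
  \<open>m\<close>-fold Laplacian of a compactly supported function: in the variable \<open>s = |z|\<^sup>2\<close> the Laplacian is
  \<open>4 s\<^sup>-\<^sup>1 \<theta> (\<theta> + n/2 - 1)\<close> with \<open>\<theta> = s d/ds\<close>, so \<open>\<Delta>\<^sup>m (s\<^sup>m v)\<close> contains the factor \<open>\<theta> + n/2\<close>.\<close>

lemma kernel_exists:
  assumes "2 * m < CARD('n::finite)" "m \<ge> 1"
  shows "\<exists>\<zeta> \<eta> :: real poly. one_minus_X ^ (4 * m) dvd \<zeta> \<and> one_minus_X ^ (2 * m + 1) dvd \<eta> \<and>
    smult 2 (pCons 0 (pderiv \<eta>)) + smult (real CARD('n)) \<eta> = (radial_lap (real CARD('n)) ^^ m) \<zeta> \<and>
    (\<integral>z. trunc_poly \<eta> ((z::real^'n) \<bullet> z) \<partial>lborel) \<noteq> 0"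
proof -
  define n where "n = real CARD('n)"
  \<comment> \<open>The m Laplacians consist of 2m Euler factors, each costing one order of contact;
    the power 4m leaves 2m of them.\<close>
  define v :: "real poly" where "v = one_minus_X ^ (4 * m)"
  \<comment> \<open>\<open>W j\<close> is what remains of the j-fold radial Laplacian of s^m v after
    the factor s^(m-j) is split off.\<close>
  define W where "W = rec_nat v (\<lambda>j w. smult 4 (euler (real (m - Suc j) + n / 2) (euler (real (m - j)) w)))"
  have W0: "W 0 = v" and WS: "W (Suc j) = smult 4 (euler (real (m - Suc j) + n / 2) (euler (real (m - j)) (W j)))" for j
    by (simp_all add: W_def)
  have dW: "one_minus_X ^ (4 * m - 2 * j) dvd W j" if "j \<le> m" for j
    using that
  proof (induction j)
    case (Suc j)
    have e: "4 * m - 2 * j = Suc (Suc (4 * m - 2 * Suc j))" using Suc.prems by simp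
    have "one_minus_X ^ Suc (Suc (4 * m - 2 * Suc j)) dvd W j" using Suc.IH Suc.prems unfolding e by simp
    then show ?case unfolding WS by (intro dvd_smult one_minus_X_dvd_euler)
  qed (simp add: W0 v_def)
  have L: "(radial_lap n ^^ j) (monom 1 m * v) = monom 1 (m - j) * W j" if "j \<le> m" for j
    using that
  proof (induction j)
    case (Suc j)
    then have "m - j = Suc (m - Suc j)" by simp
    then have "radial_lap n (monom 1 (m - j) * W j) = monom 1 (m - Suc j) * W (Suc j)"
      unfolding WS using radial_lap_monom_mult[of n "m - Suc j" "W j"] by simp
    then show ?case using Suc by simp
  qed (simp add: W0)
  \<comment> \<open>Passing from \<open>W j\<close> to \<open>W (Suc j)\<close> multiplies the
    integral by 4 (m-j-1) (m-j-n/2). For j + 1 < m both factors are nonzero, the second by 2m < n.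
    At j + 1 = m the first is zero, as the integral of a Laplacian must be, so the kernel has to be
    taken from before the last factor.\<close>
  have I: "(\<integral>z. trunc_poly (W j) ((z::real^'n) \<bullet> z) \<partial>lborel) \<noteq> 0" if "j < m" for j
    using that
  proof (induction j)
    case 0
    show ?case unfolding W0 v_def using integral_trunc_poly_power_pos[of "4 * m", where 'n='n] assms(2) by simp
  next
    case (Suc j)
    have sm: "trunc_poly (smult 4 p) s = 4 * trunc_poly p s" for p s by (simp add: trunc_poly_def)
    have d: "one_minus_X ^ 3 dvd W j" 
      using dW[of j] Suc.prems by (rule_tac power_le_dvd[of _ "4 * m - 2 * j"]) auto
    then have d2: "one_minus_X ^ 2 dvd W j" by (rule power_le_dvd) simp
    have d1: "one_minus_X ^ 2 dvd euler (real (m - j)) (W j)" 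
      using one_minus_X_dvd_euler[of 2 "W j"] d by (simp add: numeral_3_eq_3)
    have "(\<integral>z. trunc_poly (W (Suc j)) ((z::real^'n) \<bullet> z) \<partial>lborel) = 4 * ((real (m - Suc j) + n / 2 - n / 2) * 
       ((real (m - j) - n / 2) * (\<integral>z. trunc_poly (W j) ((z::real^'n) \<bullet> z) \<partial>lborel)))"
      unfolding WS sm using integral_trunc_poly_euler[OF d1, where 'n='n] integral_trunc_poly_euler[OF d2, where 'n='n]
      by (simp add: n_def)
    moreover have "real (m - Suc j) \<noteq> 0" using Suc.prems by simp
    moreover have "real (m - j) - n / 2 \<noteq> 0" using assms(1) unfolding n_def by linarith
    ultimately show ?case using Suc by simp
  qed
  \<comment> \<open>\<open>W m\<close> with its factor \<theta> + n/2 left out: 2 \<theta>\<eta> + n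
    \<eta> = 4 (\<theta> + n/2) (\<theta> + 1) \<open>W (m - 1)\<close> = \<open>W m\<close>. The
    remaining factor \<theta> + 1 multiplies the integral by 1 - n/2, which is nonzero.\<close>
  define \<eta> where "\<eta> = smult 2 (euler 1 (W (m - 1)))"
  have dm: "one_minus_X ^ (2 * m + 2) dvd W (m - 1)"
    by (rule power_le_dvd[OF dW]) (use assms(2) in auto)
  have "(\<integral>z. trunc_poly \<eta> ((z::real^'n) \<bullet> z) \<partial>lborel) = 2 * ((1 - n / 2) * (\<integral>z. trunc_poly (W (m - 1)) ((z::real^'n) \<bullet> z) \<partial>lborel))"
  proof -
    have sm: "trunc_poly (smult 2 p) s = 2 * trunc_poly p s" for p s by (simp add: trunc_poly_def)
    have "one_minus_X ^ 2 dvd W (m - 1)" using dm by (rule power_le_dvd) simp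
    then show ?thesis unfolding \<eta>_def sm using integral_trunc_poly_euler[where 'n='n] by (simp add: n_def)
  qed
  moreover have "1 - n / 2 \<noteq> 0" using assms unfolding n_def by linarith
  ultimately have "(\<integral>z. trunc_poly \<eta> ((z::real^'n) \<bullet> z) \<partial>lborel) \<noteq> 0" using I[of "m - 1"] assms(2) by simp
  moreover have "one_minus_X ^ (2 * m + 1) dvd \<eta>"
    unfolding \<eta>_def by (intro dvd_smult one_minus_X_dvd_euler) (use dm in simp)
  moreover have "smult 2 (pCons 0 (pderiv \<eta>)) + smult n \<eta> = (radial_lap n ^^ m) (monom 1 m * v)"
  proof -
    have "(radial_lap n ^^ m) (monom 1 m * v) = W m" using L[of m] by simp
    also have "W m = smult 4 (euler (n / 2) (euler 1 (W (m - 1))))"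
      using WS[of "m - 1"] assms(2) by simp
    also have "\<dots> = smult 2 (pCons 0 (pderiv \<eta>)) + smult n \<eta>"
      unfolding \<eta>_def by (simp add: euler_def[of "n / 2"] pderiv_smult smult_add_right mult.commute)
    finally show ?thesis by simp
  qed
  moreover have "one_minus_X ^ (4 * m) dvd monom 1 m * v" by (simp add: v_def)
  ultimately show ?thesis unfolding n_def by blast
qed

subsection \<open>The local estimate\<close>

lemma pderiv_coord_scaled:
  fixes G :: "real^'n::finite \<Rightarrow> real"
  assumes "Ck_on (Suc k) UNIV G"
  shows "((\<lambda>t. G (s *\<^sub>R (y + t *\<^sub>R axis i 1 - x))) has_real_derivative s * pderiv_coord i G (s *\<^sub>R (y - x))) (at 0)"
proof -
  have a: "((\<lambda>t. G (s *\<^sub>R (y - x) + t *\<^sub>R axis i 1)) has_real_derivative pderiv_coord i G (s *\<^sub>R (y - x))) (at (s * 0))"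
    using Ck_on_DERIV[OF assms] by simp
  have b: "((\<lambda>t. s * t) has_real_derivative s) (at 0)" by (auto intro!: derivative_eq_intros)
  have "((\<lambda>t. G (s *\<^sub>R (y - x) + (s * t) *\<^sub>R axis i 1)) has_real_derivative pderiv_coord i G (s *\<^sub>R (y - x)) * s) (at 0)"
    by (rule DERIV_chain2[OF a b])
  then show ?thesis by (simp add: algebra_simps)
qed

lemma Ck_on_scaled:
  fixes G :: "real^'n::finite \<Rightarrow> real"
  assumes "Ck_on k UNIV G"
  shows "Ck_on k UNIV (\<lambda>y. G (s *\<^sub>R (y - x)))"
  using assms
proof (induction k arbitrary: G)
  case 0
  have "continuous_on UNIV (\<lambda>y. s *\<^sub>R (y - x))" by (intro continuous_intros)
  then show ?case using 0 continuous_on_compose2[of UNIV G UNIV "\<lambda>y. s *\<^sub>R (y - x)"] by (simp add: Ck_on_0)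
next
  case (Suc k)
  have c: "continuous_on UNIV (\<lambda>y. s *\<^sub>R (y - x))" by (intro continuous_intros)
  show ?case
    by (rule Ck_on_SucI[OF open_UNIV, where g="\<lambda>i y. s * pderiv_coord i G (s *\<^sub>R (y - x))"])
       (auto intro!: Ck_on_cmult Suc.IH Ck_on_Suc_D[OF Suc.prems] pderiv_coord_scaled[OF Suc.prems]
          continuous_on_compose2[OF Ck_on_continuous[OF Suc.prems] c])
qed

lemma Dlist_scaled:
  fixes G :: "real^'n::finite \<Rightarrow> real"
  assumes "Ck_on (length is) UNIV G"
  shows "Dlist is (\<lambda>y. G (s *\<^sub>R (y - x))) y = s ^ length is * Dlist is G (s *\<^sub>R (y - x))"
  using assms
proof (induction "is" arbitrary: y)
  case (Cons i "is")
  have "Dlist (i # is) (\<lambda>y. G (s *\<^sub>R (y - x))) y = pderiv_coord i (\<lambda>y. s ^ length is * Dlist is G (s *\<^sub>R (y - x))) y"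
    using Cons.IH Ck_on_mono[OF Cons.prems, of "length is" UNIV] by (simp add: fun_eq_iff pderiv_coord_def)
  also have "\<dots> = s ^ length is * (s * pderiv_coord i (Dlist is G) (s *\<^sub>R (y - x)))"
  proof (rule pderiv_coord_eqI, rule DERIV_cmult)
    have "Ck_on (Suc 0) UNIV (Dlist is G)" by (rule Ck_on_Dlist[OF Cons.prems]) simp
    then show "((\<lambda>t. Dlist is G (s *\<^sub>R (y + t *\<^sub>R axis i 1 - x))) has_real_derivative
        s * pderiv_coord i (Dlist is G) (s *\<^sub>R (y - x))) (at 0)"
      by (rule pderiv_coord_scaled)
  qed
  finally show ?case by simp
qed simp

lemma laplacian_scaled:
  fixes G :: "real^'n::finite \<Rightarrow> real"
  assumes "Ck_on 2 UNIV G"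
  shows "laplacian (\<lambda>y. G (s *\<^sub>R (y - x))) y = s\<^sup>2 * laplacian G (s *\<^sub>R (y - x))"
  unfolding laplacian_def sum_distrib_left
proof (rule sum.cong[OF refl])
  fix i
  show "Dlist [i, i] (\<lambda>y. G (s *\<^sub>R (y - x))) y = s\<^sup>2 * Dlist [i, i] G (s *\<^sub>R (y - x))"
    using Dlist_scaled[of "[i, i]" G s x y] assms by (simp add: numeral_2_eq_2)
qed

lemma poly_laplacian_scaled:
  fixes G :: "real^'n::finite \<Rightarrow> real"
  assumes "Ck_on (2 * m) UNIV G"
  shows "poly_laplacian m (\<lambda>y. G (s *\<^sub>R (y - x))) y = s ^ (2 * m) * poly_laplacian m G (s *\<^sub>R (y - x))"
  using assms
proof (induction m arbitrary: y)
  case (Suc m)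
  have c: "Ck_on 2 UNIV (poly_laplacian m G)" by (rule Ck_on_poly_laplacian[OF open_UNIV Suc.prems]) simp
  have "poly_laplacian (Suc m) (\<lambda>y. G (s *\<^sub>R (y - x))) y = laplacian (\<lambda>y. s ^ (2 * m) * poly_laplacian m G (s *\<^sub>R (y - x))) y"
    unfolding poly_laplacian_Suc
    by (rule laplacian_cong[OF open_UNIV]) (use Suc.IH Ck_on_mono[OF Suc.prems, of "2 * m" UNIV] in auto)
  also have "\<dots> = s ^ (2 * m) * (s\<^sup>2 * laplacian (poly_laplacian m G) (s *\<^sub>R (y - x)))"
    by (subst laplacian_cmult[OF open_UNIV Ck_on_scaled[OF c]]) (auto simp: laplacian_scaled[OF c])
  finally show ?case by (simp add: poly_laplacian_Suc power2_eq_square)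
qed (simp add: poly_laplacian_0)

lemma lborel_integral_scaled:
  fixes g :: "real^'n::finite \<Rightarrow> real"
  assumes "g \<in> borel_measurable borel" "t > 0"
  shows "(\<integral>y. g ((1 / t) *\<^sub>R (y - x)) / t ^ CARD('n) \<partial>lborel) = (\<integral>z. g z \<partial>lborel)"
proof -
  let ?h = "\<lambda>y. g ((1 / t) *\<^sub>R (y - x)) / t ^ CARD('n)"
  have h: "?h \<in> borel_measurable borel"
    by (intro borel_measurable_divide measurable_compose[OF _ assms(1)]) auto
  have "(\<integral>y. ?h y \<partial>lborel) = (\<integral>y. ?h y \<partial>density (distr lborel borel (\<lambda>z. x + t *\<^sub>R z)) (\<lambda>_. \<bar>t\<bar> ^ DIM(real^'n)))"
    using lborel_affine[of t x] assms(2) by simp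
  also have "\<dots> = (\<integral>y. (t ^ CARD('n)) *\<^sub>R ?h y \<partial>distr lborel borel (\<lambda>z. x + t *\<^sub>R z))"
  proof -
    have e: "\<bar>t\<bar> ^ DIM(real^'n) = t ^ CARD('n)"
      using assms(2) by simp
    show ?thesis unfolding e
    proof (rule integral_density)
      show "?h \<in> borel_measurable (distr lborel borel (\<lambda>z. x + t *\<^sub>R z))"
        using h by (simp only: measurable_distr_eq1)
    qed (use assms(2) in auto)
  qed
  also have "\<dots> = (\<integral>z. (t ^ CARD('n)) *\<^sub>R ?h (x + t *\<^sub>R z) \<partial>lborel)"
    by (rule integral_distr[OF _ borel_measurable_scaleR[OF borel_measurable_const h]]) simp
  also have "\<dots> = (\<integral>z. g z \<partial>lborel)" using assms(2) by simp
  finally show ?thesis .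
qed

lemma abs_integral_le:
  fixes f g :: "'a::euclidean_space \<Rightarrow> real"
  assumes "integrable M f" "integrable M g" "\<And>y. \<bar>f y\<bar> \<le> g y"
  shows "\<bar>integral\<^sup>L M f\<bar> \<le> integral\<^sup>L M g"
  using Bochner_Integration.integral_norm_bound_integral[OF assms(1,2)] assms(3) by simp

lemma scaled_notin_cball:
  fixes x y :: "'a::real_normed_vector"
  assumes "y \<notin> cball x t" "t > 0"
  shows "(1 / t) *\<^sub>R (y - x) \<notin> cball 0 1"
proof -
  have "norm ((1 / t) *\<^sub>R (y - x)) = norm (y - x) / t" using assms(2) by simp
  moreover have "norm (y - x) > t" using assms(1) by (simp add: dist_norm norm_minus_commute)
  ultimately show ?thesis using assms(2) by simp
qed

lemma bounded_compact_support:
  fixes g :: "'a::euclidean_space \<Rightarrow> real"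
  assumes "continuous_on UNIV g" "\<And>z. z \<notin> cball 0 1 \<Longrightarrow> g z = 0"
  shows "\<exists>C\<ge>0. \<forall>z. \<bar>g z\<bar> \<le> C"
proof -
  have "bounded (g ` cball 0 1)"
    by (intro compact_imp_bounded compact_continuous_image continuous_on_subset[OF assms(1)]) auto
  then obtain B where B: "\<And>z. z \<in> cball 0 1 \<Longrightarrow> \<bar>g z\<bar> \<le> B" unfolding bounded_iff by (metis imageI real_norm_def)
  then have "\<bar>g z\<bar> \<le> max B 0" for z using assms(2)[of z] by (cases "z \<in> cball 0 1") (auto simp: le_max_iff_disj)
  then show ?thesis by (intro exI[of _ "max B 0"]) auto
qed

text \<open>The kernel may change sign, so the error is measured by the integral of its absolute
  value, and the limit carries the total integral as a factor.\<close>

lemma approx_identity: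
  fixes v \<eta> :: "real^'n::finite \<Rightarrow> real"
  assumes S: "open S" "x \<in> S" "continuous_on S v"
    and h: "continuous_on UNIV \<eta>" "\<And>z. z \<notin> cball 0 1 \<Longrightarrow> \<eta> z = 0"
  shows "((\<lambda>t. \<integral>y. v y * (\<eta> ((1 / t) *\<^sub>R (y - x)) / t ^ CARD('n)) \<partial>lborel) \<longlongrightarrow> v x * (\<integral>z. \<eta> z \<partial>lborel)) (at_right 0)"
proof (rule tendstoI)
  fix e :: real assume e: "e > 0"
  define I where "I = (\<integral>z. \<bar>\<eta> z\<bar> \<partial>lborel)"
  have I: "I \<ge> 0" unfolding I_def by (rule integral_nonneg_AE) auto
  \<comment> \<open>The summand 1 covers the case \<open>I = 0\<close> and makes
    \<open>e' * I < e\<close> strict.\<close>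
  define e' where "e' = e / (I + 1)"
  have e': "e' > 0" "e' * I < e" using e I by (auto simp: e'_def field_simps)
  obtain r where r: "r > 0" "cball x r \<subseteq> S" using S(1,2) open_contains_cball by blast
  obtain d where d: "d > 0" "\<And>y. y \<in> S \<Longrightarrow> dist y x < d \<Longrightarrow> dist (v y) (v x) < e'"
    using S(2,3) e'(1) unfolding continuous_on_iff by metis
  have "dist (\<integral>y. v y * (\<eta> ((1 / t) *\<^sub>R (y - x)) / t ^ CARD('n)) \<partial>lborel) (v x * (\<integral>z. \<eta> z \<partial>lborel)) < e"
    if t: "t > 0" "t < min r d" for t
  proof -
    let ?p = "\<lambda>y. \<eta> ((1 / t) *\<^sub>R (y - x)) / t ^ CARD('n)"
    have cp: "continuous_on UNIV ?p"
      by (intro continuous_on_divide continuous_on_compose2[OF h(1)] continuous_intros) (use t in auto)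
    have sp: "?p y = 0" if "y \<notin> cball x t" for y
      using h(2)[OF scaled_notin_cball[OF that t(1)]] by simp
    have K: "compact (cball x t)" "cball x t \<subseteq> S" using r t by auto
    have ip: "integrable lborel ?p" by (rule integrable_compact_support[OF continuous_on_subset[OF cp] K(1) sp]) auto
    have iv: "integrable lborel (\<lambda>y. v y * ?p y)"
      by (rule integrable_compact_support[OF continuous_on_subset[OF continuous_mult_compact_support[OF S(1,3) K cp sp]] K(1)]) (auto simp: sp)
    have m: "\<eta> \<in> borel_measurable borel" by (rule borel_measurable_continuous_onI[OF h(1)])
    have "(\<integral>y. v y * ?p y \<partial>lborel) - v x * (\<integral>z. \<eta> z \<partial>lborel) = (\<integral>y. v y * ?p y \<partial>lborel) - (\<integral>y. v x * ?p y \<partial>lborel)"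
      unfolding lborel_integral_scaled[OF m t(1), of x, symmetric]
      by (simp only: Bochner_Integration.integral_mult_right_zero)
    also have "\<dots> = (\<integral>y. v y * ?p y - v x * ?p y \<partial>lborel)"
      by (rule Bochner_Integration.integral_diff[symmetric, OF iv integrable_mult_right[OF ip]])
    also have "\<bar>\<dots>\<bar> \<le> (\<integral>y. e' * \<bar>?p y\<bar> \<partial>lborel)"
    proof (rule abs_integral_le)
      fix y
      show "\<bar>v y * ?p y - v x * ?p y\<bar> \<le> e' * \<bar>?p y\<bar>"
      proof (cases "y \<in> cball x t")
        case True
        then have "\<bar>v y - v x\<bar> \<le> e'" using d(2)[of y] K(2) t by (auto simp: dist_real_def dist_commute)
        then show ?thesis unfolding left_diff_distrib[symmetric] abs_mult by (rule mult_right_mono) simp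
      next
        case False
        have "?p y = 0" by (rule sp[OF False])
        then show ?thesis by (simp only: mult_zero_right)
      qed
    qed (intro Bochner_Integration.integrable_diff iv integrable_mult_right integrable_abs ip)+
    also have "\<dots> = e' * I"
    proof -
      have "(\<lambda>z. \<bar>\<eta> z\<bar>) \<in> borel_measurable borel" using m by measurable
      from lborel_integral_scaled[OF this t(1), of x] have "(\<integral>y. \<bar>?p y\<bar> \<partial>lborel) = I"
        using t by (simp add: I_def abs_divide)
      then show ?thesis by (simp only: Bochner_Integration.integral_mult_right_zero)
    qed
    finally show ?thesis using e'(2) by (simp add: dist_real_def)
  qed
  then show "\<forall>\<^sub>F t in at_right 0. dist (\<integral>y. v y * (\<eta> ((1 / t) *\<^sub>R (y - x)) / t ^ CARD('n)) \<partial>lborel) (v x * (\<integral>z. \<eta> z \<partial>lborel)) < e"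
    unfolding eventually_at_right_field using r d by (intro exI[of _ "min r d"]) auto
qed

lemma integral_mult_bound:
  fixes v \<phi> :: "'a::euclidean_space \<Rightarrow> real"
  assumes "compact K" "continuous_on K v" "continuous_on K \<phi>" "\<And>y. y \<notin> K \<Longrightarrow> \<phi> y = 0" "\<And>y. \<bar>\<phi> y\<bar> \<le> B"
  shows "\<bar>\<integral>y. v y * \<phi> y \<partial>lborel\<bar> \<le> B * (LINT y:K|lborel. \<bar>v y\<bar>)"
proof -
  have i1: "integrable lborel (\<lambda>y. v y * \<phi> y)"
    by (rule integrable_compact_support[OF _ assms(1)]) (use assms in \<open>auto intro: continuous_on_mult\<close>)
  have i2: "integrable lborel (\<lambda>y. indicator K y *\<^sub>R \<bar>v y\<bar>)"
    by (rule borel_integrable_compact[OF assms(1)]) (use assms in \<open>auto intro: continuous_on_rabs\<close>)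
  have "\<bar>\<integral>y. v y * \<phi> y \<partial>lborel\<bar> \<le> (\<integral>y. B * (indicator K y *\<^sub>R \<bar>v y\<bar>) \<partial>lborel)"
  proof (rule abs_integral_le)
    fix y
    show "\<bar>v y * \<phi> y\<bar> \<le> B * (indicator K y *\<^sub>R \<bar>v y\<bar>)"
      using mult_left_mono[OF assms(5)[of y], of "\<bar>v y\<bar>"] assms(4)[of y] 
      by (cases "y \<in> K") (auto simp: abs_mult mult.commute)
  qed (use i1 i2 in auto)
  then show ?thesis by (simp add: set_lebesgue_integral_def)
qed

text \<open>The combination 2 \<theta>\<eta> + n \<eta> on the right is the one that
  \<open>kernel_exists\<close> turns into an m-fold Laplacian.\<close>

lemma DERIV_scaled_profile:
  assumes "one_minus_X ^ 2 dvd \<eta>" "t > 0"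
  shows "((\<lambda>t. trunc_poly \<eta> (w / t\<^sup>2) / t ^ n) has_real_derivative
     - (trunc_poly (smult 2 (pCons 0 (pderiv \<eta>)) + smult (real n) \<eta>) (w / t\<^sup>2) / t ^ Suc n)) (at t)"
proof -
  have a: "((\<lambda>t. w / t\<^sup>2) has_real_derivative - 2 * (w / t\<^sup>2) / t) (at t)"
    using assms(2) by (auto intro!: derivative_eq_intros simp: field_simps power2_eq_square)
  have b: "((\<lambda>t. trunc_poly \<eta> (w / t\<^sup>2)) has_real_derivative trunc_poly (pderiv \<eta>) (w / t\<^sup>2) * (- 2 * (w / t\<^sup>2) / t)) (at t)"
    by (rule DERIV_chain2[OF DERIV_trunc_poly[OF assms(1)] a])
  have c: "((\<lambda>t. 1 / t ^ n) has_real_derivative - real n / t ^ Suc n) (at t)"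
  proof (cases n)
    case (Suc k)
    have "((\<lambda>t. inverse (t ^ n)) has_real_derivative - (inverse (t ^ n) * (real n * t ^ (n - 1)) * inverse (t ^ n))) (at t)"
      using assms(2) by (auto intro!: derivative_eq_intros)
    moreover have "- (inverse (t ^ n) * (real n * t ^ (n - 1)) * inverse (t ^ n)) = - real n / t ^ Suc n"
      using assms(2) Suc by (simp add: field_simps)
    ultimately show ?thesis by (simp only: inverse_eq_divide)
  qed simp
  have "((\<lambda>t. trunc_poly \<eta> (w / t\<^sup>2) * (1 / t ^ n)) has_real_derivative
     trunc_poly (pderiv \<eta>) (w / t\<^sup>2) * (- 2 * (w / t\<^sup>2) / t) * (1 / t ^ n) + (- real n / t ^ Suc n) * trunc_poly \<eta> (w / t\<^sup>2)) (at t)"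
    by (rule DERIV_mult[OF b c])
  moreover have "trunc_poly (pderiv \<eta>) s * (- 2 * s / t) * (1 / t ^ n) + (- real n / t ^ Suc n) * trunc_poly \<eta> s =
     - (trunc_poly (smult 2 (pCons 0 (pderiv \<eta>)) + smult (real n) \<eta>) s / t ^ Suc n)" for s
    using assms(2) by (simp add: trunc_poly_def field_simps)
  ultimately show ?thesis by (simp only: times_divide_eq_right[of _ 1] mult_1_right)
qed

lemma set_integral_abs_mono:
  fixes f :: "real^'n::finite \<Rightarrow> real"
  assumes "compact K" "continuous_on K f" "compact L" "L \<subseteq> K"
  shows "(LINT y:L|lborel. \<bar>f y\<bar>) \<le> (LINT y:K|lborel. \<bar>f y\<bar>)"
  unfolding set_lebesgue_integral_def
proof (rule integral_mono)
  show "integrable lborel (\<lambda>y. indicat_real L y *\<^sub>R \<bar>f y\<bar>)" "integrable lborel (\<lambda>y. indicat_real K y *\<^sub>R \<bar>f y\<bar>)"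
    by (intro borel_integrable_compact continuous_on_rabs assms continuous_on_subset[OF assms(2)] order_refl)+
qed (use assms(4) in \<open>auto simp: indicator_def\<close>)

lemma set_integral_abs_nonneg: "0 \<le> (LINT y:K|lborel. \<bar>f y :: real\<bar>)"
  unfolding set_lebesgue_integral_def by (rule integral_nonneg_AE) (auto simp: indicator_def)

text \<open>The mean \<open>J t\<close> of \<open>Dlist is u\<close> against the rescaled kernel tends to a multiple of \<open>Dlist is u x\<close>
  as \<open>t \<rightarrow> 0\<close>, and integration by parts bounds its \<open>t\<close>-derivative by an average of \<open>\<Delta>\<^sup>m u\<close>.\<close>

lemma local_estimate_aux:
  fixes "is" :: "'n::finite list"
  assumes m: "m \<ge> 1" "2 * m < CARD('n)" "length is < 2 * m"
  shows "\<exists>C>0. \<forall>\<Omega> (u :: real^'n \<Rightarrow> real) x R A E \<tau>. open \<Omega> \<longrightarrow> Ck_on (2 * m) \<Omega> u \<longrightarrow> cball x R \<subseteq> \<Omega> \<longrightarrow>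
     0 < \<tau> \<longrightarrow> 2 * \<tau> \<le> R \<longrightarrow>
     (\<forall>t. 0 < t \<longrightarrow> t \<le> \<tau> \<longrightarrow> (LINT y:cball x t|lborel. \<bar>poly_laplacian m u y\<bar>) \<le> A * t ^ CARD('n)) \<longrightarrow>
     (LINT y:cball x (R / 2)|lborel. \<bar>poly_laplacian m u y\<bar>) \<le> E \<longrightarrow>
     \<bar>Dlist is u x\<bar> \<le> C * ((LINT y:cball x R|lborel. \<bar>u y\<bar>) / R ^ (CARD('n) + length is)
         + A * \<tau> ^ (2 * m - length is) + E / \<tau> ^ (CARD('n) + length is - 2 * m))"
proof -
  define n where "n = CARD('n)"
  define l where "l = length is"
  obtain \<zeta> \<eta> :: "real poly" where dz: "one_minus_X ^ (4 * m) dvd \<zeta>" and de: "one_minus_X ^ (2 * m + 1) dvd \<eta>"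
    and eq: "smult 2 (pCons 0 (pderiv \<eta>)) + smult (real n) \<eta> = (radial_lap (real n) ^^ m) \<zeta>"
    and c0: "(\<integral>z. trunc_poly \<eta> ((z::real^'n) \<bullet> z) \<partial>lborel) \<noteq> 0"
    using kernel_exists[where 'n='n, OF m(2,1)] unfolding n_def by blast
  define Z where "Z = (\<lambda>z::real^'n. trunc_poly \<zeta> (z \<bullet> z))"
  define H where "H = (\<lambda>z::real^'n. trunc_poly \<eta> (z \<bullet> z))"
  define c where "c = (\<integral>z. H z \<partial>lborel)"
  have cn: "c \<noteq> 0" using c0 by (simp add: c_def H_def)
  have supp: "trunc_poly q (z \<bullet> z) = 0" if "z \<notin> cball 0 1" for q and z :: "real^'n"
    using that by (auto simp: trunc_poly_def power2_norm_eq_inner[symmetric] abs_square_less_1)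
  have ZC: "Ck_on (length (rev is) + 2 * m) UNIV Z"
    unfolding Z_def by (intro Ck_on_trunc_poly Ck_on_inner_self open_UNIV power_le_dvd[OF dz]) (use m(3) in auto)
  have ZC1: "Ck_on (length (rev is)) UNIV Z" "Ck_on (2 * m) UNIV Z" by (rule Ck_on_mono[OF ZC]; simp)+
  have HC: "Ck_on (length (rev is)) UNIV H"
    unfolding H_def by (intro Ck_on_trunc_poly Ck_on_inner_self open_UNIV power_le_dvd[OF de]) (use m(3) in auto)
  have Z0: "Z z = 0" "H z = 0" if "z \<notin> cball 0 1" for z using supp[OF that] by (auto simp: Z_def H_def)
  have LZ: "poly_laplacian m Z = (\<lambda>z. trunc_poly ((radial_lap (real n) ^^ m) \<zeta>) (z \<bullet> z))"
    and dL: "one_minus_X dvd (radial_lap (real n) ^^ m) \<zeta>"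
    using poly_laplacian_trunc_poly[OF power_le_dvd[OF dz, of "2 * m + 1"], where 'n='n] m(1)
    unfolding Z_def n_def by auto
  have dl: "Dlist (rev is) Z z = 0" "Dlist (rev is) H z = 0" if "z \<notin> cball 0 1" for z
    using Dlist_outside_support[of "cball 0 1" Z z] Dlist_outside_support[of "cball 0 1" H z] Z0 that by auto
  have "Ck_on 0 UNIV (Dlist (rev is) Z)" "Ck_on 0 UNIV (Dlist (rev is) H)"
    using Ck_on_Dlist[OF ZC1(1)] Ck_on_Dlist[OF HC] by simp_all
  then obtain C1 C2 where C1: "C1 \<ge> 0" "\<And>z. \<bar>Dlist (rev is) Z z\<bar> \<le> C1" and C2: "C2 \<ge> 0" "\<And>z. \<bar>Dlist (rev is) H z\<bar> \<le> C2"
    using bounded_compact_support[of "Dlist (rev is) Z"] bounded_compact_support[of "Dlist (rev is) H"] dl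
    unfolding Ck_on_0 by blast
  define C where "C = (C1 + C2 * 2 ^ (n + l) + 1) / \<bar>c\<bar>"
  have Cp: "C > 0" using C1(1) C2(1) cn by (auto simp: C_def intro!: divide_pos_pos add_nonneg_pos)
  show ?thesis
  proof (rule exI[of _ C], intro conjI Cp allI impI)
    fix \<Omega> :: "(real^'n) set" and u x R A E \<tau>
    assume Om: "open \<Omega>" and u: "Ck_on (2 * m) \<Omega> u" and R: "cball x R \<subseteq> \<Omega>" and tau: "0 < \<tau>" "2 * \<tau> \<le> R"
      and A: "\<forall>t. 0 < t \<longrightarrow> t \<le> \<tau> \<longrightarrow> (LINT y:cball x t|lborel. \<bar>poly_laplacian m u y\<bar>) \<le> A * t ^ CARD('n)"
      and E: "(LINT y:cball x (R / 2)|lborel. \<bar>poly_laplacian m u y\<bar>) \<le> E"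
    have Rp: "R > 0" using tau by simp
    define M where "M = (\<lambda>t. LINT y:cball x t|lborel. \<bar>poly_laplacian m u y\<bar>)"
    define U where "U = (LINT y:cball x R|lborel. \<bar>u y\<bar>)"
    define v where "v = Dlist is u"
    have cf: "continuous_on \<Omega> (poly_laplacian m u)"
      using Ck_on_poly_laplacian[OF Om u, of 0 m] by (simp add: Ck_on_0)
    have cu: "continuous_on \<Omega> u" by (rule Ck_on_continuous[OF u])
    have cv: "continuous_on \<Omega> v" unfolding v_def using Ck_on_Dlist[OF u, of "is" 0] m(3) by (simp add: Ck_on_0)
    have ul: "Ck_on (length is) \<Omega> u" by (rule Ck_on_mono[OF u]) (use m(3) in auto)
    have sub: "cball x t \<subseteq> \<Omega>" if "t \<le> R" for t using R that by (meson order_trans subset_cball)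
    have M0: "M t \<ge> 0" for t unfolding M_def by (rule set_integral_abs_nonneg)
    have U0: "U \<ge> 0" unfolding U_def by (rule set_integral_abs_nonneg)
    have ME: "M t \<le> E" if "t \<le> R / 2" for t
    proof -
      have "cball x t \<subseteq> cball x (R / 2)" using that by (rule subset_cball)
      moreover have "cball x (R / 2) \<subseteq> \<Omega>" using sub[of "R / 2"] Rp by simp
      ultimately have "M t \<le> M (R / 2)" unfolding M_def
        by (intro set_integral_abs_mono compact_cball continuous_on_subset[OF cf])
      then show ?thesis using E unfolding M_def by simp
    qed
    define g where "g = (\<lambda>t y. H ((1 / t) *\<^sub>R (y - x)) / t ^ n)"
    define J where "J = (\<lambda>t. \<integral>y. v y * g t y \<partial>lborel)"
    define L where "L = (\<lambda>z::real^'n. trunc_poly ((radial_lap (real n) ^^ m) \<zeta>) (z \<bullet> z))"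
    define g' where "g' = (\<lambda>t y. - (L ((1 / t) *\<^sub>R (y - x)) / t ^ Suc n))"
    define J' where "J' = (\<lambda>t. \<integral>y. v y * g' t y \<partial>lborel)"
    have inner_scaled: "((1 / t) *\<^sub>R (y - x)) \<bullet> ((1 / t) *\<^sub>R (y - x)) = ((y - x) \<bullet> (y - x)) / t\<^sup>2" for t :: real and y :: "real^'n"
      by (simp add: power2_eq_square)
    have L0: "L z = 0" if "z \<notin> cball 0 1" for z using supp[OF that] by (simp add: L_def)
    have cL: "continuous_on UNIV L" unfolding L_def
      by (rule continuous_on_compose2[OF continuous_on_trunc_poly[OF dL, of UNIV]]) (auto intro!: continuous_intros)
    have cH: "continuous_on UNIV H" by (rule Ck_on_continuous[OF HC])
    have dg: "((\<lambda>t. g t y) has_real_derivative g' t y) (at t)" if "t > 0" for t y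
    proof -
      have "((\<lambda>t. trunc_poly \<eta> (((y - x) \<bullet> (y - x)) / t\<^sup>2) / t ^ n) has_real_derivative g' t y) (at t)"
        using DERIV_scaled_profile[of \<eta> t "(y - x) \<bullet> (y - x)" n] power_le_dvd[OF de, of 2] m(1) that
        unfolding eq g'_def L_def inner_scaled by simp
      then show ?thesis unfolding g_def H_def inner_scaled .
    qed
    have g0: "g t y = 0" "g' t y = 0" if "y \<notin> cball x t" "t > 0" for t y
      using scaled_notin_cball[OF that] Z0 L0 unfolding g_def g'_def by auto
    have cg: "continuous_on UNIV (g t)" if "t > 0" for t
      unfolding g_def by (intro continuous_on_divide continuous_on_compose2[OF cH] continuous_intros) (use that in auto)
    have cg': "continuous_on ({0<..<R} \<times> UNIV) (\<lambda>(t, y). g' t y)"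
      unfolding g'_def case_prod_unfold
      by (intro continuous_on_minus continuous_on_divide continuous_on_compose2[OF cL] continuous_intros) auto
    have J: "(J has_real_derivative J' t) (at t)" if t: "t \<in> {0<..<R}" for t
      unfolding J_def J'_def
    proof (rule DERIV_integral_compact_support[OF t compact_cball])
      fix t y assume "t \<in> {0<..<R}"
      then show "((\<lambda>t. v y * g t y) has_real_derivative v y * g' t y) (at t)" by (intro DERIV_cmult dg) simp
    next
      fix t assume t: "t \<in> {0<..<R}"
      show "continuous_on UNIV (\<lambda>y. v y * g t y)"
        by (rule continuous_mult_compact_support[OF Om cv compact_cball sub[of t] cg]) (use t g0 in auto)
    next
      fix t y assume "t \<in> {0<..<R}" "y \<notin> cball x R"
      then show "v y * g t y = 0" using g0[of y t] by auto
    next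
      \<comment> \<open>\<open>v\<close> is controlled on \<open>\<Omega>\<close> only; off the ball
        of radius \<open>R\<close> the factor \<open>g' t\<close> is zero. The two open sets cover
        the strip.\<close>
      have "continuous_on ({0<..<R} \<times> \<Omega> \<union> {0<..<R} \<times> (- cball x R)) (\<lambda>(t, y). v y * g' t y)"
      proof (rule continuous_on_open_Un)
        show "continuous_on ({0<..<R} \<times> \<Omega>) (\<lambda>(t, y). v y * g' t y)"
          unfolding case_prod_unfold
          by (intro continuous_on_mult continuous_on_compose2[OF cv] continuous_intros
              continuous_on_subset[OF cg'[unfolded case_prod_unfold]]) auto
        have "v y * g' t y = 0" if "t \<in> {0<..<R}" "y \<notin> cball x R" for t y
          using g0[of y t] that by auto
        then show "continuous_on ({0<..<R} \<times> (- cball x R)) (\<lambda>(t, y). v y * g' t y)"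
          by (subst continuous_on_cong[OF refl, where g="\<lambda>_. 0"]) auto
      qed (auto intro!: open_Times Om simp: open_Compl)
      moreover have "{0<..<R} \<times> \<Omega> \<union> {0<..<R} \<times> (- cball x R) = {0<..<R} \<times> UNIV" using R by auto
      ultimately show "continuous_on ({0<..<R} \<times> UNIV) (\<lambda>(t, y). v y * g' t y)" by simp
    qed
    have int_v: "\<bar>\<integral>y. v y * G ((1 / t) *\<^sub>R (y - x)) \<partial>lborel\<bar> = \<bar>\<integral>y. u y * Dlist (rev is) (\<lambda>y. G ((1 / t) *\<^sub>R (y - x))) y \<partial>lborel\<bar>"
      if t: "0 < t" "t \<le> R" and G: "Ck_on (length (rev is)) UNIV G" "\<And>z. z \<notin> cball 0 1 \<Longrightarrow> G z = 0" for t G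
      unfolding v_def
      by (subst ibp_Dlist[OF Om compact_cball sub[OF t(2)] ul])
         (use Ck_on_scaled[OF G(1)] G(2)[OF scaled_notin_cball[OF _ t(1)]] in \<open>auto simp: abs_mult power_abs\<close>)
    \<comment> \<open>Up to the factor - t^(2m-n-1), \<open>g' t\<close> is the m-fold Laplacian of
      the rescaled \<open>Z\<close>. Integration by parts moves the derivatives \<open>is\<close> to
      the kernel, at the price t^(-l), and brings the Laplacians back onto \<open>u\<close>.\<close>
    have J'_bound: "\<bar>J' t\<bar> \<le> C1 * (t ^ (2 * m) / t ^ Suc n / t ^ l) * M t" if t: "0 < t" "t \<le> R" for t
    proof -
      define Zt where "Zt = (\<lambda>y. Z ((1 / t) *\<^sub>R (y - x)))"
      have Zt: "Ck_on (length (rev is) + 2 * m) UNIV Zt" unfolding Zt_def by (rule Ck_on_scaled[OF ZC])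
      have Zt1: "Ck_on (length (rev is)) UNIV Zt" by (rule Ck_on_mono[OF Zt]) auto
      have Zt0: "Zt y = 0" if "y \<notin> cball x t" for y unfolding Zt_def by (rule Z0(1)[OF scaled_notin_cball[OF that t(1)]])
      have cl: "closed (cball x t)" by simp
      have K: "compact (cball x t)" "cball x t \<subseteq> \<Omega>" using sub t by auto
      have pl: "poly_laplacian m Zt y = (1 / t) ^ (2 * m) * L ((1 / t) *\<^sub>R (y - x))" for y
        unfolding Zt_def poly_laplacian_scaled[OF ZC1(2)] LZ L_def ..
      have "J' t = (\<integral>y. - (t ^ (2 * m) / t ^ Suc n) * (v y * poly_laplacian m Zt y) \<partial>lborel)"
        unfolding J'_def g'_def pl using t(1) by (simp add: field_simps)
      also have "\<dots> = - (t ^ (2 * m) / t ^ Suc n) * (\<integral>y. v y * poly_laplacian m Zt y \<partial>lborel)"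
        by (rule Bochner_Integration.integral_mult_right_zero)
      also have "(\<integral>y. v y * poly_laplacian m Zt y \<partial>lborel) = (-1) ^ l * (\<integral>y. u y * Dlist (rev is) (poly_laplacian m Zt) y \<partial>lborel)"
        unfolding v_def l_def
      proof (rule ibp_Dlist[OF Om K ul])
        show "Ck_on (length is) UNIV (poly_laplacian m Zt)"
          by (rule Ck_on_poly_laplacian[OF open_UNIV Zt]) simp
        show "poly_laplacian m Zt y = 0" if "y \<notin> cball x t" for y
          by (rule poly_laplacian_outside_support[OF cl Zt0 that])
      qed
      also have "(\<integral>y. u y * Dlist (rev is) (poly_laplacian m Zt) y \<partial>lborel) = (\<integral>y. poly_laplacian m u y * Dlist (rev is) Zt y \<partial>lborel)"
        unfolding poly_laplacian_Dlist_commute[OF Zt, symmetric]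
      proof (rule ibp_poly_laplacian[OF Om K u])
        show "Ck_on (2 * m) UNIV (Dlist (rev is) Zt)" by (rule Ck_on_Dlist[OF Zt]) simp
        show "Dlist (rev is) Zt y = 0" if "y \<notin> cball x t" for y
          by (rule Dlist_outside_support[OF cl Zt0 that])
      qed
      finally have e: "\<bar>J' t\<bar> = t ^ (2 * m) / t ^ Suc n * \<bar>\<integral>y. poly_laplacian m u y * Dlist (rev is) Zt y \<partial>lborel\<bar>"
        using t(1) by (simp add: abs_mult power_abs)
      have "\<bar>\<integral>y. poly_laplacian m u y * Dlist (rev is) Zt y \<partial>lborel\<bar> \<le> (C1 / t ^ l) * M t"
        unfolding M_def
      proof (rule integral_mult_bound[OF K(1)])
        show "continuous_on (cball x t) (poly_laplacian m u)" by (rule continuous_on_subset[OF cf K(2)])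
        show "continuous_on (cball x t) (Dlist (rev is) Zt)"
          using Ck_on_Dlist[OF Zt1, of "rev is" 0] by (auto simp: Ck_on_0 intro: continuous_on_subset)
        show "Dlist (rev is) Zt y = 0" if "y \<notin> cball x t" for y
          by (rule Dlist_outside_support[OF cl Zt0 that])
        show "\<bar>Dlist (rev is) Zt y\<bar> \<le> C1 / t ^ l" for y
          unfolding Zt_def Dlist_scaled[OF ZC1(1)] abs_mult 
          using C1(2)[of "(1 / t) *\<^sub>R (y - x)"] t(1) by (simp add: l_def field_simps power_divide)
      qed
      then have "\<bar>J' t\<bar> \<le> t ^ (2 * m) / t ^ Suc n * ((C1 / t ^ l) * M t)"
        unfolding e by (rule mult_left_mono) (use t(1) in simp)
      then show ?thesis by (simp add: field_simps)
    qed
    \<comment> \<open>At the outer radius all derivatives are thrown on the kernel, so that the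
      integral of |u| suffices.\<close>
    have J_bound: "\<bar>J (R / 2)\<bar> \<le> C2 * 2 ^ (n + l) * (U / R ^ (n + l))"
    proof -
      define t where "t = R / 2"
      have t: "0 < t" "t \<le> R" using Rp by (auto simp: t_def)
      have K: "compact (cball x t)" "cball x t \<subseteq> \<Omega>" using sub t by auto
      define Ht where "Ht = (\<lambda>y. H ((1 / t) *\<^sub>R (y - x)))"
      have Ht: "Ck_on (length (rev is)) UNIV Ht" unfolding Ht_def by (rule Ck_on_scaled[OF HC])
      have Ht0: "Ht y = 0" if "y \<notin> cball x t" for y unfolding Ht_def by (rule Z0(2)[OF scaled_notin_cball[OF that t(1)]])
      have "J t = (\<integral>y. v y * Ht y \<partial>lborel) / t ^ n"
        unfolding J_def g_def Ht_def by simp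
      then have "\<bar>J t\<bar> = \<bar>\<integral>y. v y * Ht y \<partial>lborel\<bar> / t ^ n"
        using t(1) by (simp add: abs_divide)
      also have "\<bar>\<integral>y. v y * Ht y \<partial>lborel\<bar> = \<bar>\<integral>y. u y * Dlist (rev is) Ht y \<partial>lborel\<bar>"
        unfolding Ht_def by (rule int_v[OF t HC Z0(2)])
      also have "\<bar>\<integral>y. u y * Dlist (rev is) Ht y \<partial>lborel\<bar> \<le> (C2 / t ^ l) * (LINT y:cball x t|lborel. \<bar>u y\<bar>)"
      proof (rule integral_mult_bound[OF K(1)])
        show "continuous_on (cball x t) u" by (rule continuous_on_subset[OF cu K(2)])
        show "continuous_on (cball x t) (Dlist (rev is) Ht)"
          using Ck_on_Dlist[OF Ht, of "rev is" 0] by (auto simp: Ck_on_0 intro: continuous_on_subset)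
        show "Dlist (rev is) Ht y = 0" if "y \<notin> cball x t" for y
          by (rule Dlist_outside_support[OF closed_cball Ht0 that])
        show "\<bar>Dlist (rev is) Ht y\<bar> \<le> C2 / t ^ l" for y
          unfolding Ht_def Dlist_scaled[OF HC] abs_mult 
          using C2(2)[of "(1 / t) *\<^sub>R (y - x)"] t(1) by (simp add: l_def field_simps power_divide)
      qed
      also have "(LINT y:cball x t|lborel. \<bar>u y\<bar>) \<le> U"
        unfolding U_def by (rule set_integral_abs_mono) (use cu R t in \<open>auto intro: continuous_on_subset\<close>)
      finally have "\<bar>J t\<bar> \<le> C2 / t ^ l * U / t ^ n" using t(1) C2(1) by (simp add: divide_right_mono mult_left_mono)
      also have "\<dots> = C2 * 2 ^ (n + l) * (U / R ^ (n + l))"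
        unfolding t_def by (simp add: power_add power_divide field_simps)
      finally show ?thesis by (simp add: t_def)
    qed
    have lim: "(J \<longlongrightarrow> v x * c) (at_right 0)"
      unfolding J_def g_def c_def n_def
      by (rule approx_identity[OF Om _ cv cH Z0(2)]) (use R Rp in auto)
    \<comment> \<open>The assumed bound at \<open>t = \<tau>\<close> dominates a nonnegative
      integral.\<close>
    have Ann: "A \<ge> 0"
    proof -
      have "0 \<le> A * \<tau> ^ n" using A tau(1) M0[of \<tau>] unfolding n_def M_def by (meson order_trans order_refl)
      then show ?thesis using zero_less_power[OF tau(1), of n] by (metis zero_le_mult_iff not_le)
    qed
    \<comment> \<open>For t \<le> \<tau> the masses are at most A t^n, so |J' t| is bounded by a
      multiple of A t^(2m-l-1). The mean value theorem on [s, \<tau>] with s \<rightarrow> 0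
      replaces integration.\<close>
    have near: "\<bar>J \<tau> - v x * c\<bar> \<le> C1 * A * \<tau> ^ (2 * m - l)"
    proof -
      have d: "\<bar>J' t\<bar> \<le> C1 * A * \<tau> ^ (2 * m - l - 1)" if t: "0 < t" "t \<le> \<tau>" for t
      proof -
        have "\<bar>J' t\<bar> \<le> C1 * (t ^ (2 * m) / t ^ Suc n / t ^ l) * M t" using J'_bound t tau by simp
        also have "\<dots> \<le> C1 * (t ^ (2 * m) / t ^ Suc n / t ^ l) * (A * t ^ n)"
          by (rule mult_left_mono) (use A t C1(1) in \<open>auto simp: M_def n_def\<close>)
        also have "\<dots> = C1 * A * t ^ (2 * m - l - 1)"
        proof -
          have "2 * m = Suc l + (2 * m - l - 1)" using m(3) by (simp add: l_def)
          then have "t ^ (2 * m) = t ^ Suc l * t ^ (2 * m - l - 1)" by (metis power_add)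
          then show ?thesis using t(1) by simp
        qed
        also have "\<dots> \<le> C1 * A * \<tau> ^ (2 * m - l - 1)"
          using t C1(1) Ann by (intro mult_left_mono power_mono) auto
        finally show ?thesis .
      qed
      have b: "\<bar>J \<tau> - J s\<bar> \<le> C1 * A * \<tau> ^ (2 * m - l)" if s: "0 < s" "s < \<tau>" for s
      proof -
        have "\<exists>z. z > s \<and> z < \<tau> \<and> J \<tau> - J s = (\<tau> - s) * J' z"
          by (rule MVT2[OF s(2)]) (use J s tau in auto)
        then obtain z where z: "z > s" "z < \<tau>" "J \<tau> - J s = (\<tau> - s) * J' z" by blast
        have "\<bar>J \<tau> - J s\<bar> = (\<tau> - s) * \<bar>J' z\<bar>" using z s by (simp add: abs_mult)
        also have "\<dots> \<le> \<tau> * (C1 * A * \<tau> ^ (2 * m - l - 1))"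
          by (rule mult_mono) (use d[of z] z s tau in auto)
        also have "\<dots> = C1 * A * \<tau> ^ Suc (2 * m - l - 1)" by simp
        also have "Suc (2 * m - l - 1) = 2 * m - l" using m(3) by (simp add: l_def)
        finally show ?thesis .
      qed
      have l2: "((\<lambda>s. \<bar>J \<tau> - J s\<bar>) \<longlongrightarrow> \<bar>J \<tau> - v x * c\<bar>) (at_right 0)"
        by (intro tendsto_intros lim)
      show ?thesis
        by (rule tendsto_upperbound[OF l2]) (auto simp: eventually_at_right_field intro!: exI[of _ \<tau>] tau b)
    qed
    define e where "e = n + l - 2 * m"
    have e: "e \<ge> 1" "n + l = e + 2 * m" using m(2) by (auto simp: e_def n_def)
    have far: "\<bar>J (R / 2) - J \<tau>\<bar> \<le> C1 * E / \<tau> ^ e"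
    proof -
      \<comment> \<open>An antiderivative of the bound C1 E t^(-e-1) on |J' t|, where the masses are
        estimated by E alone. Both G - J and G + J are then nondecreasing.\<close>
      define G where "G = (\<lambda>t::real. - (C1 * E / real e) * (1 / t ^ e))"
      have E0: "E \<ge> 0" using ME[of "R / 2"] M0[of "R / 2"] by simp
      have dG: "(G has_real_derivative C1 * E / t ^ Suc e) (at t)" if "t > 0" for t
      proof -
        have "((\<lambda>t. inverse (t ^ e)) has_real_derivative - (inverse (t ^ e) * (real e * t ^ (e - 1)) * inverse (t ^ e))) (at t)"
          using that by (auto intro!: derivative_eq_intros)
        then have "(G has_real_derivative - (C1 * E / real e) * - (inverse (t ^ e) * (real e * t ^ (e - 1)) * inverse (t ^ e))) (at t)"
          unfolding G_def inverse_eq_divide by (rule DERIV_cmult)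
        moreover have "- (C1 * E / real e) * - (inverse (t ^ e) * (real e * t ^ (e - 1)) * inverse (t ^ e)) = C1 * E / t ^ Suc e"
        proof -
          have "- (C1 * E / real e) * - (inverse (t ^ e) * (real e * t ^ (e - 1)) * inverse (t ^ e)) =
             C1 * E * (inverse (t ^ e) * (t ^ (e - 1) * inverse (t ^ e)))"
            using e(1) by simp
          also have "inverse (t ^ e) * (t ^ (e - 1) * inverse (t ^ e)) = 1 / t ^ Suc e"
            using that e(1) by (cases e) (simp_all add: field_simps)
          finally show ?thesis by simp
        qed
        ultimately show ?thesis by simp
      qed
      have d: "\<bar>J' t\<bar> \<le> C1 * E / t ^ Suc e" if t: "0 < t" "t \<le> R / 2" for t
      proof -
        have "\<bar>J' t\<bar> \<le> C1 * (t ^ (2 * m) / t ^ Suc n / t ^ l) * M t" using J'_bound t Rp by simp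
        also have "\<dots> \<le> C1 * (t ^ (2 * m) / t ^ Suc n / t ^ l) * E"
          by (rule mult_left_mono) (use ME t C1(1) in auto)
        also have "t ^ (2 * m) / t ^ Suc n / t ^ l = 1 / t ^ Suc e"
        proof -
          have "t ^ Suc n * t ^ l = t ^ Suc e * t ^ (2 * m)" 
            unfolding power_add[symmetric] using e(2) by (simp only: add_Suc)
          then show ?thesis using t(1) by (simp add: field_simps)
        qed
        finally show ?thesis by simp
      qed
      have le: "\<tau> \<le> R / 2" using tau by simp
      have "G \<tau> - J \<tau> \<le> G (R / 2) - J (R / 2)"
      proof (rule DERIV_nonneg_imp_nondecreasing[OF le])
        fix t assume t: "\<tau> \<le> t" "t \<le> R / 2"
        then have "((\<lambda>t. G t - J t) has_real_derivative C1 * E / t ^ Suc e - J' t) (at t)"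
          by (intro DERIV_diff dG J) (use tau Rp in auto)
        moreover have "C1 * E / t ^ Suc e - J' t \<ge> 0" using d[of t] t tau by linarith
        ultimately show "\<exists>y. ((\<lambda>t. G t - J t) has_real_derivative y) (at t) \<and> 0 \<le> y" by blast
      qed
      moreover have "G \<tau> + J \<tau> \<le> G (R / 2) + J (R / 2)"
      proof (rule DERIV_nonneg_imp_nondecreasing[OF le])
        fix t assume t: "\<tau> \<le> t" "t \<le> R / 2"
        then have "((\<lambda>t. G t + J t) has_real_derivative C1 * E / t ^ Suc e + J' t) (at t)"
          by (intro DERIV_add dG J) (use tau Rp in auto)
        moreover have "C1 * E / t ^ Suc e + J' t \<ge> 0" using d[of t] t tau by linarith
        ultimately show "\<exists>y. ((\<lambda>t. G t + J t) has_real_derivative y) (at t) \<and> 0 \<le> y" by blast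
      qed
      moreover have "G (R / 2) \<le> 0" using C1(1) E0 Rp by (simp add: G_def)
      moreover have "- G \<tau> \<le> C1 * E / \<tau> ^ e"
      proof -
        have "C1 * E / real e \<le> C1 * E / 1" using C1(1) E0 e(1) by (intro divide_left_mono) auto
        then have "C1 * E / real e / \<tau> ^ e \<le> C1 * E / 1 / \<tau> ^ e" by (rule divide_right_mono) (use tau(1) in simp)
        then show ?thesis unfolding G_def by simp
      qed
      ultimately show ?thesis by linarith
    qed
    have "\<bar>v x\<bar> * \<bar>c\<bar> \<le> C2 * 2 ^ (n + l) * (U / R ^ (n + l)) + C1 * A * \<tau> ^ (2 * m - l) + C1 * E / \<tau> ^ e"
      unfolding abs_mult[symmetric] using near far J_bound by linarith
    also have "\<dots> \<le> (C1 + C2 * 2 ^ (n + l) + 1) * (U / R ^ (n + l) + A * \<tau> ^ (2 * m - l) + E / \<tau> ^ e)"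
    proof -
      define a where "a = U / R ^ (n + l)"
      define b where "b = A * \<tau> ^ (2 * m - l)"
      define d where "d = E / \<tau> ^ e"
      have "a \<ge> 0" "b \<ge> 0" "d \<ge> 0"
        using U0 Rp Ann tau(1) ME[of "R / 2"] M0[of "R / 2"] by (auto simp: a_def b_def d_def)
      moreover have "C2 * 2 ^ (n + l) \<ge> 0" using C2(1) by simp
      ultimately have "C2 * 2 ^ (n + l) * a + C1 * b + C1 * d \<le> (C1 + C2 * 2 ^ (n + l) + 1) * (a + b + d)"
        using C1(1) by (simp add: distrib_left distrib_right add_increasing add_increasing2)
      then show ?thesis by (simp add: a_def b_def d_def mult.assoc)
    qed
    finally have "\<bar>v x\<bar> \<le> C * (U / R ^ (n + l) + A * \<tau> ^ (2 * m - l) + E / \<tau> ^ e)"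
      using cn by (simp add: C_def field_simps)
    then show "\<bar>Dlist is u x\<bar> \<le> C * ((LINT y:cball x R|lborel. \<bar>u y\<bar>) / R ^ (CARD('n) + length is)
         + A * \<tau> ^ (2 * m - length is) + E / \<tau> ^ (CARD('n) + length is - 2 * m))"
      unfolding v_def U_def n_def l_def e_def .
  qed
qed

text \<open>Only finitely many index lists are shorter than 2m, so one constant serves them
  all.\<close>

lemma local_estimate:
  assumes m: "m \<ge> 1" "2 * m < CARD('n::finite)"
  obtains C where "C > 0" "\<And>\<Omega> (u :: real^'n \<Rightarrow> real) x R A E \<tau> is. open \<Omega> \<Longrightarrow> Ck_on (2 * m) \<Omega> u \<Longrightarrow> cball x R \<subseteq> \<Omega> \<Longrightarrow>
     length is < 2 * m \<Longrightarrow> 0 < \<tau> \<Longrightarrow> 2 * \<tau> \<le> R \<Longrightarrow>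
     (\<And>t. 0 < t \<Longrightarrow> t \<le> \<tau> \<Longrightarrow> (LINT y:cball x t|lborel. \<bar>poly_laplacian m u y\<bar>) \<le> A * t ^ CARD('n)) \<Longrightarrow>
     (LINT y:cball x (R / 2)|lborel. \<bar>poly_laplacian m u y\<bar>) \<le> E \<Longrightarrow>
     \<bar>Dlist is u x\<bar> \<le> C * ((LINT y:cball x R|lborel. \<bar>u y\<bar>) / R ^ (CARD('n) + length is)
         + A * \<tau> ^ (2 * m - length is) + E / \<tau> ^ (CARD('n) + length is - 2 * m))"
proof -
  let ?P = "\<lambda>is C. \<forall>\<Omega> (u :: real^'n \<Rightarrow> real) x R A E \<tau>. open \<Omega> \<longrightarrow> Ck_on (2 * m) \<Omega> u \<longrightarrow> cball x R \<subseteq> \<Omega> \<longrightarrow>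
     0 < \<tau> \<longrightarrow> 2 * \<tau> \<le> R \<longrightarrow>
     (\<forall>t. 0 < t \<longrightarrow> t \<le> \<tau> \<longrightarrow> (LINT y:cball x t|lborel. \<bar>poly_laplacian m u y\<bar>) \<le> A * t ^ CARD('n)) \<longrightarrow>
     (LINT y:cball x (R / 2)|lborel. \<bar>poly_laplacian m u y\<bar>) \<le> E \<longrightarrow>
     \<bar>Dlist is u x\<bar> \<le> C * ((LINT y:cball x R|lborel. \<bar>u y\<bar>) / R ^ (CARD('n) + length is)
         + A * \<tau> ^ (2 * m - length is) + E / \<tau> ^ (CARD('n) + length is - 2 * m))"
  let ?L = "{is :: 'n list. length is < 2 * m}"
  have fin: "finite ?L"
    by (rule finite_subset[OF _ finite_lists_length_le[of UNIV "2 * m"]]) auto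
  have "\<forall>is :: 'n list. \<exists>C. length is < 2 * m \<longrightarrow> C > 0 \<and> ?P is C"
    using local_estimate_aux[where 'n='n, OF m] by blast
  then obtain D where D: "\<And>is :: 'n list. length is < 2 * m \<Longrightarrow> D is > 0 \<and> ?P is (D is)" by metis
  define C where "C = 1 + sum D ?L"
  have DC: "D is \<le> C" if "length is < 2 * m" for "is" :: "'n list"
    using member_le_sum[of "is" ?L D] that D fin unfolding C_def by (fastforce simp: less_imp_le)
  have "sum D ?L \<ge> 0" by (rule sum_nonneg) (use D in \<open>auto simp: less_imp_le\<close>)
  then have "C > 0" unfolding C_def by simp
  then show thesis
  proof (rule that)
    fix \<Omega> and u :: "real^'n \<Rightarrow> real" and x R A E \<tau> and "is" :: "'n list"
    assume a: "open \<Omega>" "Ck_on (2 * m) \<Omega> u" "cball x R \<subseteq> \<Omega>" "length is < 2 * m" "0 < \<tau>" "2 * \<tau> \<le> R"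
      and A: "\<And>t. 0 < t \<Longrightarrow> t \<le> \<tau> \<Longrightarrow> (LINT y:cball x t|lborel. \<bar>poly_laplacian m u y\<bar>) \<le> A * t ^ CARD('n)"
      and E: "(LINT y:cball x (R / 2)|lborel. \<bar>poly_laplacian m u y\<bar>) \<le> E"
    let ?r = "(LINT y:cball x R|lborel. \<bar>u y\<bar>) / R ^ (CARD('n) + length is)
         + A * \<tau> ^ (2 * m - length is) + E / \<tau> ^ (CARD('n) + length is - 2 * m)"
    have le: "\<bar>Dlist is u x\<bar> \<le> D is * ?r"
      using D[OF a(4)] a A E by blast
    \<comment> \<open>Nonnegativity of the bracket is read off the estimate itself, since
      \<open>D is\<close> is positive and the product bounds an absolute value.\<close>
    have "0 \<le> D is * ?r" using le by linarith
    then have "?r \<ge> 0" using D[OF a(4)] by (simp add: zero_le_mult_iff)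
    then have "D is * ?r \<le> C * ?r" by (rule mult_right_mono[OF DC[OF a(4)]])
    then show "\<bar>Dlist is u x\<bar> \<le> C * ?r" using le by linarith
  qed
qed

subsection \<open>Radial test functions with nonnegative iterated Laplacian\<close>

text \<open>In the variables \<open>s\<close> and \<open>y = (e / s)\<^sup>a\<close> the operator \<open>s d/ds\<close> acts on \<open>s\<^sup>\<beta> P(y)\<close> through
  \<open>P \<mapsto> \<beta> P - a y P'\<close>.\<close>

definition pow_op :: "real \<Rightarrow> real \<Rightarrow> real poly \<Rightarrow> real poly" where
  "pow_op a c P = smult c P - smult a (pCons 0 (pderiv P))"

definition pow_poly :: "real \<Rightarrow> real \<Rightarrow> real \<Rightarrow> real poly \<Rightarrow> real \<Rightarrow> real" where
  "pow_poly a e \<beta> P s = s powr \<beta> * poly P ((e / s) powr a)"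

lemma DERIV_pow_poly:
  assumes "s > 0" "e > 0"
  shows "(pow_poly a e \<beta> P has_real_derivative pow_poly a e (\<beta> - 1) (pow_op a \<beta> P) s) (at s)"
proof -
  define y where "y = (\<lambda>s. (e / s) powr a)"
  have dy: "(y has_real_derivative - (a * y s / s)) (at s)"
  proof -
    have 1: "((\<lambda>s. e / s) has_real_derivative - (e / s\<^sup>2)) (at s)"
      using assms by (auto intro!: derivative_eq_intros simp: power2_eq_square)
    have "(y has_real_derivative a * (e / s) powr (a - 1) * - (e / s\<^sup>2)) (at s)"
      unfolding y_def by (rule DERIV_chain2[OF has_real_derivative_powr 1]) (use assms in simp)
    moreover have "a * (e / s) powr (a - 1) * - (e / s\<^sup>2) = - (a * y s / s)"
      unfolding y_def using assms by (simp add: powr_diff field_simps power2_eq_square)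
    ultimately show ?thesis by simp
  qed
  have 1: "((\<lambda>s. poly P (y s)) has_real_derivative poly (pderiv P) (y s) * - (a * y s / s)) (at s)"
    by (rule DERIV_chain2[OF poly_DERIV dy])
  have 2: "((\<lambda>s. s powr \<beta>) has_real_derivative \<beta> * s powr (\<beta> - 1)) (at s)"
    by (rule has_real_derivative_powr[OF assms(1)])
  have "((\<lambda>s. s powr \<beta> * poly P (y s)) has_real_derivative
     \<beta> * s powr (\<beta> - 1) * poly P (y s) + poly (pderiv P) (y s) * - (a * y s / s) * s powr \<beta>) (at s)"
    by (rule DERIV_mult[OF 2 1])
  moreover have "\<beta> * s powr (\<beta> - 1) * poly P (y s) + poly (pderiv P) (y s) * - (a * y s / s) * s powr \<beta>
     = s powr (\<beta> - 1) * poly (pow_op a \<beta> P) (y s)"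
  proof -
    have "s powr \<beta> = s powr (\<beta> - 1) * s" using assms(1) by (simp add: powr_diff)
    then show ?thesis using assms(1) by (simp add: pow_op_def algebra_simps)
  qed
  ultimately show ?thesis unfolding pow_poly_def[abs_def] y_def by simp
qed

lemma Ck_on_pow_poly:
  assumes "e > 0"
  shows "Ck_on k (- {0 :: real^'n::finite}) (\<lambda>x. pow_poly a e \<beta> P (x \<bullet> x))"
proof -
  \<comment> \<open>Each s-derivative lowers the exponent by one and replaces the polynomial by its
    image under \<open>pow_op\<close>; \<open>Q j\<close> is the polynomial after j
    derivatives.\<close>
  define Q where "Q = rec_nat P (\<lambda>j. pow_op a (\<beta> - real j))"
  have Q: "Q 0 = P" "Q (Suc j) = pow_op a (\<beta> - real j) (Q j)" for j by (simp_all add: Q_def)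
  define h where "h = (\<lambda>j. pow_poly a e (\<beta> - real j) (Q j))"
  have d: "(h j has_real_derivative h (Suc j) s) (at s)" if "s \<in> {0<..}" for j s
    unfolding h_def using DERIV_pow_poly[OF _ assms, of s a "\<beta> - real j" "Q j"] that by (simp add: Q algebra_simps)
  have "Ck_on k (- {0 :: real^'n}) (\<lambda>x. h 0 (x \<bullet> x))"
  proof (rule Ck_on_compose[OF _ Ck_on_inner_self, where U="{0<..}"])
    show "continuous_on {0<..} (h j)" for j
      by (intro continuous_at_imp_continuous_on ballI DERIV_isCont[OF d])
  qed (use d in \<open>auto simp: open_Compl\<close>)
  then show ?thesis by (simp add: h_def Q)
qed

lemma pow_op_add_const: "pow_op a (c + d) P = pow_op a c P + smult d P"
  by (simp add: pow_op_def smult_add_left)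

text \<open>The factorization 4 s^(-1) (\<theta> + n/2 - 1) \<theta> once more, now with \<theta>
  represented by \<open>pow_op\<close>.\<close>

lemma laplacian_pow_poly:
  fixes x :: "real^'n::finite"
  assumes "x \<noteq> 0" "e > 0"
  shows "laplacian (\<lambda>x::real^'n. pow_poly a e \<beta> P (x \<bullet> x)) x =
    4 * pow_poly a e (\<beta> - 1) (pow_op a (\<beta> - 1 + real CARD('n) / 2) (pow_op a \<beta> P)) (x \<bullet> x)"
proof -
  let ?n = "real CARD('n)"
  have "laplacian (\<lambda>x::real^'n. pow_poly a e \<beta> P (x \<bullet> x)) x = 
     4 * (x \<bullet> x) * pow_poly a e (\<beta> - 1 - 1) (pow_op a (\<beta> - 1) (pow_op a \<beta> P)) (x \<bullet> x) 
     + 2 * ?n * pow_poly a e (\<beta> - 1) (pow_op a \<beta> P) (x \<bullet> x)"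
  proof (rule laplacian_radial[of "- {0}"])
    show "(pow_poly a e (\<beta> - 1) (pow_op a \<beta> P) has_real_derivative
       pow_poly a e (\<beta> - 1 - 1) (pow_op a (\<beta> - 1) (pow_op a \<beta> P)) (x \<bullet> x)) (at (x \<bullet> x))"
      by (rule DERIV_pow_poly) (use assms in auto)
  qed (use assms in \<open>auto intro!: DERIV_pow_poly simp: open_Compl\<close>)
  moreover have "(x \<bullet> x) * pow_poly a e (\<beta> - 1 - 1) R (x \<bullet> x) = pow_poly a e (\<beta> - 1) R (x \<bullet> x)" for R
    using assms(1) by (simp add: pow_poly_def powr_diff power2_eq_square)
  moreover have "pow_poly a e (\<beta> - 1) (pow_op a (\<beta> - 1 + ?n / 2) R) s = pow_poly a e (\<beta> - 1) (pow_op a (\<beta> - 1) R) s + ?n / 2 * pow_poly a e (\<beta> - 1) R s" for R s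
    unfolding pow_op_add_const by (simp add: pow_poly_def algebra_simps)
  ultimately show ?thesis by (simp add: mult.assoc)
qed

text \<open>The polynomial left after j Laplacians of s^(j-1) P(y): the exponent runs down to 0 and
  the result carries s^(-1). The factor at exponent 0 annihilates constants, which reflects that
  |x|^(2j-2) is j-polyharmonic.\<close>

fun lap_iter :: "real \<Rightarrow> real \<Rightarrow> nat \<Rightarrow> real poly \<Rightarrow> real poly" where
  "lap_iter a n 0 P = P"
| "lap_iter a n (Suc j) P = lap_iter a n j (pow_op a (real j - 1 + n / 2) (pow_op a (real j) P))"

lemma poly_laplacian_pow_poly:
  fixes x :: "real^'n::finite"
  assumes "x \<noteq> 0" "e > 0"
  shows "poly_laplacian j (\<lambda>x::real^'n. pow_poly a e (real j - 1) P (x \<bullet> x)) x =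
    4 ^ j * pow_poly a e (- 1) (lap_iter a (real CARD('n)) j P) (x \<bullet> x)"
proof (induction j arbitrary: P)
  case (Suc j)
  let ?Q = "pow_op a (real j - 1 + real CARD('n) / 2) (pow_op a (real j) P)"
  have o: "open (- {0 :: real^'n})" by (simp add: open_Compl)
  have "poly_laplacian (Suc j) (\<lambda>x::real^'n. pow_poly a e (real (Suc j) - 1) P (x \<bullet> x)) x
    = poly_laplacian j (\<lambda>x. 4 * pow_poly a e (real j - 1) ?Q (x \<bullet> x)) x"
    unfolding poly_laplacian_Suc'
    by (rule poly_laplacian_cong[OF o]) (use assms laplacian_pow_poly[where \<beta>="real j"] in auto)
  also have "\<dots> = 4 * poly_laplacian j (\<lambda>x. pow_poly a e (real j - 1) ?Q (x \<bullet> x)) x"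
    by (rule poly_laplacian_cmult[OF o Ck_on_pow_poly[OF assms(2)]]) (use assms in auto)
  finally show ?case using Suc.IH by simp
qed (simp add: poly_laplacian_0)

lemma pow_op_commute: "pow_op a c (pow_op a d P) = pow_op a d (pow_op a c P)"
  by (simp add: pow_op_def pderiv_smult pderiv_diff pderiv_pCons smult_diff_right smult_add_right mult.commute)

text \<open>The same operators with the factor of \<open>\<beta> = 0\<close> applied first: it produces a nonnegative
  polynomial, and the remaining factors preserve nonnegativity.\<close>

fun lap_tail :: "real \<Rightarrow> real \<Rightarrow> nat \<Rightarrow> real poly \<Rightarrow> real poly" where
  "lap_tail a n 0 P = pow_op a (n / 2 - 1) P"
| "lap_tail a n (Suc j) P = lap_tail a n j (pow_op a (real (Suc j) - 1 + n / 2) (pow_op a (real (Suc j)) P))"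

text \<open>All factors are polynomials in the same Euler operator and commute, so the one at
  exponent 0 can be moved to the front.\<close>

lemma lap_iter_Suc: "lap_iter a n (Suc j) P = lap_tail a n j (pow_op a 0 P)"
proof (induction j arbitrary: P)
  case (Suc j)
  have "lap_iter a n (Suc (Suc j)) P = lap_iter a n (Suc j) (pow_op a (real (Suc j) - 1 + n / 2) (pow_op a (real (Suc j)) P))"
    by simp
  also have "\<dots> = lap_tail a n j (pow_op a 0 (pow_op a (real (Suc j) - 1 + n / 2) (pow_op a (real (Suc j)) P)))"
    by (rule Suc.IH)
  also have "\<dots> = lap_tail a n (Suc j) (pow_op a 0 P)"
    by (simp add: pow_op_commute[of a 0])
  finally show ?case .
qed (simp add: algebra_simps)

section \<open>Positivity in the Bernstein basis (without binomial factors)\<close>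

definition bern :: "nat \<Rightarrow> nat \<Rightarrow> real poly" where
  "bern N j = monom 1 j * one_minus_X ^ (N - j)"

text \<open>The index bound \<open>i\<close> is tracked because \<open>pow_op\<close> raises it by
  one and preserves nonnegativity only while c \<ge> a i.\<close>

inductive bern_cone :: "nat \<Rightarrow> nat \<Rightarrow> real poly \<Rightarrow> bool" for N i where
  "bern_cone N i 0"
| "c \<ge> 0 \<Longrightarrow> j \<le> i \<Longrightarrow> bern_cone N i Q \<Longrightarrow> bern_cone N i (smult c (bern N j) + Q)"

lemma bern_cone_add: "bern_cone N i P \<Longrightarrow> bern_cone N i Q \<Longrightarrow> bern_cone N i (P + Q)"
  by (induction rule: bern_cone.induct) (auto simp: add.assoc intro: bern_cone.intros)

lemma bern_cone_smult_bern: "c \<ge> 0 \<Longrightarrow> j \<le> i \<Longrightarrow> bern_cone N i (smult c (bern N j))"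
  using bern_cone.intros(2)[OF _ _ bern_cone.intros(1)] by fastforce

lemma poly_bern_cone_nonneg: "bern_cone N i Q \<Longrightarrow> 0 \<le> y \<Longrightarrow> y \<le> 1 \<Longrightarrow> poly Q y \<ge> 0"
  by (induction rule: bern_cone.induct) (auto simp: bern_def poly_monom poly_power)

text \<open>With y d/dy b_j = j b_j - (N-j) b_(j+1), the operator c - a y d/dy has only nonnegative
  coefficients in this basis as soon as c \<ge> a j.\<close>

lemma pow_op_bern:
  assumes "j < N"
  shows "pow_op a c (bern N j) = smult (c - a * real j) (bern N j) + smult (a * real (N - j)) (bern N (Suc j))"
proof -
  obtain k where k: "N - j = Suc k" using assms by (metis Suc_diff_Suc)
  then have k': "N - Suc j = k" by simp
  have p: "pderiv (one_minus_X ^ Suc k) = - smult (real (Suc k)) (one_minus_X ^ k)"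
    unfolding pderiv_power_Suc by (simp add: pderiv_pCons smult_minus_left[symmetric] del: smult_minus_left)
  have "pCons 0 (pderiv (bern N j)) = monom 1 j * (pCons 0 (pderiv (one_minus_X ^ Suc k)) + smult (real j) (one_minus_X ^ Suc k))"
    unfolding bern_def k X_pderiv_monom_mult euler_def ..
  also have "\<dots> = - smult (real (Suc k)) (monom 1 (Suc j) * one_minus_X ^ k) + smult (real j) (monom 1 j * one_minus_X ^ Suc k)"
    unfolding p by (simp add: monom_Suc distrib_left del: power_Suc)
  also have "\<dots> = smult (real j) (bern N j) - smult (real (N - j)) (bern N (Suc j))"
    unfolding bern_def k k' by simp
  finally have e: "pCons 0 (pderiv (bern N j)) = smult (real j) (bern N j) - smult (real (N - j)) (bern N (Suc j))" .
  show ?thesis unfolding pow_op_def e by (simp add: smult_diff_right smult_diff_left)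
qed

lemma pow_op_add: "pow_op a c (P + Q) = pow_op a c P + pow_op a c Q"
  by (simp add: pow_op_def pderiv_add smult_add_right)

lemma pow_op_smult: "pow_op a c (smult d P) = smult d (pow_op a c P)"
  by (simp add: pow_op_def pderiv_smult smult_diff_right mult.commute)

lemma pow_op_bern_cone:
  assumes "a \<ge> 0" "c \<ge> a * real i" "i < N" "bern_cone N i Q"
  shows "bern_cone N (Suc i) (pow_op a c Q)"
  using assms(4)
proof induction
  case 1
  then show ?case by (simp add: pow_op_def bern_cone.intros)
next
  case (2 d j Q)
  have "a * real j \<le> a * real i" using 2 assms(1) by (intro mult_left_mono) auto
  then have c: "c - a * real j \<ge> 0" using assms(2) by simp
  have "pow_op a c (smult d (bern N j) + Q) = smult (d * (c - a * real j)) (bern N j)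
      + (smult (d * (a * real (N - j))) (bern N (Suc j)) + pow_op a c Q)"
    using 2 assms(3) by (simp add: pow_op_add pow_op_smult pow_op_bern smult_add_right)
  moreover have "bern_cone N (Suc i) \<dots>"
    by (intro bern_cone.intros) (use 2 c assms in auto)
  ultimately show ?case by simp
qed

text \<open>Nonnegativity alone would not suffice: the coefficient of y (1-y)^(N-1) must remain
  strictly positive to yield a quantitative lower bound.\<close>

definition bern_pos :: "nat \<Rightarrow> nat \<Rightarrow> real poly \<Rightarrow> bool" where
  "bern_pos N i Q \<longleftrightarrow> (\<exists>d>0. \<exists>R. bern_cone N i R \<and> Q = smult d (bern N 1) + R)"

lemma pow_op_bern_pos:
  assumes "a \<ge> 0" "c \<ge> a * real i" "c > a" "1 \<le> i" "i < N" "bern_pos N i Q"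
  shows "bern_pos N (Suc i) (pow_op a c Q)"
proof -
  obtain d R where d: "d > 0" "bern_cone N i R" "Q = smult d (bern N 1) + R"
    using assms(6) unfolding bern_pos_def by blast
  have "pow_op a c Q = smult (d * (c - a)) (bern N 1) + (smult (d * (a * real (N - 1))) (bern N (Suc 1)) + pow_op a c R)"
    unfolding d(3) using assms(4,5) by (simp add: pow_op_add pow_op_smult pow_op_bern smult_add_right)
  moreover have "bern_cone N (Suc i) (smult (d * (a * real (N - 1))) (bern N (Suc 1)) + pow_op a c R)"
    by (intro bern_cone_add bern_cone_smult_bern pow_op_bern_cone) (use assms d in auto)
  moreover have "d * (c - a) > 0" using d(1) assms(3) by simp
  ultimately show ?thesis unfolding bern_pos_def by blast
qed

text \<open>Every remaining factor has constant at least 1: the integers \<open>Suc j\<close>, the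
  numbers \<open>real (Suc j) - 1 + n / 2\<close>, and \<open>n / 2 - 1\<close> because
  \<open>n \<ge> 4\<close>. On the other side a i \<le> a M \<le> 1, and a < 1 keeps the
  distinguished coefficient positive.\<close>

lemma lap_tail_bern_pos:
  assumes "a \<ge> 0" "a < 1" "a * real M \<le> 1" "n \<ge> 4" "M \<le> N" "1 \<le> i" "i + 2 * j + 1 \<le> M" "bern_pos N i Q"
  shows "bern_pos N (i + 2 * j + 1) (lap_tail a n j Q)"
  using assms(6-)
proof (induction j arbitrary: i Q)
  case 0
  have "a * real i \<le> a * real M" using 0 assms(1) by (intro mult_left_mono) auto
  then show ?case using pow_op_bern_pos[of a i "n / 2 - 1" N Q] 0 assms by simp
next
  case (Suc j)
  have ai: "a * real k \<le> 1" if "k \<le> M" for k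
  proof -
    have "a * real k \<le> a * real M" using that assms(1) by (intro mult_left_mono) auto
    then show ?thesis using assms(3) by simp
  qed
  have 1: "bern_pos N (Suc i) (pow_op a (real (Suc j)) Q)"
    by (rule pow_op_bern_pos) (use Suc.prems assms ai[of i] in auto)
  have "bern_pos N (Suc (Suc i)) (pow_op a (real (Suc j) - 1 + n / 2) (pow_op a (real (Suc j)) Q))"
    by (rule pow_op_bern_pos[OF _ _ _ _ _ 1]) (use Suc.prems assms(1-5) ai[of "Suc i"] in auto)
  from Suc.IH[OF _ _ this] Suc.prems show ?case by simp
qed

text \<open>The factor at exponent 0 sends \<open>bern N 0\<close> to a positive multiple of
  \<open>bern N 1\<close>, since its constant coefficient is zero. The other 2m - 1 factors preserve
  positivity; the choice a = 1/(2m) is made so that a i \<le> 1 for all indices reached.\<close>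

lemma annular_poly_laplacian_lower_bound:
  assumes "m \<ge> 1" "CARD('n::finite) \<ge> 4"
  defines "a \<equiv> 1 / real (2 * m)"
  shows "\<exists>\<delta>>0. \<forall>e>0. \<forall>x::real^'n. e \<le> x \<bullet> x \<longrightarrow>
    poly_laplacian m (\<lambda>x. pow_poly a e (real m - 1) (one_minus_X ^ (4 * m)) (x \<bullet> x)) x
    \<ge> \<delta> * (1 / (x \<bullet> x)) * ((e / (x \<bullet> x)) powr a * (1 - (e / (x \<bullet> x)) powr a) ^ (4 * m - 1))"
proof -
  define N where "N = 4 * m"
  define n where "n = real CARD('n)"
  have a: "a > 0" "a < 1" "a * real (2 * m) = 1" using assms(1) by (auto simp: a_def)
  have b0: "one_minus_X ^ N = bern N 0" by (simp add: bern_def)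
  have "pow_op a 0 (one_minus_X ^ N) = smult (a * real N) (bern N 1) + 0"
    unfolding b0 using pow_op_bern[of 0 N a 0] assms(1) by (simp add: N_def)
  moreover have "a * real N > 0" using a(1) assms(1) by (simp add: N_def)
  ultimately have "bern_pos N 1 (pow_op a 0 (one_minus_X ^ N))"
    unfolding bern_pos_def using bern_cone.intros(1) by blast
  then have "bern_pos N (1 + 2 * (m - 1) + 1) (lap_tail a n (m - 1) (pow_op a 0 (one_minus_X ^ N)))"
    by (intro lap_tail_bern_pos[where M="2 * m"]) (use a assms(1,2) in \<open>auto simp: N_def n_def\<close>)
  then obtain d R where d: "d > 0" "bern_cone N (1 + 2 * (m - 1) + 1) R"
    and e: "lap_tail a n (m - 1) (pow_op a 0 (one_minus_X ^ N)) = smult d (bern N 1) + R"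
    unfolding bern_pos_def by blast
  have li: "lap_iter a n m (one_minus_X ^ N) = smult d (bern N 1) + R"
    using lap_iter_Suc[of a n "m - 1"] e assms(1) by simp
  show ?thesis
  proof (intro exI[of _ d] conjI d allI impI)
    fix e :: real and x :: "real^'n" assume ex: "e > 0" "e \<le> x \<bullet> x"
    then have x: "x \<noteq> 0" by auto
    define y where "y = (e / (x \<bullet> x)) powr a"
    have y: "0 \<le> y" "y \<le> 1" unfolding y_def using ex a(1) using powr_mono2[of a "e / (x \<bullet> x)" 1] by (auto simp: divide_le_eq)
    have P: "poly (smult d (bern N 1) + R) y \<ge> d * (y * (1 - y) ^ (N - 1))"
      using poly_bern_cone_nonneg[OF d(2) y] by (simp add: bern_def poly_monom poly_power)
    have P0: "d * (y * (1 - y) ^ (N - 1)) \<ge> 0" using d(1) y by simp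
    have sp: "x \<bullet> x > 0" using x by simp
    have "poly_laplacian m (\<lambda>x. pow_poly a e (real m - 1) (one_minus_X ^ (4 * m)) (x \<bullet> x)) x
      = 4 ^ m * ((1 / (x \<bullet> x)) * poly (smult d (bern N 1) + R) y)"
      unfolding poly_laplacian_pow_poly[OF x ex(1)] n_def[symmetric] N_def[symmetric] li
      using sp by (simp add: pow_poly_def y_def powr_minus_divide)
    also have "\<dots> \<ge> 1 * ((1 / (x \<bullet> x)) * (d * (y * (1 - y) ^ (N - 1))))"
      using P P0 sp by (intro mult_mono) auto
    finally show "poly_laplacian m (\<lambda>x. pow_poly a e (real m - 1) (one_minus_X ^ (4 * m)) (x \<bullet> x)) x
       \<ge> d * (1 / (x \<bullet> x)) * ((e / (x \<bullet> x)) powr a * (1 - (e / (x \<bullet> x)) powr a) ^ (4 * m - 1))"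
      unfolding y_def N_def by (simp add: mult_ac)
  qed
qed

subsection \<open>Integral bounds near the singularity\<close>

text \<open>The inner truncation is 0 for |x|^2 \<le> 1 and (|x|^2 - 1)^k beyond; the outer one
  turns it into a function equal to 1 for |x|^2 \<le> 1 and, for k > 0, falling to 0 at |x|^2 =
  2.\<close>

definition cutoff :: "nat \<Rightarrow> real^'n::finite \<Rightarrow> real" where
  "cutoff k x = trunc_poly (one_minus_X ^ k) (trunc_poly (one_minus_X ^ k) (2 - x \<bullet> x))"

lemma cutoff_eq_1: "x \<bullet> x \<le> 1 \<Longrightarrow> cutoff k x = 1"
  by (simp add: cutoff_def trunc_poly_def poly_power)

lemma cutoff_eq_0: "x \<bullet> x \<ge> 2 \<Longrightarrow> cutoff k x = 0"
proof -
  assume "x \<bullet> x \<ge> 2"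
  then have "1 \<le> (x \<bullet> x - 1) ^ k" by (intro one_le_power) simp
  then show ?thesis using \<open>x \<bullet> x \<ge> 2\<close> by (simp add: cutoff_def trunc_poly_def poly_power not_less)
qed

lemma cutoff_nonneg: "cutoff k x \<ge> 0"
  by (simp add: cutoff_def trunc_poly_def poly_power)

lemma Ck_on_cutoff: "Ck_on k (UNIV :: (real^'n::finite) set) (cutoff (Suc k))"
proof -
  have "Ck_on k (UNIV :: (real^'n) set) (\<lambda>x. 2 + (-1) * (x \<bullet> x))"
    by (intro Ck_on_add Ck_on_const Ck_on_cmult Ck_on_inner_self open_UNIV)
  then have "Ck_on k (UNIV :: (real^'n) set) (\<lambda>x. 2 - x \<bullet> x)" by simp
  from Ck_on_trunc_poly[OF open_UNIV Ck_on_trunc_poly[OF open_UNIV this dvd_refl] dvd_refl]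
  show ?thesis unfolding cutoff_def[abs_def] .
qed

text \<open>|x|^(2m-2) (1 - y)^(4m) with y = (e/|x|^2)^(1/(2m)); truncation at y = 1 is the cutoff
  at the inner radius, and the high contact order makes it smooth enough.\<close>

definition annular_test :: "nat \<Rightarrow> real \<Rightarrow> real^'n::finite \<Rightarrow> real" where
  "annular_test m e x = (x \<bullet> x) powr (real m - 1) *
     trunc_poly (one_minus_X ^ (4 * m)) ((e / (x \<bullet> x)) powr (1 / real (2 * m))) * cutoff (Suc (2 * m)) x"

lemma compact_annulus: "compact {x :: 'a::euclidean_space. r \<le> x \<bullet> x \<and> x \<bullet> x \<le> R}"
proof -
  have "closed {x :: 'a. r \<le> x \<bullet> x \<and> x \<bullet> x \<le> R}"
    by (intro closed_Collect_conj closed_Collect_le continuous_intros)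
  moreover have "norm x \<le> sqrt R" if "x \<bullet> x \<le> R" for x :: 'a
    using that by (simp add: norm_eq_sqrt_inner)
  then have "bounded {x :: 'a. r \<le> x \<bullet> x \<and> x \<bullet> x \<le> R}"
    by (auto simp: bounded_iff)
  ultimately show ?thesis by (simp add: compact_eq_bounded_closed)
qed

lemma annular_test_zero:
  assumes "m \<ge> 1" "x \<bullet> x \<le> e \<or> x \<bullet> x \<ge> 2"
  shows "annular_test m e x = 0"
\<comment> \<open>The origin needs separate treatment: there \<open>e / (x \<bullet> x)\<close> is 0
  and the truncation does not vanish, but \<open>0 powr _ = 0\<close> does.\<close>
proof (cases "x \<bullet> x \<ge> 2 \<or> x = 0")
  case True
  then show ?thesis by (auto simp: annular_test_def cutoff_eq_0)
next
  case False
  then have "x \<bullet> x > 0" "x \<bullet> x \<le> e" using assms by auto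
  then have "1 \<le> (e / (x \<bullet> x)) powr (1 / real (2 * m))" by (intro ge_one_powr_ge_zero) auto
  then show ?thesis by (simp add: annular_test_def trunc_poly_def)
qed

lemma annular_test_eq:
  assumes "m \<ge> 1" "e > 0" "e < x \<bullet> x"
  shows "annular_test m e x = pow_poly (1 / real (2 * m)) e (real m - 1) (one_minus_X ^ (4 * m)) (x \<bullet> x) * cutoff (Suc (2 * m)) x"
proof -
  have "(e / (x \<bullet> x)) powr (1 / real (2 * m)) < 1 powr (1 / real (2 * m))"
    using assms by (intro powr_less_mono2) (auto simp: divide_less_eq)
  then show ?thesis by (simp add: annular_test_def trunc_poly_def pow_poly_def)
qed

lemma annular_test_nonneg: "annular_test m e x \<ge> 0"
  by (auto simp: annular_test_def trunc_poly_def poly_power intro!: mult_nonneg_nonneg cutoff_nonneg)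

text \<open>Off the origin all factors are regular; near the origin the function is identically
  zero. The two open sets cover the space.\<close>

lemma Ck_on_annular_test:
  assumes "m \<ge> 1" "e > 0"
  shows "Ck_on (2 * m) (UNIV :: (real^'n::finite) set) (annular_test m e)"
proof -
  let ?a = "1 / real (2 * m)"
  have o: "open (- {0 :: real^'n})" by (simp add: open_Compl)
  have 1: "Ck_on (2 * m) (- {0 :: real^'n}) (annular_test m e)"
  proof -
    have "Ck_on (2 * m) (- {0 :: real^'n}) (\<lambda>x. pow_poly ?a e (real m - 1) 1 (x \<bullet> x))" 
      by (rule Ck_on_pow_poly[OF assms(2)])
    moreover have "Ck_on (2 * m) (- {0 :: real^'n}) (\<lambda>x. trunc_poly (one_minus_X ^ (4 * m)) (pow_poly ?a e 0 [:0, 1:] (x \<bullet> x)))"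
      by (rule Ck_on_trunc_poly[OF o Ck_on_pow_poly[OF assms(2)]], rule le_imp_power_dvd) (use assms in auto)
    moreover have "Ck_on (2 * m) (- {0 :: real^'n}) (cutoff (Suc (2 * m)))"
      by (rule Ck_on_mono[OF Ck_on_cutoff]) auto
    ultimately have "Ck_on (2 * m) (- {0 :: real^'n}) (\<lambda>x. pow_poly ?a e (real m - 1) 1 (x \<bullet> x) *
       trunc_poly (one_minus_X ^ (4 * m)) (pow_poly ?a e 0 [:0, 1:] (x \<bullet> x)) * cutoff (Suc (2 * m)) x)"
      by (intro Ck_on_mult o)
    then show ?thesis
      by (subst Ck_on_cong[OF o]) (auto simp: annular_test_def pow_poly_def)
  qed
  have o2: "open {x :: real^'n. x \<bullet> x < e}" by (intro open_Collect_less continuous_intros)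
  have 2: "Ck_on (2 * m) {x :: real^'n. x \<bullet> x < e} (annular_test m e)"
    by (subst Ck_on_cong[OF o2, where g="\<lambda>x. 0"]) (auto simp: annular_test_zero[OF assms(1)] Ck_on_const[OF o2])
  have "- {0 :: real^'n} \<union> {x. x \<bullet> x < e} = UNIV" using assms by auto
  then show ?thesis using Ck_on_union[OF o o2 1 2] by simp
qed

lemma annular_test_lower:
  assumes "m \<ge> 1" "CARD('n::finite) \<ge> 4"
  obtains \<delta> where "\<delta> > 0" "\<And>e x :: real^'n. 0 < e \<Longrightarrow> x \<bullet> x < 1 \<Longrightarrow>
    poly_laplacian m (annular_test m e) x \<ge> (if e < x \<bullet> x then \<delta> * (1 / (x \<bullet> x)) *
      ((e / (x \<bullet> x)) powr (1 / real (2 * m)) * (1 - (e / (x \<bullet> x)) powr (1 / real (2 * m))) ^ (4 * m - 1)) else 0)"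
proof -
  obtain \<delta> where d: "\<delta> > 0" and L: "\<And>e x :: real^'n. 0 < e \<Longrightarrow> e \<le> x \<bullet> x \<Longrightarrow>
    poly_laplacian m (\<lambda>x. pow_poly (1 / real (2 * m)) e (real m - 1) (one_minus_X ^ (4 * m)) (x \<bullet> x)) x
    \<ge> \<delta> * (1 / (x \<bullet> x)) * ((e / (x \<bullet> x)) powr (1 / real (2 * m)) * (1 - (e / (x \<bullet> x)) powr (1 / real (2 * m))) ^ (4 * m - 1))"
    using annular_poly_laplacian_lower_bound[where 'n='n, OF assms] by blast
  show thesis
  proof (rule that[OF d])
    fix e :: real and x :: "real^'n" assume e: "0 < e" "x \<bullet> x < 1"
    show "poly_laplacian m (annular_test m e) x \<ge> (if e < x \<bullet> x then \<delta> * (1 / (x \<bullet> x)) *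
      ((e / (x \<bullet> x)) powr (1 / real (2 * m)) * (1 - (e / (x \<bullet> x)) powr (1 / real (2 * m))) ^ (4 * m - 1)) else 0)"
    proof (cases "e < x \<bullet> x")
      case True
      have o: "open {x :: real^'n. e < x \<bullet> x \<and> x \<bullet> x < 1}" by (intro open_Collect_conj open_Collect_less continuous_intros)
      have "poly_laplacian m (annular_test m e) x = 
        poly_laplacian m (\<lambda>x. pow_poly (1 / real (2 * m)) e (real m - 1) (one_minus_X ^ (4 * m)) (x \<bullet> x)) x"
        by (rule poly_laplacian_cong[OF o]) (use True e assms(1) in \<open>auto simp: annular_test_eq cutoff_eq_1\<close>)
      then show ?thesis using L[of e x] True e by simp
    next
      case False
      \<comment> \<open>The test function vanishes on the open ball |x|^2 < e; continuity of its
        m-fold Laplacian adds the sphere.\<close>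
      have "poly_laplacian m (annular_test m e) x = 0"
      proof (rule continuous_constant_on_closure[where S="ball 0 (sqrt e)" and f="poly_laplacian m (annular_test m e)"])
        show "continuous_on (closure (ball 0 (sqrt e))) (poly_laplacian m (annular_test m e :: real^'n \<Rightarrow> real))"
          using Ck_on_poly_laplacian[OF open_UNIV Ck_on_annular_test[OF assms(1) e(1)], of 0 m]
          by (auto simp: Ck_on_0 intro: continuous_on_subset)
        fix z :: "real^'n" assume z: "z \<in> ball 0 (sqrt e)"
        have "poly_laplacian m (annular_test m e) z = poly_laplacian m (\<lambda>_. 0) z"
        proof (rule poly_laplacian_cong[OF open_ball _ z])
          fix y :: "real^'n" assume "y \<in> ball 0 (sqrt e)"
          then have "y \<bullet> y \<le> e" by (simp add: norm_eq_sqrt_inner)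
          then show "annular_test m e y = 0" using annular_test_zero[OF assms(1), of y e] by simp
        qed
        also have "\<dots> = 0" by (rule poly_laplacian_outside_support[of "{}"]) auto
        finally show "poly_laplacian m (annular_test m e) z = 0" .
      next
        show "x \<in> closure (ball 0 (sqrt e))" using e False by (simp add: norm_eq_sqrt_inner)
      qed
      then show ?thesis using False by simp
    qed
  qed
qed

text \<open>Away from the origin the test functions form a bounded family: expanding \<open>(1 - y)\<^sup>4\<^sup>m\<close> writes them
  as combinations of finitely many fixed functions with bounded coefficients.\<close>

lemma annular_test_outer_bound:
  assumes "m \<ge> 1"
  obtains C where "C \<ge> 0" "\<And>e x :: real^'n::finite. 0 < e \<Longrightarrow> e \<le> 1 / 4 \<Longrightarrow> 1 \<le> x \<bullet> x \<Longrightarrow> x \<bullet> x \<le> 2 \<Longrightarrow>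
    \<bar>poly_laplacian m (annular_test m e) x\<bar> \<le> C"
proof -
  define a where "a = 1 / real (2 * m)"
  define p where "p = one_minus_X ^ (4 * m)"
  define \<psi> :: "nat \<Rightarrow> real^'n \<Rightarrow> real" where "\<psi> = (\<lambda>k x. pow_poly a 1 (real m - 1) (monom 1 k) (x \<bullet> x) * cutoff (Suc (2 * m)) x)"
  let ?S = "- {0 :: real^'n}"
  let ?K = "{x :: real^'n. 1 \<le> x \<bullet> x \<and> x \<bullet> x \<le> 2}"
  have oS: "open ?S" by (simp add: open_Compl)
  have psi: "Ck_on (2 * m) ?S (\<psi> k)" for k
    unfolding \<psi>_def by (intro Ck_on_mult oS Ck_on_pow_poly Ck_on_mono[OF Ck_on_cutoff]) auto
  have "\<exists>B. \<forall>x\<in>?K. \<bar>poly_laplacian m (\<psi> k) x\<bar> \<le> B" for k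
  proof -
    have "continuous_on ?S (poly_laplacian m (\<psi> k))"
      using Ck_on_poly_laplacian[OF oS psi, of 0 m] by (simp add: Ck_on_0)
    then have "continuous_on ?K (poly_laplacian m (\<psi> k))"
      by (rule continuous_on_subset) auto
    then have "bounded (poly_laplacian m (\<psi> k) ` ?K)"
      by (intro compact_imp_bounded compact_continuous_image compact_annulus)
    then obtain B where "\<And>y. y \<in> poly_laplacian m (\<psi> k) ` ?K \<Longrightarrow> norm y \<le> B"
      unfolding bounded_iff by blast
    from this[OF imageI] show ?thesis unfolding real_norm_def by blast
  qed
  then have "\<exists>B. \<forall>k. \<forall>x\<in>?K. \<bar>poly_laplacian m (\<psi> k) x\<bar> \<le> B k" by (intro choice allI)
  then obtain B where B: "\<And>k x. x \<in> ?K \<Longrightarrow> \<bar>poly_laplacian m (\<psi> k) x\<bar> \<le> B k" by blast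
  define C where "C = (\<Sum>k\<le>degree p. \<bar>coeff p k\<bar> * \<bar>B k\<bar>)"
  have "C \<ge> 0" unfolding C_def by (intro sum_nonneg) auto
  then show thesis
  proof (rule that)
    fix e :: real and x :: "real^'n" assume e: "0 < e" "e \<le> 1 / 4" and x: "1 \<le> x \<bullet> x" "x \<bullet> x \<le> 2"
    \<comment> \<open>Here |x|^2 > 1/2 > e, so the truncation is inactive. Then e enters the
      expansion only through powers of e^a, which are at most 1; this gives uniformity in e.\<close>
    let ?U = "{x :: real^'n. 1 / 2 < x \<bullet> x}"
    have oU: "open ?U" by (intro open_Collect_less continuous_intros)
    have US: "?U \<subseteq> ?S" by auto
    have psiU: "Ck_on (2 * m) ?U (\<psi> k)" for k by (rule Ck_on_mono[OF psi _ US]) simp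
    have e1: "0 \<le> e powr a" "e powr a \<le> 1" using powr_mono2[of a e 1] e by (auto simp: a_def)
    have eq: "annular_test m e z = (\<Sum>k\<le>degree p. (coeff p k * (e powr a) ^ k) * \<psi> k z)" if "z \<in> ?U" for z
    proof -
      have z: "e < z \<bullet> z" "z \<bullet> z > 0" using that e by auto
      have "(e / (z \<bullet> z)) powr a = e powr a * (1 / (z \<bullet> z)) powr a"
        using z e by (simp add: powr_divide)
      then have "annular_test m e z = (z \<bullet> z) powr (real m - 1) * (\<Sum>k\<le>degree p. coeff p k * (e powr a * (1 / (z \<bullet> z)) powr a) ^ k) * cutoff (Suc (2 * m)) z"
        unfolding annular_test_eq[OF assms e(1) z(1)] pow_poly_def a_def[symmetric] p_def[symmetric] poly_altdef by simp
      then show ?thesis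
        by (simp add: \<psi>_def pow_poly_def poly_monom sum_distrib_left sum_distrib_right power_mult_distrib mult_ac)
    qed
    have xU: "x \<in> ?U" using x by simp
    have "poly_laplacian m (annular_test m e) x = poly_laplacian m (\<lambda>z. \<Sum>k\<le>degree p. (coeff p k * (e powr a) ^ k) * \<psi> k z) x"
      by (rule poly_laplacian_cong[OF oU eq xU])
    also have "\<dots> = (\<Sum>k\<le>degree p. poly_laplacian m (\<lambda>z. (coeff p k * (e powr a) ^ k) * \<psi> k z) x)"
      by (rule poly_laplacian_sum[OF oU Ck_on_cmult[OF oU psiU] xU])
    also have "\<dots> = (\<Sum>k\<le>degree p. (coeff p k * (e powr a) ^ k) * poly_laplacian m (\<psi> k) x)"
      by (intro sum.cong refl poly_laplacian_cmult[OF oU psiU xU])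
    also have "\<bar>\<dots>\<bar> \<le> (\<Sum>k\<le>degree p. \<bar>(coeff p k * (e powr a) ^ k) * poly_laplacian m (\<psi> k) x\<bar>)"
      by (rule sum_abs)
    also have "\<dots> \<le> C" unfolding C_def
    proof (rule sum_mono)
      fix k
      have "\<bar>coeff p k * (e powr a) ^ k\<bar> \<le> \<bar>coeff p k\<bar> * 1"
        unfolding abs_mult using e1 by (intro mult_left_mono) (auto simp: power_le_one)
      moreover have "\<bar>poly_laplacian m (\<psi> k) x\<bar> \<le> \<bar>B k\<bar>" using B[of x k] x by auto
      ultimately show "\<bar>coeff p k * (e powr a) ^ k * poly_laplacian m (\<psi> k) x\<bar> \<le> \<bar>coeff p k\<bar> * \<bar>B k\<bar>"
        unfolding abs_mult[of "coeff p k * (e powr a) ^ k"] by (intro mult_mono) auto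
    qed
    finally show "\<bar>poly_laplacian m (annular_test m e) x\<bar> \<le> C" .
  qed
qed

text \<open>Integration by parts gives \<integral> u \<Delta>^m \<phi> + \<integral> f \<phi> = 0.
  Inside the unit ball both integrands are nonnegative, and the outer shell contributes at least -B
  times a fixed integral of u. So each of the two integrals over a part of the unit ball is bounded
  independently of e; the first bounds u from the lower bound on \<Delta>^m \<phi>, the second
  bounds f from that on \<phi>.\<close>

lemma mass_bounds:
  fixes u :: "real^'n::finite \<Rightarrow> real"
  assumes m: "m \<ge> 1" "CARD('n) \<ge> 4"
    and u: "Ck_on (2 * m) (ball 0 2 - {0}) u"
    and u0: "\<And>x. x \<in> ball 0 2 - {0} \<Longrightarrow> 0 \<le> u x"
    and f0: "\<And>x. x \<in> ball 0 2 - {0} \<Longrightarrow> 0 \<le> - poly_laplacian m u x"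
  obtains C where "C > 0"
    "\<And>r. 0 < r \<Longrightarrow> r \<le> 1 \<Longrightarrow> (LINT x:{x. r \<le> norm x \<and> norm x \<le> 1}|lborel. norm x ^ (2 * m - 2) * \<bar>poly_laplacian m u x\<bar>) \<le> C"
    "\<And>\<rho>. 0 < \<rho> \<Longrightarrow> \<rho> \<le> 1 / 2 \<Longrightarrow> (LINT x:{x. \<rho> / 2 \<le> norm x \<and> norm x \<le> 3 * \<rho> / 2}|lborel. \<bar>u x\<bar>) \<le> C * \<rho>\<^sup>2"
proof -
  define \<Omega> where "\<Omega> = ball (0::real^'n) 2 - {0}"
  define f where "f = (\<lambda>x. - poly_laplacian m u x)"
  let ?a = "1 / real (2 * m)"
  have Om: "open \<Omega>" by (simp add: \<Omega>_def open_Diff)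
  have cu: "continuous_on \<Omega> u" using Ck_on_continuous[OF u] by (simp add: \<Omega>_def)
  have cf: "continuous_on \<Omega> f"
    using Ck_on_poly_laplacian[OF Om u[folded \<Omega>_def], of 0 m] by (auto simp: Ck_on_0 f_def intro: continuous_on_minus)
  have u0: "0 \<le> u x" and f0: "0 \<le> f x" if "x \<in> \<Omega>" for x using u0 f0 that by (auto simp: \<Omega>_def f_def)
  have inOm: "x \<in> \<Omega>" if "x \<noteq> 0" "x \<bullet> x \<le> 2" for x :: "real^'n"
  proof -
    have "(norm x)\<^sup>2 < 2\<^sup>2" using that by (simp add: power2_norm_eq_inner)
    then have "norm x < 2" by (rule power2_less_imp_less) simp
    then show ?thesis using that by (auto simp: \<Omega>_def)
  qed
  obtain \<delta> where d: "\<delta> > 0" and L: "\<And>e x :: real^'n. 0 < e \<Longrightarrow> x \<bullet> x < 1 \<Longrightarrow>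
    poly_laplacian m (annular_test m e) x \<ge> (if e < x \<bullet> x then \<delta> * (1 / (x \<bullet> x)) *
      ((e / (x \<bullet> x)) powr ?a * (1 - (e / (x \<bullet> x)) powr ?a) ^ (4 * m - 1)) else 0)"
    using annular_test_lower[where 'n='n, OF m] by blast
  obtain B where B: "B \<ge> 0" "\<And>e x :: real^'n. 0 < e \<Longrightarrow> e \<le> 1 / 4 \<Longrightarrow> 1 \<le> x \<bullet> x \<Longrightarrow> x \<bullet> x \<le> 2 \<Longrightarrow>
    \<bar>poly_laplacian m (annular_test m e) x\<bar> \<le> B"
    using annular_test_outer_bound[where 'n='n, OF m(1)] by blast
  let ?O = "{x :: real^'n. 1 \<le> x \<bullet> x \<and> x \<bullet> x \<le> 2}"
  have O: "?O \<subseteq> \<Omega>" by (auto intro!: inOm)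
  define D where "D = B * (LINT x:?O|lborel. u x)"
  have iu: "integrable lborel (\<lambda>x. indicator ?O x *\<^sub>R u x)"
    by (rule borel_integrable_compact[OF compact_annulus continuous_on_subset[OF cu O]])
  have D0: "D \<ge> 0" unfolding D_def set_lebesgue_integral_def
    using B(1) u0 O by (intro mult_nonneg_nonneg integral_nonneg_AE) (auto simp: indicator_def)
  \<comment> \<open>On the unit sphere itself only the f-term is kept, because the lower bound on
    \<Delta>^m \<phi> covers |x| < 1 and the sphere already belongs to the shell estimated by
    B.\<close>
  have key: "(LINT x:K|lborel. h x) \<le> D"
    if e: "0 < e" "e \<le> 1 / 4" and K: "compact K" "K \<subseteq> {x. e \<le> x \<bullet> x \<and> x \<bullet> x \<le> 1}" "continuous_on K h"
      and h: "\<And>x. x \<in> K \<Longrightarrow> x \<bullet> x < 1 \<Longrightarrow> h x \<le> u x * poly_laplacian m (annular_test m e) x + f x * annular_test m e x"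
      and h1: "\<And>x. x \<in> K \<Longrightarrow> x \<bullet> x = 1 \<Longrightarrow> h x \<le> f x * annular_test m e x" for e K h
  proof -
    let ?\<phi> = "annular_test m e :: real^'n \<Rightarrow> real"
    let ?S = "{x :: real^'n. e \<le> x \<bullet> x \<and> x \<bullet> x \<le> 2}"
    have S: "compact ?S" "?S \<subseteq> \<Omega>" using compact_annulus e by (auto intro!: inOm)
    have p0: "?\<phi> x = 0" if "x \<notin> ?S" for x using annular_test_zero[OF m(1), of x e] that by auto
    have Lp0: "poly_laplacian m ?\<phi> x = 0" if "x \<notin> ?S" for x
      by (rule poly_laplacian_outside_support[OF compact_imp_closed[OF S(1)] p0 that])
    have p: "Ck_on (2 * m) UNIV ?\<phi>" by (rule Ck_on_annular_test[OF m(1) e(1)])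
    have cp: "continuous_on UNIV ?\<phi>" by (rule Ck_on_continuous[OF p])
    have cL: "continuous_on UNIV (poly_laplacian m ?\<phi>)"
      using Ck_on_poly_laplacian[OF open_UNIV p, of 0 m] by (simp add: Ck_on_0)
    have i1: "integrable lborel (\<lambda>x. u x * poly_laplacian m ?\<phi> x)"
      by (rule integrable_compact_support[OF continuous_on_mult S(1)])
         (use S cu cL Lp0 in \<open>auto intro: continuous_on_subset\<close>)
    have i2: "integrable lborel (\<lambda>x. f x * ?\<phi> x)"
      by (rule integrable_compact_support[OF continuous_on_mult S(1)])
         (use S cf cp p0 in \<open>auto intro: continuous_on_subset\<close>)
    have ih: "integrable lborel (\<lambda>x. indicator K x *\<^sub>R h x)"
      by (rule borel_integrable_compact[OF K(1,3)])
    have "(\<integral>x. u x * poly_laplacian m ?\<phi> x \<partial>lborel) = (\<integral>x. poly_laplacian m u x * ?\<phi> x \<partial>lborel)"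
      by (rule ibp_poly_laplacian[OF Om S u[folded \<Omega>_def] p p0])
    also have "\<dots> = - (\<integral>x. f x * ?\<phi> x \<partial>lborel)" by (simp add: f_def)
    finally have z: "(\<integral>x. u x * poly_laplacian m ?\<phi> x + f x * ?\<phi> x \<partial>lborel) = 0"
      using i1 i2 by simp
    have "(\<integral>x. indicator K x *\<^sub>R h x - B * (indicator ?O x *\<^sub>R u x) \<partial>lborel)
       \<le> (\<integral>x. u x * poly_laplacian m ?\<phi> x + f x * ?\<phi> x \<partial>lborel)"
    proof (rule integral_mono)
      show "integrable lborel (\<lambda>x. indicator K x *\<^sub>R h x - B * (indicator ?O x *\<^sub>R u x))"
        by (intro Bochner_Integration.integrable_diff ih integrable_mult_right iu)
      show "integrable lborel (\<lambda>x. u x * poly_laplacian m ?\<phi> x + f x * ?\<phi> x)"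
        by (intro Bochner_Integration.integrable_add i1 i2)
      fix x :: "real^'n"
      consider "x \<notin> ?S" | "x \<in> ?S" "x \<bullet> x < 1" | "x \<in> ?S" "1 \<le> x \<bullet> x" by fastforce
      then show "indicator K x *\<^sub>R h x - B * (indicator ?O x *\<^sub>R u x) \<le> u x * poly_laplacian m ?\<phi> x + f x * ?\<phi> x"
      proof cases
        case 1
        then have "x \<notin> K" using K(2) by auto
        moreover have "0 \<le> B * (indicator ?O x *\<^sub>R u x)" using B(1) u0 O by (auto simp: indicator_def)
        ultimately show ?thesis using p0[OF 1] Lp0[OF 1] by simp
      next
        case 2
        then have x: "x \<in> \<Omega>" using S(2) by auto
        have "0 \<le> (if e < x \<bullet> x then \<delta> * (1 / (x \<bullet> x)) *
          ((e / (x \<bullet> x)) powr ?a * (1 - (e / (x \<bullet> x)) powr ?a) ^ (4 * m - 1)) else 0)"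
          using d e powr_mono2[of ?a "e / (x \<bullet> x)" 1] by (auto simp: divide_le_eq)
        then have "0 \<le> poly_laplacian m ?\<phi> x" using L[OF e(1) 2(2)] by linarith
        then have "0 \<le> u x * poly_laplacian m ?\<phi> x + f x * ?\<phi> x"
          using u0[OF x] f0[OF x] annular_test_nonneg[of m e x] by simp
        moreover have "x \<notin> ?O" using 2 by auto
        ultimately show ?thesis using h[of x] 2 by (cases "x \<in> K") auto
      next
        case 3
        then have x: "x \<in> \<Omega>" "x \<in> ?O" using S(2) by auto
        have "- B \<le> poly_laplacian m ?\<phi> x" using B(2)[OF e, of x] x(2) by (auto simp: abs_le_iff)
        then have "u x * (- B) \<le> u x * poly_laplacian m ?\<phi> x" by (rule mult_left_mono) (rule u0[OF x(1)])
        moreover have "0 \<le> f x * ?\<phi> x" using f0[OF x(1)] annular_test_nonneg[of m e x] by simp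
        moreover have "indicator K x *\<^sub>R h x \<le> f x * ?\<phi> x"
        proof (cases "x \<in> K")
          case True
          then have "x \<bullet> x = 1" using K(2) 3 by fastforce
          then show ?thesis using h1[OF True] True by simp
        qed (use calculation in simp)
        ultimately show ?thesis using x(2) by (simp add: mult.commute)
      qed
    qed
    then have "(\<integral>x. indicator K x *\<^sub>R h x \<partial>lborel) - B * (\<integral>x. indicator ?O x *\<^sub>R u x \<partial>lborel) \<le> 0"
      unfolding z Bochner_Integration.integral_diff[OF ih integrable_mult_right[OF iu]]
        Bochner_Integration.integral_mult_right_zero .
    then show ?thesis by (simp add: D_def set_lebesgue_integral_def)
  qed
  \<comment> \<open>For e = (\<rho>/4)^2 the quotient e/|x|^2 lies in [1/36, 1/4] on the annulus
    from \<rho>/2 to 3\<rho>/2, and y lies in [\<open>y0\<close>, \<open>y1\<close>], away from both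
    zeros of y (1-y)^(4m-1).\<close>
  define y0 where "y0 = (1 / 36) powr ?a"
  define y1 where "y1 = (1 / 4) powr ?a"
  define c where "c = \<delta> * (4 / 9) * (y0 * (1 - y1) ^ (4 * m - 1))"
  have y1: "0 < y0" "y1 < 1" using powr_less_mono2[of ?a "1/4" 1] m(1) by (auto simp: y0_def y1_def)
  then have c: "c > 0" using d by (auto simp: c_def)
  show thesis
  proof (rule that[of "2 ^ (4 * m) * D + D / c + 1"])
    show "0 < 2 ^ (4 * m) * D + D / c + 1" using D0 c by (auto intro!: add_nonneg_pos add_nonneg_nonneg)
    fix r :: real assume r: "0 < r" "r \<le> 1"
    let ?K = "{x :: real^'n. r \<le> norm x \<and> norm x \<le> 1}"
    have Keq: "?K = {x. r\<^sup>2 \<le> x \<bullet> x \<and> x \<bullet> x \<le> 1}"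
      using r by (auto simp: power2_norm_eq_inner[symmetric] power_mono abs_square_le_1 intro: power2_le_imp_le)
    \<comment> \<open>Chosen so that (e/|x|^2)^(1/(2m)) \<le> 1/2 for |x| \<ge> r; the test function
      is then at least 2^(-4m) |x|^(2m-2) there.\<close>
    define e where "e = r\<^sup>2 / 2 ^ (2 * m)"
    have "r\<^sup>2 \<le> 1" using r by (simp add: power_le_one)
    moreover have P: "(4::real) \<le> 2 ^ (2 * m)" 
      using power_increasing[of 1 m "4::real"] m by (simp add: power_mult)
    ultimately have "r\<^sup>2 / 2 ^ (2 * m) \<le> 1 / 4" by (intro frac_le) auto
    moreover have "r\<^sup>2 / 2 ^ (2 * m) < r\<^sup>2 / 1" by (rule divide_strict_left_mono) (use r P in auto)
    ultimately have e: "0 < e" "e \<le> 1 / 4" "e \<le> r\<^sup>2" "e < r\<^sup>2" using r by (auto simp: e_def)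
    have KO: "?K \<subseteq> \<Omega>" unfolding Keq using r by (auto intro!: inOm)
    have bd: "(1 / 2) ^ (4 * m) * (norm x ^ (2 * m - 2) * f x) \<le> f x * annular_test m e x" if x: "x \<in> ?K" for x
    proof -
      have s: "e < x \<bullet> x" "x \<bullet> x \<le> 1" "x \<bullet> x > 0" using x e unfolding Keq by auto
      have "e / (x \<bullet> x) \<le> (1 / 2) ^ (2 * m)"
        using x s e unfolding Keq by (simp add: e_def field_simps)
      then have "(e / (x \<bullet> x)) powr ?a \<le> ((1 / 2) ^ (2 * m)) powr ?a"
        using e s by (intro powr_mono2) auto
      also have "((1 / 2) ^ (2 * m)) powr ?a = (1 / 2 :: real)"
        using m(1) by (simp add: powr_realpow[symmetric] powr_powr)
      finally have y: "1 / 2 \<le> 1 - (e / (x \<bullet> x)) powr ?a" by simp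
      have "annular_test m e x = (x \<bullet> x) powr (real m - 1) * (1 - (e / (x \<bullet> x)) powr ?a) ^ (4 * m)"
        using annular_test_eq[OF m(1) e(1) s(1)] s(2) by (simp add: cutoff_eq_1 pow_poly_def poly_power)
      also have "(x \<bullet> x) powr (real m - 1) = norm x ^ (2 * m - 2)"
      proof -
        have "(x \<bullet> x) powr (real m - 1) = (x \<bullet> x) ^ (m - 1)"
          using powr_realpow[OF s(3), of "m - 1"] m(1) by simp
        also have "\<dots> = norm x ^ (2 * (m - 1))" by (simp add: power2_norm_eq_inner[symmetric] power_mult)
        finally show ?thesis by (simp add: diff_mult_distrib2)
      qed
      finally have "norm x ^ (2 * m - 2) * (1 / 2) ^ (4 * m) \<le> annular_test m e x"
        using y by (auto intro!: mult_left_mono power_mono)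
      then have "f x * (norm x ^ (2 * m - 2) * (1 / 2) ^ (4 * m)) \<le> f x * annular_test m e x"
        by (rule mult_left_mono) (use f0 KO x in auto)
      then show ?thesis by (simp add: mult_ac)
    qed
    have "(LINT x:?K|lborel. (1 / 2) ^ (4 * m) * (norm x ^ (2 * m - 2) * f x)) \<le> D"
    proof (rule key[OF e(1,2)])
      show "compact ?K" unfolding Keq by (rule compact_annulus)
      show "?K \<subseteq> {x. e \<le> x \<bullet> x \<and> x \<bullet> x \<le> 1}" unfolding Keq using e(3) by auto
      show "continuous_on ?K (\<lambda>x. (1 / 2) ^ (4 * m) * (norm x ^ (2 * m - 2) * f x))"
        by (intro continuous_intros continuous_on_subset[OF cf KO])
      fix x assume x: "x \<in> ?K"
      show "(1 / 2) ^ (4 * m) * (norm x ^ (2 * m - 2) * f x) \<le> f x * annular_test m e x" by (rule bd[OF x])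
      assume x1: "x \<bullet> x < 1"
      have s: "e < x \<bullet> x" using x e unfolding Keq by auto
      have "0 \<le> (if e < x \<bullet> x then \<delta> * (1 / (x \<bullet> x)) *
          ((e / (x \<bullet> x)) powr ?a * (1 - (e / (x \<bullet> x)) powr ?a) ^ (4 * m - 1)) else 0)"
          using d e powr_mono2[of ?a "e / (x \<bullet> x)" 1] by (auto simp: divide_le_eq)
      then have "0 \<le> poly_laplacian m (annular_test m e) x" using L[OF e(1) x1] by linarith
      then have "0 \<le> u x * poly_laplacian m (annular_test m e) x" using u0 KO x by auto
      then show "(1 / 2) ^ (4 * m) * (norm x ^ (2 * m - 2) * f x) \<le> u x * poly_laplacian m (annular_test m e) x + f x * annular_test m e x"
        using bd[OF x] by linarith
    qed
    then have "(1 / 2) ^ (4 * m) * (LINT x:?K|lborel. norm x ^ (2 * m - 2) * f x) \<le> D"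
      by (simp only: set_integral_mult_right)
    then have "(LINT x:?K|lborel. norm x ^ (2 * m - 2) * f x) \<le> 2 ^ (4 * m) * D"
      by (simp add: power_divide field_simps)
    moreover have "(LINT x:?K|lborel. norm x ^ (2 * m - 2) * \<bar>poly_laplacian m u x\<bar>) = (LINT x:?K|lborel. norm x ^ (2 * m - 2) * f x)"
    proof (rule set_lebesgue_integral_cong)
      have "\<bar>poly_laplacian m u x\<bar> = f x" if "x \<in> ?K" for x using f0[of x] KO that by (auto simp: f_def)
      then show "\<forall>x. x \<in> ?K \<longrightarrow> norm x ^ (2 * m - 2) * \<bar>poly_laplacian m u x\<bar> = norm x ^ (2 * m - 2) * f x" by auto
      have "compact ?K" unfolding Keq by (rule compact_annulus)
      then show "?K \<in> sets lborel" by (simp add: compact_imp_closed)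
    qed
    moreover have "0 \<le> D / c" using D0 c by simp
    ultimately show "(LINT x:?K|lborel. norm x ^ (2 * m - 2) * \<bar>poly_laplacian m u x\<bar>) \<le> 2 ^ (4 * m) * D + D / c + 1"
      by linarith
  next
    fix \<rho> :: real assume r: "0 < \<rho>" "\<rho> \<le> 1 / 2"
    let ?K = "{x :: real^'n. \<rho> / 2 \<le> norm x \<and> norm x \<le> 3 * \<rho> / 2}"
    have Keq: "?K = {x. (\<rho> / 2)\<^sup>2 \<le> x \<bullet> x \<and> x \<bullet> x \<le> (3 * \<rho> / 2)\<^sup>2}"
      unfolding power2_norm_eq_inner[symmetric] using r by (auto intro: power_mono power2_le_imp_le)
    define e where "e = (\<rho> / 4)\<^sup>2"
    have r2: "\<rho>\<^sup>2 \<le> (1 / 2)\<^sup>2" using r by (intro power_mono) auto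
    have e: "0 < e" "e \<le> 1 / 4" "4 * e = (\<rho> / 2)\<^sup>2" "36 * e = (3 * \<rho> / 2)\<^sup>2" "36 * e < 1"
      using r r2 by (auto simp: e_def power2_eq_square)
    have xs: "4 * e \<le> x \<bullet> x" "x \<bullet> x \<le> 36 * e" "x \<bullet> x < 1" "e < x \<bullet> x" "x \<in> \<Omega>" if "x \<in> ?K" for x
      using that e unfolding Keq by (auto intro!: inOm)
    have KO: "?K \<subseteq> \<Omega>" using xs by blast
    have bd: "c / \<rho>\<^sup>2 * u x \<le> u x * poly_laplacian m (annular_test m e) x" if x: "x \<in> ?K" for x
    proof -
      note s = xs[OF x]
      define y where "y = (e / (x \<bullet> x)) powr ?a"
      have sp: "x \<bullet> x > 0" using s e by linarith
      have "y0 \<le> y" unfolding y0_def y_def using s e sp by (intro powr_mono2) (auto simp: field_simps)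
      moreover have "y \<le> y1" unfolding y1_def y_def using s e sp by (intro powr_mono2) (auto simp: field_simps)
      ultimately have "y0 * (1 - y1) ^ (4 * m - 1) \<le> y * (1 - y) ^ (4 * m - 1)"
        using y1 by (intro mult_mono power_mono) auto
      moreover have "4 / 9 / \<rho>\<^sup>2 \<le> 1 / (x \<bullet> x)"
        using s(2) sp r unfolding e(4) by (simp add: field_simps power2_eq_square)
      ultimately have "(4 / 9 / \<rho>\<^sup>2) * (y0 * (1 - y1) ^ (4 * m - 1)) \<le> 1 / (x \<bullet> x) * (y * (1 - y) ^ (4 * m - 1))"
        using y1 sp by (intro mult_mono[where c="_ * _"]) auto
      then have "\<delta> * ((4 / 9 / \<rho>\<^sup>2) * (y0 * (1 - y1) ^ (4 * m - 1))) \<le> \<delta> * (1 / (x \<bullet> x) * (y * (1 - y) ^ (4 * m - 1)))"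
        using d by (intro mult_left_mono) auto
      also have "\<dots> \<le> poly_laplacian m (annular_test m e) x"
        using L[OF e(1) s(3)] s(4) by (simp add: y_def mult.assoc)
      finally have "c / \<rho>\<^sup>2 \<le> poly_laplacian m (annular_test m e) x" by (simp add: c_def)
      then show ?thesis using u0[OF s(5)] by (metis mult.commute mult_left_mono)
    qed
    have "(LINT x:?K|lborel. c / \<rho>\<^sup>2 * u x) \<le> D"
    proof (rule key[OF e(1,2)])
      show "compact ?K" unfolding Keq by (rule compact_annulus)
      show "?K \<subseteq> {x. e \<le> x \<bullet> x \<and> x \<bullet> x \<le> 1}" using xs by (force simp: less_imp_le)
      show "continuous_on ?K (\<lambda>x. c / \<rho>\<^sup>2 * u x)"
        by (intro continuous_on_mult continuous_on_const continuous_on_subset[OF cu KO])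
      fix x assume x: "x \<in> ?K"
      show "c / \<rho>\<^sup>2 * u x \<le> f x * annular_test m e x" if "x \<bullet> x = 1" using xs(3)[OF x] that by simp
      have "0 \<le> f x * annular_test m e x" using f0 KO x annular_test_nonneg[of m e x] by auto
      then show "c / \<rho>\<^sup>2 * u x \<le> u x * poly_laplacian m (annular_test m e) x + f x * annular_test m e x"
        using bd[OF x] by linarith
    qed
    then have "c / \<rho>\<^sup>2 * (LINT x:?K|lborel. u x) \<le> D" by (simp only: set_integral_mult_right)
    then have "(LINT x:?K|lborel. u x) \<le> D / c * \<rho>\<^sup>2" using r c by (simp add: field_simps)
    also have "\<dots> \<le> (2 ^ (4 * m) * D + D / c + 1) * \<rho>\<^sup>2"
      using D0 by (intro mult_right_mono) auto
    finally have "(LINT x:?K|lborel. u x) \<le> (2 ^ (4 * m) * D + D / c + 1) * \<rho>\<^sup>2" .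
    moreover have "(LINT x:?K|lborel. \<bar>u x\<bar>) = (LINT x:?K|lborel. u x)"
    proof (rule set_lebesgue_integral_cong)
      show "\<forall>x. x \<in> ?K \<longrightarrow> \<bar>u x\<bar> = u x" using u0 KO by auto
      have "compact ?K" unfolding Keq by (rule compact_annulus)
      then show "?K \<in> sets lborel" by (simp add: compact_imp_closed)
    qed
    ultimately show "(LINT x:?K|lborel. \<bar>u x\<bar>) \<le> (2 ^ (4 * m) * D + D / c + 1) * \<rho>\<^sup>2" by simp
  qed
qed

section \<open>From integral bounds to derivative bounds\<close>

lemma Dnorm_le:
  fixes u :: "real^'n::finite \<Rightarrow> real"
  assumes "\<And>is. length is = k \<Longrightarrow> \<bar>Dlist is u x\<bar> \<le> B"
  shows "Dnorm k u x \<le> real (CARD('n) ^ k) * B"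
proof -
  have "Dnorm k u x = L2_set (\<lambda>is. Dlist is u x) {is. length is = k}"
    by (simp add: Dnorm_def L2_set_def)
  also have "\<dots> \<le> (\<Sum>is\<in>{is. length is = k}. \<bar>Dlist is u x\<bar>)" by (rule L2_set_le_sum_abs)
  also have "\<dots> \<le> real (card {is :: 'n list. length is = k}) * B"
    by (rule sum_bounded_above) (use assms in auto)
  also have "card {is :: 'n list. length is = k} = CARD('n) ^ k"
    using card_lists_length_eq[of "UNIV :: 'n set" k] by simp
  finally show ?thesis .
qed

text \<open>The masses I(r) of r \<le> |x| \<le> 1 increase to a finite supremum as r decreases. The
  annulus from \<rho>/2 to 3\<rho>/2 is disjoint from |x| \<ge> 2\<rho>, so its mass is at most
  I(\<rho>/2) - I(2\<rho>), a difference of two values near the supremum.\<close>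

lemma small_annulus_mass_tendsto_0:
  fixes h :: "real^'n::finite \<Rightarrow> real"
  assumes h0: "\<And>x. 0 \<le> h x" and c: "continuous_on (cball 0 1 - {0}) h"
    and B: "\<And>r. 0 < r \<Longrightarrow> r \<le> 1 \<Longrightarrow> (LINT x:{x. r \<le> norm x \<and> norm x \<le> 1}|lborel. h x) \<le> C"
  defines "\<epsilon> \<equiv> \<lambda>\<rho>. LINT x:{x. \<rho> / 2 \<le> norm x \<and> norm x \<le> 3 * \<rho> / 2}|lborel. h x"
  shows "(\<epsilon> \<longlongrightarrow> 0) (at_right 0)" "\<And>\<rho>. 0 < \<rho> \<Longrightarrow> \<rho> \<le> 1 / 2 \<Longrightarrow> 0 \<le> \<epsilon> \<rho> \<and> \<epsilon> \<rho> \<le> C"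
proof -
  let ?A = "\<lambda>r s. {x :: real^'n. r \<le> norm x \<and> norm x \<le> s}"
  define I where "I = (\<lambda>r. LINT x:?A r 1|lborel. h x)"
  have int: "integrable lborel (\<lambda>x. indicator (?A r s) x *\<^sub>R h x)" if "0 < r" "s \<le> 1" for r s
  proof (rule borel_integrable_compact)
    have "?A r s = cball 0 s - ball 0 r" by (auto simp: not_less)
    then show "compact (?A r s)" by (simp add: compact_diff)
    show "continuous_on (?A r s) h" by (rule continuous_on_subset[OF c]) (use that in auto)
  qed
  have e0: "0 \<le> \<epsilon> \<rho>" for \<rho> unfolding \<epsilon>_def set_lebesgue_integral_def
    by (rule integral_nonneg_AE) (use h0 in \<open>auto simp: indicator_def\<close>)
  have eI: "\<epsilon> \<rho> + I (2 * \<rho>) \<le> I (\<rho> / 2)" if "0 < \<rho>" "\<rho> \<le> 1 / 2" for \<rho>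
  proof -
    have i: "integrable lborel (\<lambda>x. indicator (?A (\<rho> / 2) (3 * \<rho> / 2)) x *\<^sub>R h x)"
      "integrable lborel (\<lambda>x. indicator (?A (2 * \<rho>) 1) x *\<^sub>R h x)"
      "integrable lborel (\<lambda>x. indicator (?A (\<rho> / 2) 1) x *\<^sub>R h x)"
      by (rule int; use that in simp)+
    have "\<epsilon> \<rho> + I (2 * \<rho>) = (\<integral>x. indicator (?A (\<rho> / 2) (3 * \<rho> / 2)) x *\<^sub>R h x + indicator (?A (2 * \<rho>) 1) x *\<^sub>R h x \<partial>lborel)"
      unfolding \<epsilon>_def I_def set_lebesgue_integral_def
      by (rule Bochner_Integration.integral_add[symmetric, OF i(1,2)])
    also have "\<dots> \<le> (\<integral>x. indicator (?A (\<rho> / 2) 1) x *\<^sub>R h x \<partial>lborel)"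
    proof (rule integral_mono)
      show "integrable lborel (\<lambda>x. indicator (?A (\<rho> / 2) (3 * \<rho> / 2)) x *\<^sub>R h x + indicator (?A (2 * \<rho>) 1) x *\<^sub>R h x)"
        by (rule Bochner_Integration.integrable_add[OF i(1,2)])
      show "integrable lborel (\<lambda>x. indicator (?A (\<rho> / 2) 1) x *\<^sub>R h x)" by (rule i(3))
      show "indicator (?A (\<rho> / 2) (3 * \<rho> / 2)) x *\<^sub>R h x + indicator (?A (2 * \<rho>) 1) x *\<^sub>R h x \<le> indicator (?A (\<rho> / 2) 1) x *\<^sub>R h x" for x
        using that h0[of x] by (auto simp: indicator_def)
    qed
    finally show ?thesis by (simp add: I_def set_lebesgue_integral_def)
  qed
  have I0: "0 \<le> I r" for r unfolding I_def set_lebesgue_integral_def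
    by (rule integral_nonneg_AE) (use h0 in \<open>auto simp: indicator_def\<close>)
  have mono: "I s \<le> I r" if "0 < r" "r \<le> s" for r s
    unfolding I_def set_lebesgue_integral_def
  proof (rule integral_mono)
    show "integrable lborel (\<lambda>x. indicator (?A s 1) x *\<^sub>R h x)" "integrable lborel (\<lambda>x. indicator (?A r 1) x *\<^sub>R h x)"
      by (rule int; use that in simp)+
    show "indicator (?A s 1) x *\<^sub>R h x \<le> indicator (?A r 1) x *\<^sub>R h x" for x
      using that h0[of x] by (simp add: indicator_def)
  qed
  show "0 \<le> \<epsilon> \<rho> \<and> \<epsilon> \<rho> \<le> C" if "0 < \<rho>" "\<rho> \<le> 1 / 2" for \<rho>
    using e0[of \<rho>] eI[OF that] I0[of "2 * \<rho>"] B[of "\<rho> / 2"] that unfolding I_def by linarith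
  define S where "S = (SUP r\<in>{0<..1}. I r)"
  have bdd: "bdd_above (I ` {0<..1})"
    by (rule bdd_aboveI2[of _ _ C]) (use B in \<open>auto simp: I_def\<close>)
  show "(\<epsilon> \<longlongrightarrow> 0) (at_right 0)"
  proof (rule tendstoI)
    fix e :: real assume "e > 0"
    then have "S - e < (SUP r\<in>{0<..1}. I r)" by (simp add: S_def)
    moreover have "{0<..1::real} \<noteq> {}" by simp
    ultimately obtain r where r: "0 < r" "r \<le> 1" "S - e < I r"
      using less_cSUP_iff[OF _ bdd] by auto
    have "\<epsilon> \<rho> < e" if "0 < \<rho>" "\<rho> < r / 2" for \<rho>
    proof -
      have "I (\<rho> / 2) \<le> S" unfolding S_def by (rule cSUP_upper[OF _ bdd]) (use that r in auto)
      moreover have "I r \<le> I (2 * \<rho>)" by (rule mono) (use that in auto)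
      ultimately show ?thesis using eI[of \<rho>] that r by linarith
    qed
    then show "\<forall>\<^sub>F \<rho> in at_right 0. dist (\<epsilon> \<rho>) 0 < e"
      unfolding eventually_at_right_field using r(1) e0 by (intro exI[of _ "r / 2"]) auto
  qed
qed

text \<open>The local estimate at y with R = |x|/4. The ball stays in the annulus from |x|/2 to
  3|x|/2, where the integral of u is O(|x|^2); there removing the weight |z|^(2m-2) from the mass
  \<epsilon>(|x|) costs a factor of order |x|^(2-2m). A pointwise bound F near y gives the masses of
  the small balls.\<close>

lemma derivative_bound:
  fixes u :: "real^'n::finite \<Rightarrow> real"
  assumes m: "m \<ge> 1" "CARD('n) \<ge> 4" "2 * m < CARD('n)"
    and u: "Ck_on (2 * m) (ball 0 2 - {0}) u"
    and u0: "\<And>x. x \<in> ball 0 2 - {0} \<Longrightarrow> 0 \<le> u x"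
    and f0: "\<And>x. x \<in> ball 0 2 - {0} \<Longrightarrow> 0 \<le> - poly_laplacian m u x"
  defines "n \<equiv> real CARD('n)"
  obtains C \<epsilon> where "C > 0" "(\<epsilon> \<longlongrightarrow> 0) (at_right 0)" "\<And>\<rho>. 0 < \<rho> \<Longrightarrow> \<rho> \<le> 1 / 2 \<Longrightarrow> 0 \<le> \<epsilon> \<rho> \<and> \<epsilon> \<rho> \<le> C"
    "\<And>x y \<tau> F k. x \<noteq> 0 \<Longrightarrow> norm x \<le> 1 / 2 \<Longrightarrow> dist x y \<le> norm x / 4 \<Longrightarrow> k < 2 * m \<Longrightarrow>
      0 < \<tau> \<Longrightarrow> \<tau> \<le> norm x / 8 \<Longrightarrow> (\<And>z. dist y z \<le> \<tau> \<Longrightarrow> \<bar>poly_laplacian m u z\<bar> \<le> F) \<Longrightarrow>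
      Dnorm k u y \<le> C * (norm x powr (- (n - 2 + real k)) + F * \<tau> powr (2 * real m - real k)
         + \<epsilon> (norm x) * norm x powr (- (2 * real m - 2)) * \<tau> powr (- (n - 2 * real m + real k)))"
proof -
  define \<Omega> where "\<Omega> = ball (0::real^'n) 2 - {0}"
  have Om: "open \<Omega>" by (simp add: \<Omega>_def open_Diff)
  define L where "L = (\<lambda>x. \<bar>poly_laplacian m u x\<bar>)"
  have cL: "continuous_on \<Omega> L" unfolding L_def
    using Ck_on_poly_laplacian[OF Om u[folded \<Omega>_def], of 0 m] by (auto simp: Ck_on_0 intro: continuous_on_rabs)
  have cu: "continuous_on \<Omega> u" using Ck_on_continuous[OF u] by (simp add: \<Omega>_def)
  obtain C1 where C1: "C1 > 0" and est: "\<And>\<Omega> (u :: real^'n \<Rightarrow> real) x R A E \<tau> is. open \<Omega> \<Longrightarrow> Ck_on (2 * m) \<Omega> u \<Longrightarrow> cball x R \<subseteq> \<Omega> \<Longrightarrow>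
     length is < 2 * m \<Longrightarrow> 0 < \<tau> \<Longrightarrow> 2 * \<tau> \<le> R \<Longrightarrow>
     (\<And>t. 0 < t \<Longrightarrow> t \<le> \<tau> \<Longrightarrow> (LINT y:cball x t|lborel. \<bar>poly_laplacian m u y\<bar>) \<le> A * t ^ CARD('n)) \<Longrightarrow>
     (LINT y:cball x (R / 2)|lborel. \<bar>poly_laplacian m u y\<bar>) \<le> E \<Longrightarrow>
     \<bar>Dlist is u x\<bar> \<le> C1 * ((LINT y:cball x R|lborel. \<bar>u y\<bar>) / R ^ (CARD('n) + length is)
         + A * \<tau> ^ (2 * m - length is) + E / \<tau> ^ (CARD('n) + length is - 2 * m))"
    using local_estimate[where 'n='n, OF m(1,3)] by blast
  obtain C2 where C2: "C2 > 0"
    and mf: "\<And>r. 0 < r \<Longrightarrow> r \<le> 1 \<Longrightarrow> (LINT x:{x. r \<le> norm x \<and> norm x \<le> 1}|lborel. norm x ^ (2 * m - 2) * \<bar>poly_laplacian m u x\<bar>) \<le> C2"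
    and mu: "\<And>\<rho>. 0 < \<rho> \<Longrightarrow> \<rho> \<le> 1 / 2 \<Longrightarrow> (LINT x:{x. \<rho> / 2 \<le> norm x \<and> norm x \<le> 3 * \<rho> / 2}|lborel. \<bar>u x\<bar>) \<le> C2 * \<rho>\<^sup>2"
    using mass_bounds[OF m(1,2) u u0 f0] by blast
  let ?A = "\<lambda>\<rho>. {x :: real^'n. \<rho> / 2 \<le> norm x \<and> norm x \<le> 3 * \<rho> / 2}"
  define h where "h = (\<lambda>x :: real^'n. norm x ^ (2 * m - 2) * L x)"
  define \<epsilon> where "\<epsilon> = (\<lambda>\<rho>. LINT x:?A \<rho>|lborel. h x)"
  have ch: "continuous_on \<Omega> h" unfolding h_def by (intro continuous_on_mult continuous_intros cL)
  have h: "(\<epsilon> \<longlongrightarrow> 0) (at_right 0)" "\<And>\<rho>. 0 < \<rho> \<Longrightarrow> \<rho> \<le> 1 / 2 \<Longrightarrow> 0 \<le> \<epsilon> \<rho> \<and> \<epsilon> \<rho> \<le> C2"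
  proof -
    have c: "continuous_on (cball 0 1 - {0}) h" by (rule continuous_on_subset[OF ch]) (auto simp: \<Omega>_def)
    have h0: "0 \<le> h x" for x by (simp add: h_def L_def)
    have mf': "(LINT x:{x. r \<le> norm x \<and> norm x \<le> 1}|lborel. h x) \<le> C2" if "0 < r" "r \<le> 1" for r
      using mf[OF that] by (simp add: h_def L_def)
    show "(\<epsilon> \<longlongrightarrow> 0) (at_right 0)" "\<And>\<rho>. 0 < \<rho> \<Longrightarrow> \<rho> \<le> 1 / 2 \<Longrightarrow> 0 \<le> \<epsilon> \<rho> \<and> \<epsilon> \<rho> \<le> C2"
      unfolding \<epsilon>_def
      using small_annulus_mass_tendsto_0[OF h0 c mf'] by blast+
  qed
  define V where "V = measure lborel (ball (0::real^'n) 1)"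
  have V0: "V \<ge> 0" by (simp add: V_def)
  \<comment> \<open>A common majorant of the coefficients of the three terms; \<open>C\<close>
    moreover dominates \<open>C2\<close>, so that it also bounds \<epsilon>.\<close>
  define W where "W = C2 * 4 ^ (CARD('n) + 2 * m) + V + 2 ^ (2 * m)"
  define C where "C = real (CARD('n) ^ (2 * m)) * (C1 * W) + C2"
  have W: "W > 0" unfolding W_def using C2 V0 by (intro add_nonneg_pos add_nonneg_nonneg) auto
  have CW: "C \<ge> C2" "C \<ge> real (CARD('n) ^ (2 * m)) * (C1 * W)" using C1 C2 W by (auto simp: C_def)
  show thesis
  proof (rule that[of C \<epsilon>])
    show "C > 0" using CW C2 by linarith
    show "(\<epsilon> \<longlongrightarrow> 0) (at_right 0)" by (rule h)
    show "0 \<le> \<epsilon> \<rho> \<and> \<epsilon> \<rho> \<le> C" if "0 < \<rho>" "\<rho> \<le> 1 / 2" for \<rho> using h(2)[OF that] CW by linarith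
    fix x y :: "real^'n" and \<tau> F k
    assume x: "x \<noteq> 0" "norm x \<le> 1 / 2" and y: "dist x y \<le> norm x / 4" and k: "k < 2 * m"
      and tau: "0 < \<tau>" "\<tau> \<le> norm x / 8" and F: "\<And>z. dist y z \<le> \<tau> \<Longrightarrow> \<bar>poly_laplacian m u z\<bar> \<le> F"
    define \<rho> where "\<rho> = norm x"
    have r: "0 < \<rho>" "\<rho> \<le> 1 / 2" using x by (auto simp: \<rho>_def)
    have F0: "F \<ge> 0" using F[of y] tau by simp
    have sub: "cball y (\<rho> / 4) \<subseteq> ?A \<rho>"
    proof
      fix z assume "z \<in> cball y (\<rho> / 4)"
      then have "dist x z \<le> \<rho> / 2" using y dist_triangle[of x z y] by (simp add: \<rho>_def)
      then have "\<bar>norm x - norm z\<bar> \<le> \<rho> / 2" using norm_triangle_ineq3[of x z] by (simp add: dist_norm)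
      then have "norm x / 2 \<le> norm z" "norm z \<le> 3 * norm x / 2" unfolding \<rho>_def by linarith+
      then show "z \<in> ?A \<rho>" by (simp add: \<rho>_def)
    qed
    have AO: "?A \<rho> \<subseteq> \<Omega>" using r by (auto simp: \<Omega>_def)
    have cA: "compact (?A \<rho>)"
    proof -
      have "?A \<rho> = cball 0 (3 * \<rho> / 2) - ball 0 (\<rho> / 2)" by (auto simp: not_less)
      then show ?thesis by (simp add: compact_diff)
    qed
    have U: "(LINT z:cball y (\<rho> / 4)|lborel. \<bar>u z\<bar>) \<le> C2 * \<rho>\<^sup>2"
      using set_integral_abs_mono[OF cA continuous_on_subset[OF cu AO] compact_cball sub] mu[OF r] by linarith
    have E: "(LINT z:cball y (\<rho> / 4 / 2)|lborel. \<bar>poly_laplacian m u z\<bar>) \<le> 2 ^ (2 * m) * (\<epsilon> \<rho> / \<rho> ^ (2 * m - 2))"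
    proof -
      have "(LINT z:cball y (\<rho> / 4 / 2)|lborel. \<bar>poly_laplacian m u z\<bar>) \<le> (LINT z:?A \<rho>|lborel. \<bar>poly_laplacian m u z\<bar>)"
      proof (rule set_integral_abs_mono[OF cA])
        show "continuous_on (?A \<rho>) (poly_laplacian m u)"
          using Ck_on_poly_laplacian[OF Om u[folded \<Omega>_def], of 0 m] AO by (auto simp: Ck_on_0 intro: continuous_on_subset)
        show "cball y (\<rho> / 4 / 2) \<subseteq> ?A \<rho>" by (rule order_trans[OF subset_cball sub]) (use r in simp)
      qed simp
      also have "\<dots> \<le> (\<integral>z. (2 / \<rho>) ^ (2 * m - 2) * (indicator (?A \<rho>) z *\<^sub>R h z) \<partial>lborel)"
        unfolding set_lebesgue_integral_def
      proof (rule integral_mono)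
        show "integrable lborel (\<lambda>z. indicat_real (?A \<rho>) z *\<^sub>R \<bar>poly_laplacian m u z\<bar>)"
          using borel_integrable_compact[OF cA continuous_on_subset[OF cL AO]] by (simp add: L_def)
        show "integrable lborel (\<lambda>z. (2 / \<rho>) ^ (2 * m - 2) * (indicator (?A \<rho>) z *\<^sub>R h z))"
          by (intro integrable_mult_right borel_integrable_compact[OF cA continuous_on_subset[OF ch AO]])
        fix z
        show "indicat_real (?A \<rho>) z *\<^sub>R \<bar>poly_laplacian m u z\<bar> \<le> (2 / \<rho>) ^ (2 * m - 2) * (indicator (?A \<rho>) z *\<^sub>R h z)"
        proof (cases "z \<in> ?A \<rho>")
          case True
          then have "1 \<le> 2 / \<rho> * norm z" using r by (auto simp: field_simps)
          then have "1 \<le> (2 / \<rho> * norm z) ^ (2 * m - 2)" by (rule one_le_power)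
          then have "1 * L z \<le> (2 / \<rho> * norm z) ^ (2 * m - 2) * L z" by (rule mult_right_mono) (simp add: L_def)
          then show ?thesis using True by (simp add: h_def L_def power_mult_distrib power_divide)
        qed simp
      qed
      also have "\<dots> = (2 / \<rho>) ^ (2 * m - 2) * \<epsilon> \<rho>" by (simp add: \<epsilon>_def set_lebesgue_integral_def)
      also have "\<dots> = 2 ^ (2 * m - 2) * (\<epsilon> \<rho> / \<rho> ^ (2 * m - 2))" by (simp add: power_divide)
      also have "\<dots> \<le> 2 ^ (2 * m) * (\<epsilon> \<rho> / \<rho> ^ (2 * m - 2))"
        using h(2)[OF r] r by (intro mult_right_mono power_increasing) auto
      finally show ?thesis .
    qed
    have A: "(LINT z:cball y t|lborel. \<bar>poly_laplacian m u z\<bar>) \<le> F * V * t ^ CARD('n)" if t: "0 < t" "t \<le> \<tau>" for t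
    proof -
      have "(LINT z:cball y t|lborel. \<bar>poly_laplacian m u z\<bar>) \<le> (LINT z:cball y t|lborel. F)"
        unfolding set_lebesgue_integral_def
      proof (rule integral_mono)
        have "cball y t \<subseteq> cball y (\<rho> / 4)" by (rule subset_cball) (use t tau r in \<open>simp add: \<rho>_def\<close>)
        then have "cball y t \<subseteq> \<Omega>" using sub AO by (meson order_trans)
        from borel_integrable_compact[OF compact_cball continuous_on_subset[OF cL this]]
        show "integrable lborel (\<lambda>z. indicat_real (cball y t) z *\<^sub>R \<bar>poly_laplacian m u z\<bar>)"
          by (simp add: L_def)
        show "integrable lborel (\<lambda>z. indicat_real (cball y t) z *\<^sub>R F)"
          by (rule borel_integrable_compact) auto
      qed (use F t in \<open>auto simp: indicator_def\<close>)
      also have "\<dots> = F * measure lborel (cball y t)"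
        by (simp add: set_lebesgue_integral_def emeasure_lborel_cball_finite)
      also have "measure lborel (cball y t) = V * t ^ CARD('n)"
        using t content_ball_conv_unit_ball[of t y] by (simp add: V_def content_cball_conv_ball)
      finally show ?thesis by (simp add: mult.assoc)
    qed
    let ?B = "\<rho> powr (- (n - 2 + real k)) + F * \<tau> powr (2 * real m - real k)
         + \<epsilon> \<rho> * \<rho> powr (- (2 * real m - 2)) * \<tau> powr (- (n - 2 * real m + real k))"
    have B0: "?B \<ge> 0" using F0 h(2)[OF r] by auto
    have "\<bar>Dlist is u y\<bar> \<le> C1 * (W * ?B)" if l: "length is = k" for "is"
    proof -
      have "\<bar>Dlist is u y\<bar> \<le> C1 * ((LINT z:cball y (\<rho> / 4)|lborel. \<bar>u z\<bar>) / (\<rho> / 4) ^ (CARD('n) + length is)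
         + F * V * \<tau> ^ (2 * m - length is) + 2 ^ (2 * m) * (\<epsilon> \<rho> / \<rho> ^ (2 * m - 2)) / \<tau> ^ (CARD('n) + length is - 2 * m))"
        by (rule est[OF Om u[folded \<Omega>_def] order_trans[OF sub AO] _ tau(1) _ A E]) (use l k tau in \<open>auto simp: \<rho>_def\<close>)
      also have "\<dots> \<le> C1 * (W * ?B)"
      proof (rule mult_left_mono)
        have p1: "\<rho>\<^sup>2 / (\<rho> / 4) ^ (CARD('n) + k) = 4 ^ (CARD('n) + k) * \<rho> powr (- (n - 2 + real k))"
        proof -
          have "\<rho> powr (- (n - 2 + real k)) = \<rho> powr (2 - real (CARD('n) + k))" by (simp add: n_def algebra_simps)
          also have "\<dots> = \<rho>\<^sup>2 / \<rho> ^ (CARD('n) + k)"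
            unfolding powr_diff using r powr_realpow[of \<rho> 2] powr_realpow[of \<rho> "CARD('n) + k"] by simp
          finally show ?thesis by (simp add: power_divide)
        qed
        have p2: "\<tau> ^ (2 * m - k) = \<tau> powr (2 * real m - real k)"
          using powr_realpow[OF tau(1), of "2 * m - k"] k by (simp add: of_nat_diff)
        have p3: "1 / \<tau> ^ (CARD('n) + k - 2 * m) = \<tau> powr (- (n - 2 * real m + real k))"
        proof -
          have "n - 2 * real m + real k = real (CARD('n) + k - 2 * m)" using m(3) by (simp add: n_def of_nat_diff)
          then show ?thesis using powr_realpow[OF tau(1)] by (simp only: powr_minus_divide)
        qed
        have p4: "1 / \<rho> ^ (2 * m - 2) = \<rho> powr (- (2 * real m - 2))"
        proof -
          have "2 * real m - 2 = real (2 * m - 2)" using m(1) by (simp add: of_nat_diff)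
          then show ?thesis using powr_realpow[OF r(1)] by (simp only: powr_minus_divide)
        qed
        have "(LINT z:cball y (\<rho> / 4)|lborel. \<bar>u z\<bar>) / (\<rho> / 4) ^ (CARD('n) + k) \<le> C2 * \<rho>\<^sup>2 / (\<rho> / 4) ^ (CARD('n) + k)"
          using U r by (intro divide_right_mono) auto
        also have "\<dots> = C2 * 4 ^ (CARD('n) + k) * \<rho> powr (- (n - 2 + real k))"
          using p1 by (simp only: times_divide_eq_right[symmetric] mult.assoc)
        also have "\<dots> \<le> C2 * 4 ^ (CARD('n) + 2 * m) * \<rho> powr (- (n - 2 + real k))"
          using C2 k by (intro mult_right_mono mult_left_mono power_increasing) auto
        also have "\<dots> \<le> W * \<rho> powr (- (n - 2 + real k))" using V0 by (intro mult_right_mono) (auto simp: W_def)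
        finally have 1: "(LINT z:cball y (\<rho> / 4)|lborel. \<bar>u z\<bar>) / (\<rho> / 4) ^ (CARD('n) + k) \<le> W * \<rho> powr (- (n - 2 + real k))" .
        have "V * (F * \<tau> powr (2 * real m - real k)) \<le> W * (F * \<tau> powr (2 * real m - real k))"
          using C2 F0 by (intro mult_right_mono) (auto simp: W_def)
        then have 2: "F * V * \<tau> ^ (2 * m - k) \<le> W * (F * \<tau> powr (2 * real m - real k))"
          unfolding p2 by (simp add: mult_ac)
        have "2 ^ (2 * m) * (\<epsilon> \<rho> * \<rho> powr (- (2 * real m - 2)) * \<tau> powr (- (n - 2 * real m + real k)))
           \<le> W * (\<epsilon> \<rho> * \<rho> powr (- (2 * real m - 2)) * \<tau> powr (- (n - 2 * real m + real k)))"
          using C2 V0 h(2)[OF r] by (intro mult_right_mono) (auto simp: W_def)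
        then have 3: "2 ^ (2 * m) * (\<epsilon> \<rho> / \<rho> ^ (2 * m - 2)) / \<tau> ^ (CARD('n) + k - 2 * m)
           \<le> W * (\<epsilon> \<rho> * \<rho> powr (- (2 * real m - 2)) * \<tau> powr (- (n - 2 * real m + real k)))"
          unfolding p3[symmetric] p4[symmetric] by simp
        show "(LINT z:cball y (\<rho> / 4)|lborel. \<bar>u z\<bar>) / (\<rho> / 4) ^ (CARD('n) + length is)
         + F * V * \<tau> ^ (2 * m - length is) + 2 ^ (2 * m) * (\<epsilon> \<rho> / \<rho> ^ (2 * m - 2)) / \<tau> ^ (CARD('n) + length is - 2 * m) \<le> W * ?B"
          unfolding l distrib_left using 1 2 3 by linarith
      qed (use C1 in simp)
      finally show ?thesis .
    qed
    then have "Dnorm k u y \<le> real (CARD('n) ^ k) * (C1 * (W * ?B))" by (rule Dnorm_le)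
    also have "\<dots> \<le> real (CARD('n) ^ (2 * m)) * (C1 * (W * ?B))"
      using C1 W B0 k m(2) by (intro mult_right_mono) (auto intro!: power_increasing)
    also have "\<dots> = real (CARD('n) ^ (2 * m)) * (C1 * W) * ?B" by (simp add: mult.assoc)
    also have "\<dots> \<le> C * ?B" by (rule mult_right_mono[OF CW(2) B0])
    finally show "Dnorm k u y \<le> C * (norm x powr (- (n - 2 + real k)) + F * \<tau> powr (2 * real m - real k)
         + \<epsilon> (norm x) * norm x powr (- (2 * real m - 2)) * \<tau> powr (- (n - 2 * real m + real k)))"
      unfolding \<rho>_def .
  qed
qed

subsection \<open>The nonlinear estimate\<close>

text \<open>For T > 1 the right-hand side is at most D T^\<kappa> with \<kappa> the largest of 0 and
  the products s k \<mu> k. As \<kappa> < n, this bounds T^(n-\<kappa>).\<close>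

lemma sublinear_sum_bounded:
  fixes s \<mu> :: "nat \<Rightarrow> real"
  assumes "\<And>k. k < N \<Longrightarrow> 0 \<le> s k \<and> 0 \<le> \<mu> k \<and> s k * \<mu> k < n" and "0 < n" "0 \<le> C"
  obtains T0 where "T0 > 0" "\<And>T. T > 0 \<Longrightarrow> T powr n \<le> C * (\<Sum>k<N. (1 + T powr s k) powr \<mu> k) \<Longrightarrow> T \<le> T0"
proof -
  define \<kappa> where "\<kappa> = Max (insert 0 ((\<lambda>k. s k * \<mu> k) ` {..<N}))"
  have k: "\<kappa> < n" "0 \<le> \<kappa>" "\<And>k. k < N \<Longrightarrow> s k * \<mu> k \<le> \<kappa>"
    unfolding \<kappa>_def using assms(1,2) by (auto simp: Max_less_iff)
  define D where "D = C * (\<Sum>k<N. 2 powr \<mu> k)"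
  have D: "D \<ge> 0" unfolding D_def using assms(3) by (intro mult_nonneg_nonneg sum_nonneg) auto
  define T0 where "T0 = 1 + D powr (1 / (n - \<kappa>))"
  have T0: "T0 > 0" by (simp add: T0_def add_pos_nonneg)
  have "T \<le> T0" if T: "T > 0" and le: "T powr n \<le> C * (\<Sum>k<N. (1 + T powr s k) powr \<mu> k)" for T
  proof (cases "T \<le> 1")
    case True
    moreover have "0 \<le> D powr (1 / (n - \<kappa>))" by simp
    ultimately show ?thesis unfolding T0_def by linarith
  next
    case False
    have "(1 + T powr s k) powr \<mu> k \<le> 2 powr \<mu> k * T powr \<kappa>" if "k < N" for k
    proof -
      have "1 \<le> T powr s k" using False assms(1)[OF that] by (intro ge_one_powr_ge_zero) auto
      then have "(1 + T powr s k) powr \<mu> k \<le> (2 * T powr s k) powr \<mu> k"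
        using assms(1)[OF that] by (intro powr_mono2) auto
      also have "\<dots> = 2 powr \<mu> k * T powr (s k * \<mu> k)" using T by (simp add: powr_mult powr_powr)
      also have "\<dots> \<le> 2 powr \<mu> k * T powr \<kappa>"
        using k(3)[OF that] False by (intro mult_left_mono powr_mono) auto
      finally show ?thesis .
    qed
    then have "(\<Sum>k<N. (1 + T powr s k) powr \<mu> k) \<le> (\<Sum>k<N. 2 powr \<mu> k * T powr \<kappa>)"
      by (intro sum_mono) auto
    then have "C * (\<Sum>k<N. (1 + T powr s k) powr \<mu> k) \<le> D * T powr \<kappa>"
      using mult_left_mono[OF _ assms(3)] by (fastforce simp: D_def sum_distrib_right mult.assoc)
    then have "T powr n \<le> D * T powr \<kappa>" using le by linarith
    then have "T powr (n - \<kappa>) \<le> D" using T by (simp add: powr_diff divide_le_eq)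
    then have "(T powr (n - \<kappa>)) powr (1 / (n - \<kappa>)) \<le> D powr (1 / (n - \<kappa>))"
      using k by (intro powr_mono2) auto
    then have "T \<le> D powr (1 / (n - \<kappa>))" using T k by (simp add: powr_powr)
    then show ?thesis by (simp add: T0_def)
  qed
  then show thesis using that[OF T0] by blast
qed

text \<open>The bound on \<open>\<Delta>\<^sup>m u\<close>: at a maximum point \<open>y\<close> of \<open>(|x|/4 - |x - z|)\<^sup>n |\<Delta>\<^sup>m u(z)|\<close> the values of
  \<open>\<Delta>\<^sup>m u\<close> nearby are controlled by its value at \<open>y\<close>, so the derivatives at \<open>y\<close> are bounded by a power of
  that value, and the differential inequality closes up because the total power is less than one.\<close>

lemma poly_laplacian_bound:
  fixes u :: "real^'n::finite \<Rightarrow> real" and b :: real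
  assumes m: "m \<ge> 1" "2 * m < CARD('n)"
    and u: "Ck_on (2 * m) (ball 0 2 - {0}) u"
    and f0: "\<And>x. x \<in> ball 0 2 - {0} \<Longrightarrow> 0 \<le> - poly_laplacian m u x"
    and upper: "\<And>x. x \<in> ball 0 2 - {0} \<Longrightarrow> - poly_laplacian m u x \<le> (\<Sum>k<2 * m. (Dnorm k u x + g k x) powr \<mu> k)"
  defines "n \<equiv> real CARD('n)"
  defines "s \<equiv> \<lambda>k. n - 2 * real m + real k"
  defines "a \<equiv> \<lambda>k. s k * b + (n - 2 + real k)"
  defines "q \<equiv> n * b + (2 * real m - 2 + n)"
  assumes b: "b \<ge> 0" and mu: "\<And>k. k < 2 * m \<Longrightarrow> 0 \<le> \<mu> k \<and> s k * \<mu> k < n \<and> a k * \<mu> k \<le> q"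
    and r0: "0 < r0" "r0 \<le> 1 / 2"
    and g: "\<And>k x. k < 2 * m \<Longrightarrow> x \<noteq> 0 \<Longrightarrow> norm x \<le> 2 * r0 \<Longrightarrow> 0 \<le> g k x \<and> g k x \<le> G * norm x powr (- a k)"
    and C: "C > 0" "\<And>\<rho>. 0 < \<rho> \<Longrightarrow> \<rho> \<le> 1 / 2 \<Longrightarrow> 0 \<le> \<epsilon> \<rho> \<and> \<epsilon> \<rho> \<le> C"
    and est: "\<And>x y \<tau> F k. x \<noteq> 0 \<Longrightarrow> norm x \<le> 1 / 2 \<Longrightarrow> dist x y \<le> norm x / 4 \<Longrightarrow> k < 2 * m \<Longrightarrow>
      0 < \<tau> \<Longrightarrow> \<tau> \<le> norm x / 8 \<Longrightarrow> (\<And>z. dist y z \<le> \<tau> \<Longrightarrow> \<bar>poly_laplacian m u z\<bar> \<le> F) \<Longrightarrow>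
      Dnorm k u y \<le> C * (norm x powr (- (n - 2 + real k)) + F * \<tau> powr (2 * real m - real k)
         + \<epsilon> (norm x) * norm x powr (- (2 * real m - 2)) * \<tau> powr (- s k))"
  obtains K where "K > 0" "\<And>x. x \<noteq> 0 \<Longrightarrow> norm x \<le> r0 \<Longrightarrow> \<bar>poly_laplacian m u x\<bar> \<le> K * norm x powr (- q)"
proof -
  define f where "f = (\<lambda>x. \<bar>poly_laplacian m u x\<bar>)"
  define N where "N = CARD('n)"
  have nN: "n = real N" and Np: "N > 0" by (simp_all add: n_def N_def)
  have n5: "n > 2" "n > 2 * real m" using m unfolding n_def by linarith+
  have sk: "s k > 0" for k using n5 by (simp add: s_def)
  have ak: "a k \<ge> n - 2 + real k" "a k > 0" for k
    using sk[of k] b n5 by (auto simp: a_def add_nonneg_pos)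
  have q0: "q \<ge> 2 * real m - 2 + n" "q > 0" using b n5 m by (auto simp: q_def add_nonneg_pos)
  \<comment> \<open>Points y used below satisfy |y| \<ge> 3|x|/4, which costs (4/3)^(a k);
    \<open>a\<close> is increasing, so \<open>a (2 * m)\<close> majorizes all exponents.\<close>
  define G' where "G' = \<bar>G\<bar> * (4 / 3) powr (a (2 * m))"
  define D where "D = C + C * 2 ^ N + C * C + G'"
  have D0: "D > 0" unfolding D_def G'_def using C(1) by (intro add_pos_nonneg) auto
  define E where "E = Max (insert 1 ((\<lambda>k. D powr \<mu> k) ` {..<2 * m}))"
  have E: "E \<ge> 1" "\<And>k. k < 2 * m \<Longrightarrow> D powr \<mu> k \<le> E" by (auto simp: E_def)
  obtain T0 where T0: "T0 > 0" "\<And>T. T > 0 \<Longrightarrow> T powr n \<le> E * (\<Sum>k<2 * m. (1 + T powr s k) powr \<mu> k) \<Longrightarrow> T \<le> T0"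
  proof -
    have "0 \<le> s k \<and> 0 \<le> \<mu> k \<and> s k * \<mu> k < n" if "k < 2 * m" for k
      using mu[OF that] sk[of k] by (simp add: less_imp_le)
    moreover have "0 < n" "0 \<le> E" using n5 E(1) by auto
    ultimately show ?thesis using sublinear_sum_bounded[of "2 * m" s \<mu> n E] that by blast
  qed
  \<comment> \<open>The first summand serves the case \<tau> \<ge> d/2, the second the case \<tau> <
    d/2.\<close>
  define K where "K = 8 ^ N + T0 powr n"
  show thesis
  proof (rule that[of K])
    show "K > 0" by (simp add: K_def add_pos_nonneg)
    fix x :: "real^'n" assume x: "x \<noteq> 0" "norm x \<le> r0"
    define \<rho> where "\<rho> = norm x"
    have r: "0 < \<rho>" "\<rho> \<le> 1 / 2" "\<rho> \<le> 1" using x r0 by (auto simp: \<rho>_def)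
    let ?B = "cball x (\<rho> / 4)"
    have nz: "3 * \<rho> / 4 \<le> norm z" "norm z \<le> 5 * \<rho> / 4" if "z \<in> ?B" for z
    proof -
      have "\<bar>norm x - norm z\<bar> \<le> \<rho> / 4" using that norm_triangle_ineq3[of x z] by (simp add: dist_norm)
      then show "3 * \<rho> / 4 \<le> norm z" "norm z \<le> 5 * \<rho> / 4" unfolding \<rho>_def by linarith+
    qed
    have BO: "?B \<subseteq> ball 0 2 - {0}"
    proof
      fix z assume "z \<in> ?B"
      then show "z \<in> ball 0 2 - {0}" using nz[of z] r by auto
    qed
    have cf: "continuous_on ?B f"
    proof -
      have "open (ball 0 2 - {0} :: (real^'n) set)" by (simp add: open_Diff)
      from Ck_on_poly_laplacian[OF this u, of 0 m] show ?thesis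
        unfolding f_def Ck_on_0 by (auto intro: continuous_on_rabs continuous_on_subset[OF _ BO])
    qed
    \<comment> \<open>The exponent N = n makes the maximized quantity scale like a mass. Comparison
      with z = x gives both f x \<le> f y and the bound on f x used when \<tau> is large.\<close>
    have "\<exists>y\<in>?B. \<forall>z\<in>?B. (\<rho> / 4 - dist x z) ^ N * f z \<le> (\<rho> / 4 - dist x y) ^ N * f y"
      by (rule continuous_attains_sup) (use r in \<open>auto intro!: continuous_on_mult cf continuous_intros\<close>)
    then obtain y where y: "y \<in> ?B" 
      and max: "\<And>z. z \<in> ?B \<Longrightarrow> (\<rho> / 4 - dist x z) ^ N * f z \<le> (\<rho> / 4 - dist x y) ^ N * f y" by blast
    define d where "d = \<rho> / 4 - dist x y"
    have d: "0 \<le> d" "d \<le> \<rho> / 4" using y by (auto simp: d_def)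
    have fy: "f y \<ge> 0" "f x \<ge> 0" by (auto simp: f_def)
    have xy: "(\<rho> / 4) ^ N * f x \<le> d ^ N * f y" using max[of x] r by (simp add: d_def)
    have rq: "1 \<le> \<rho> powr (- q)" using r q0 by (simp add: powr_le_one_le ge_one_powr_ge_zero powr_minus_divide powr_le1)
    have "f x \<le> K * \<rho> powr (- q)"
    proof (cases "f x = 0")
      case True
      then show ?thesis using \<open>K > 0\<close> by simp
    next
      case False
      then have "0 < (\<rho> / 4) ^ N * f x" using fy r by simp
      then have p: "0 < d ^ N * f y" using xy by linarith
      have "d \<noteq> 0" using p Np by (intro notI) (simp add: zero_power)
      then have dp: "d > 0" using d by simp
      have "f y \<noteq> 0" using p by (intro notI) simp
      then have fyp: "f y > 0" using fy by simp
      have "d ^ N * f y \<le> (\<rho> / 4) ^ N * f y" using d fy by (intro mult_right_mono power_mono) auto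
      then have "(\<rho> / 4) ^ N * f x \<le> (\<rho> / 4) ^ N * f y" using xy by linarith
      then have fxy: "f x \<le> f y" by (rule mult_left_le_imp_le) (use r in simp)
      \<comment> \<open>Within d/2 of y the weight is still at least d/2, so maximality loses only
        the factor 2^N.\<close>
      have near: "f z \<le> 2 ^ N * f y" if "dist y z \<le> d / 2" for z
      proof -
        have dz: "d / 2 \<le> \<rho> / 4 - dist x z" using dist_triangle[of x z y] that by (simp add: d_def field_simps)
        then have "z \<in> ?B" using dp by simp
        from max[OF this] have "(\<rho> / 4 - dist x z) ^ N * f z \<le> d ^ N * f y" by (simp add: d_def)
        moreover have "(d / 2) ^ N * f z \<le> (\<rho> / 4 - dist x z) ^ N * f z"
          using dz dp by (intro mult_right_mono power_mono) (auto simp: f_def)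
        ultimately have "(d / 2) ^ N * f z \<le> d ^ N * f y" by linarith
        then have "d ^ N * f z \<le> d ^ N * (2 ^ N * f y)" by (simp add: power_divide field_simps)
        then show ?thesis using dp by simp
      qed
      \<comment> \<open>T measures f y in units of \<rho>^(-q). The radius \<tau> is the one with f
        y \<tau>^n = \<rho>^(2-2m): a density f y on a ball of that radius has mass comparable to
        that of the annulus, and the near and far terms of \<open>est\<close> balance.\<close>
      define T where "T = (f y * \<rho> powr q) powr (1 / n)"
      have Tp: "T > 0" using fyp r by (simp add: T_def)
      have Tn: "T powr n = f y * \<rho> powr q" using fyp r n5 by (simp add: T_def powr_powr)
      have fyT: "f y = T powr n * \<rho> powr (- q)" unfolding Tn using r by (simp add: powr_minus)
      define \<tau> where "\<tau> = \<rho> powr (1 + b) / T"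
      have taup: "\<tau> > 0" using r Tp by (simp add: \<tau>_def)
      have tau_powr: "\<tau> powr z = \<rho> powr ((1 + b) * z) * T powr (- z)" for z
        unfolding \<tau>_def using Tp by (simp add: powr_divide powr_powr powr_minus_divide[of T])
      show ?thesis
      proof (cases "\<tau> \<ge> d / 2")
        \<comment> \<open>No room for a ball of radius \<tau>, but then d^N f y \<le> 2^N \<tau>^n f
          y = 2^N \<rho>^(2-2m), which bounds f x without the differential inequality.\<close>
        case True
        have "(d / 2) ^ N * f y \<le> \<tau> powr n * f y"
        proof (rule mult_right_mono)
          have "(d / 2) ^ N = (d / 2) powr n" using dp by (simp add: nN powr_realpow)
          also have "\<dots> \<le> \<tau> powr n" using True dp n5 by (intro powr_mono2) auto
          finally show "(d / 2) ^ N \<le> \<tau> powr n" .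
        qed (rule fy)
        also have "\<dots> = \<rho> powr ((1 + b) * n - q)"
        proof -
          have "\<tau> powr n * f y = (\<rho> powr ((1 + b) * n) * \<rho> powr (- q)) * (T powr (- n) * T powr n)"
            unfolding tau_powr fyT by (simp only: mult_ac)
          also have "T powr (- n) * T powr n = 1" using Tp by (simp add: powr_add[symmetric])
          finally show ?thesis by (simp add: powr_add[symmetric])
        qed
        also have "\<dots> = \<rho> powr (n + - (2 * real m - 2 + n))" by (simp add: q_def algebra_simps)
        finally have "d ^ N * f y \<le> 2 ^ N * \<rho> powr (n + - (2 * real m - 2 + n))"
          by (simp add: power_divide field_simps)
        then have "(\<rho> / 4) ^ N * f x \<le> 2 ^ N * (\<rho> powr n * \<rho> powr (- (2 * real m - 2 + n)))"
          using xy unfolding powr_add by linarith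
        also have "\<rho> powr n = \<rho> ^ N" using r by (simp add: nN powr_realpow)
        finally have "\<rho> ^ N * f x \<le> \<rho> ^ N * (8 ^ N * \<rho> powr (- (2 * real m - 2 + n)))"
        proof -
          assume *: "(\<rho> / 4) ^ N * f x \<le> 2 ^ N * (\<rho> ^ N * \<rho> powr (- (2 * real m - 2 + n)))"
          have "(8 :: real) ^ N = 4 ^ N * 2 ^ N" by (simp add: power_mult_distrib[symmetric])
          moreover have "4 ^ N * ((\<rho> / 4) ^ N * f x) \<le> 4 ^ N * (2 ^ N * (\<rho> ^ N * \<rho> powr (- (2 * real m - 2 + n))))"
            using * by (intro mult_left_mono) auto
          ultimately show ?thesis by (simp add: power_divide mult_ac)
        qed
        then have "f x \<le> 8 ^ N * \<rho> powr (- (2 * real m - 2 + n))" using r by simp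
        also have "\<dots> \<le> 8 ^ N * \<rho> powr (- q)" using r q0 by (intro mult_left_mono powr_mono') auto
        also have "\<dots> \<le> K * \<rho> powr (- q)" by (intro mult_right_mono) (auto simp: K_def)
        finally show ?thesis .
      next
        case False
        have ty: "\<tau> \<le> norm x / 8" using False d by (simp add: \<rho>_def)
        have y0: "y \<noteq> 0" "norm y \<le> 2 * r0" using nz[OF y] r x by (auto simp: \<rho>_def)
        have summand: "(Dnorm k u y + g k y) powr \<mu> k \<le> E * (\<rho> powr (- q) * (1 + T powr s k) powr \<mu> k)" if k: "k < 2 * m" for k
        proof -
          have e1: "\<rho> powr (- (n - 2 + real k)) \<le> \<rho> powr (- a k)"
            using r ak(1)[of k] by (intro powr_mono') auto
          \<comment> \<open>By the choice of \<tau> the near term (\<open>e2\<close>) and the far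
            term (\<open>e3\<close>) have the same size \<rho>^(-a k) T^(s k).\<close>
          have e2: "f y * \<tau> powr (2 * real m - real k) = \<rho> powr (- a k) * T powr s k"
          proof -
            have "f y * \<tau> powr (2 * real m - real k) = \<rho> powr (- q + (1 + b) * (2 * real m - real k)) * T powr (n + - (2 * real m - real k))"
              unfolding fyT tau_powr powr_add by (simp add: mult_ac)
            also have "- q + (1 + b) * (2 * real m - real k) = - a k" by (simp add: q_def a_def s_def algebra_simps)
            finally show ?thesis by (simp add: s_def algebra_simps)
          qed
          have e3: "\<rho> powr (- (2 * real m - 2)) * \<tau> powr (- s k) = \<rho> powr (- a k) * T powr s k"
          proof -
            have "\<rho> powr (- (2 * real m - 2)) * \<tau> powr (- s k) = \<rho> powr (- (2 * real m - 2) + (1 + b) * (- s k)) * T powr s k"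
              unfolding tau_powr powr_add by (simp add: mult_ac)
            also have "- (2 * real m - 2) + (1 + b) * (- s k) = - a k" by (simp add: a_def s_def algebra_simps)
            finally show ?thesis .
          qed
          have "Dnorm k u y \<le> C * (norm x powr (- (n - 2 + real k)) + 2 ^ N * f y * \<tau> powr (2 * real m - real k)
             + \<epsilon> (norm x) * norm x powr (- (2 * real m - 2)) * \<tau> powr (- s k))"
            by (rule est[OF x(1) _ _ k taup ty]) (use r y near False in \<open>auto simp: \<rho>_def[symmetric] f_def\<close>)
          also have "\<dots> = C * (\<rho> powr (- (n - 2 + real k)) + 2 ^ N * (\<rho> powr (- a k) * T powr s k) + \<epsilon> \<rho> * (\<rho> powr (- a k) * T powr s k))"
            by (simp only: \<rho>_def[symmetric] mult.assoc e2 e3)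
          also have "\<dots> \<le> C * (\<rho> powr (- a k) * 1 + 2 ^ N * (\<rho> powr (- a k) * T powr s k) + C * (\<rho> powr (- a k) * T powr s k))"
            using C e1 r by (intro mult_left_mono add_mono mult_right_mono) auto
          also have "\<dots> \<le> (C + C * 2 ^ N + C * C) * (\<rho> powr (- a k) * (1 + T powr s k))"
          proof -
            define w where "w = \<rho> powr (- a k)"
            have "w \<ge> 0" by (simp add: w_def)
            then show ?thesis unfolding w_def[symmetric] using C(1) by (simp add: algebra_simps add_increasing add_increasing2)
          qed
          finally have D1: "Dnorm k u y \<le> (C + C * 2 ^ N + C * C) * (\<rho> powr (- a k) * (1 + T powr s k))" .
          have "g k y \<le> G * norm y powr (- a k)" using g[OF k y0] by blast
          also have "\<dots> \<le> \<bar>G\<bar> * (3 * \<rho> / 4) powr (- a k)"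
            using nz(1)[OF y] r ak(2)[of k] by (intro mult_mono powr_mono2') auto
          also have "\<dots> = \<bar>G\<bar> * (4 / 3) powr (a k) * \<rho> powr (- a k)"
          proof -
            have "(3 * \<rho> / 4) powr (- a k) = (\<rho> / (4 / 3)) powr (- a k)" by (simp add: mult.commute)
            also have "\<dots> = \<rho> powr (- a k) / (4 / 3) powr (- a k)" by (rule powr_divide) 
            finally have e: "(3 * \<rho> / 4) powr (- a k) = \<rho> powr (- a k) / (4 / 3) powr (- a k)" .
            show ?thesis unfolding e powr_minus_divide[of "4 / 3"] by simp
          qed
          also have "\<dots> \<le> G' * \<rho> powr (- a k)"
          proof -
            have "a k \<le> a (2 * m)" unfolding a_def s_def using k b by (intro add_mono mult_right_mono) auto
            then show ?thesis unfolding G'_def by (intro mult_right_mono mult_left_mono powr_mono) auto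
          qed
          also have "\<dots> \<le> G' * (\<rho> powr (- a k) * (1 + T powr s k))"
            by (intro mult_left_mono) (auto simp: G'_def mult_le_cancel_left1)
          finally have "Dnorm k u y + g k y \<le> D * (\<rho> powr (- a k) * (1 + T powr s k))"
            using D1 unfolding D_def by (simp add: distrib_right)
          moreover have "0 \<le> Dnorm k u y + g k y"
            using g[OF k y0] by (simp add: Dnorm_def sum_nonneg)
          ultimately have "(Dnorm k u y + g k y) powr \<mu> k \<le> (D * (\<rho> powr (- a k) * (1 + T powr s k))) powr \<mu> k"
            using mu[OF k] by (intro powr_mono2) auto
          also have "\<dots> = D powr \<mu> k * (\<rho> powr (- (a k * \<mu> k)) * (1 + T powr s k) powr \<mu> k)"
            using D0 r by (simp add: powr_mult powr_powr)
          \<comment> \<open>Here a k \<mu> k \<le> q enters: with \<rho> \<le> 1 the power of \<rho>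
            is absorbed by \<rho>^(-q), which cancels against f y and leaves an inequality in T
            alone.\<close>
          also have "\<dots> \<le> E * (\<rho> powr (- q) * (1 + T powr s k) powr \<mu> k)"
          proof (rule mult_mono[OF E(2)[OF k] mult_right_mono])
            show "\<rho> powr (- (a k * \<mu> k)) \<le> \<rho> powr (- q)" using r mu[OF k] by (intro powr_mono') auto
          qed (use E(1) in auto)
          finally show ?thesis .
        qed
        have yO: "y \<in> ball 0 2 - {0}" using y BO by blast
        have "f y \<le> (\<Sum>k<2 * m. (Dnorm k u y + g k y) powr \<mu> k)"
          using upper[OF yO] f0[OF yO] by (simp add: f_def)
        also have "\<dots> \<le> (\<Sum>k<2 * m. E * (\<rho> powr (- q) * (1 + T powr s k) powr \<mu> k))"
          by (intro sum_mono summand) auto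
        also have "\<dots> = E * (\<Sum>k<2 * m. (1 + T powr s k) powr \<mu> k) * \<rho> powr (- q)"
          by (simp add: sum_distrib_left sum_distrib_right mult_ac)
        finally have "T powr n \<le> E * (\<Sum>k<2 * m. (1 + T powr s k) powr \<mu> k)"
          unfolding fyT using r by simp
        then have "T \<le> T0" using T0(2)[OF Tp] by simp
        then have "T powr n \<le> T0 powr n" using Tp n5 by (intro powr_mono2) auto
        also have "\<dots> \<le> K" by (simp add: K_def)
        finally have "f y \<le> K * \<rho> powr (- q)" unfolding fyT by (intro mult_right_mono) auto
        then show ?thesis using fxy by linarith
      qed
    qed
    then show "\<bar>poly_laplacian m u x\<bar> \<le> K * norm x powr (- q)" by (simp add: f_def \<rho>_def)
  qed
qed

section \<open>The theorem in Landau notation\<close>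

lemma bigo_punctured_bound:
  fixes g h :: "nat \<Rightarrow> 'a::real_normed_vector \<Rightarrow> real"
  assumes "\<And>k. k < N \<Longrightarrow> g k \<in> O[at 0](h k)"
  obtains G d where "G > 0" "d > 0" "\<And>k x. k < N \<Longrightarrow> x \<noteq> 0 \<Longrightarrow> norm x < d \<Longrightarrow> \<bar>g k x\<bar> \<le> G * \<bar>h k x\<bar>"
proof -
  have "\<exists>c d. 0 < c \<and> 0 < d \<and> (\<forall>x. x \<noteq> 0 \<longrightarrow> norm x < d \<longrightarrow> \<bar>g k x\<bar> \<le> c * \<bar>h k x\<bar>)" if k: "k < N" for k
  proof -
    obtain c where c: "c > 0" "eventually (\<lambda>x. norm (g k x) \<le> c * norm (h k x)) (at 0)"
      using landau_o.bigE[OF assms[OF k]] by blast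
    then obtain d where "d > 0" "\<And>x. x \<noteq> 0 \<Longrightarrow> dist x 0 < d \<Longrightarrow> norm (g k x) \<le> c * norm (h k x)"
      unfolding eventually_at by auto
    then show ?thesis using c(1) by auto
  qed
  then obtain c d where cd: "\<And>k. k < N \<Longrightarrow> 0 < c k \<and> 0 < d k \<and> (\<forall>x. x \<noteq> 0 \<longrightarrow> norm x < d k \<longrightarrow> \<bar>g k x\<bar> \<le> c k * \<bar>h k x\<bar>)"
    by metis
  define G where "G = 1 + (\<Sum>k<N. c k)"
  define r where "r = Min (insert 1 (d ` {..<N}))"
  have "0 \<le> (\<Sum>k<N. c k)" by (rule sum_nonneg) (use cd in \<open>auto simp: less_imp_le\<close>)
  then have G: "G > 0" by (simp add: G_def)
  have cG: "c k \<le> G" if "k < N" for k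
    using member_le_sum[of k "{..<N}" c] that cd by (fastforce simp: G_def less_imp_le)
  have r: "r > 0" unfolding r_def using cd by (subst Min_gr_iff) auto
  have rd: "r \<le> d k" if "k < N" for k unfolding r_def using that by (intro Min_le) auto
  show thesis
  proof (rule that[OF G r])
    fix k and x :: 'a assume k: "k < N" and x: "x \<noteq> 0" "norm x < r"
    then have "\<bar>g k x\<bar> \<le> c k * \<bar>h k x\<bar>" using cd[OF k] rd[OF k] by auto
    also have "\<dots> \<le> G * \<bar>h k x\<bar>" using cG[OF k] by (rule mult_right_mono) simp
    finally show "\<bar>g k x\<bar> \<le> G * \<bar>h k x\<bar>" .
  qed
qed

theorem theorem3p1:
  fixes m n :: nat
    and lam :: "nat \<Rightarrow> real"
    and g :: "nat \<Rightarrow> real^'n::finite \<Rightarrow> real"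
    and u :: "real^'n \<Rightarrow> real"
    and b :: real
  defines "\<Omega> \<equiv> ball (0::real^'n) 2 - {0}"
  assumes n_def: "n = CARD('n)"
    and m2: "m \<ge> 2" and n2: "n \<ge> 2" and m_odd: "odd m" and mn: "2 * m < n"
    and lam_bd: "\<And>k. k < 2 * m \<Longrightarrow> lam k < real n / (real n - 2 * real m + real k)"
    and g_cont: "\<And>k. k < 2 * m \<Longrightarrow> continuous_on \<Omega> (g k)"
    and g_ge1: "\<And>k x. k < 2 * m \<Longrightarrow> x \<in> \<Omega> \<Longrightarrow> g k x \<ge> 1"
    and u_C: "Ck_on (2 * m) \<Omega> u"
    and u_nonneg: "\<And>x. x \<in> \<Omega> \<Longrightarrow> u x \<ge> 0"
    and ineq_lower: "\<And>x. x \<in> \<Omega> \<Longrightarrow> 0 \<le> - poly_laplacian m u x"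
    and ineq_upper: "\<And>x. x \<in> \<Omega> \<Longrightarrow>
          - poly_laplacian m u x \<le> (\<Sum>k<2 * m. (Dnorm k u x + g k x) powr lam k)"
    and b_def: "b = max 0 (Max ((\<lambda>k. (lam k * (real n - 2 + real k) - (2 * real m + real n - 2))
                                   / (real n - lam k * (real n - 2 * real m + real k))) ` {..<2 * m}))"
  shows "(b = 0 \<longrightarrow>
            (\<forall>k<2 * m. g k \<in> O[at 0](\<lambda>x. norm x powr (- (real n - 2 + real k)))) \<longrightarrow>
            (\<forall>i<2 * m. (\<lambda>x. Dnorm i u x) \<in> O[at 0](\<lambda>x. norm x powr (- (real n - 2 + real i)))))
       \<and> (b > 0 \<longrightarrow>
            (\<forall>k<2 * m. g k \<in> o[at 0](\<lambda>x. norm x powr (- ((real n - 2 * real m + real k) * b + (real n - 2 + real k))))) \<longrightarrow>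
            (\<forall>i<2 * m. (\<lambda>x. Dnorm i u x) \<in> o[at 0](\<lambda>x. norm x powr (- ((real n - 2 * real m + real i) * b + (real n - 2 + real i))))))"
proof -
  define s where "s = (\<lambda>k. real n - 2 * real m + real k)"
  define a where "a = (\<lambda>k. s k * b + (real n - 2 + real k))"
  define q where "q = real n * b + (2 * real m - 2 + real n)"
  \<comment> \<open>Nonnegative exponents make the summands monotone in their bases. Replacing
    \<open>lam\<close> by \<open>\<mu>\<close> only enlarges the right-hand side, since the bases
    are at least 1.\<close>
  define \<mu> where "\<mu> = (\<lambda>k. max (lam k) 0)"
  have sp: "s k > 0" for k using mn unfolding s_def by linarith
  have b0: "b \<ge> 0" by (simp add: b_def)
  have m1: "m \<ge> 1" "2 * m < CARD('n)" "CARD('n) \<ge> 4" using m2 mn n_def by auto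
  have q0: "q > 0" using b0 m2 mn unfolding q_def by (intro add_nonneg_pos) auto
  have mu: "0 \<le> \<mu> k \<and> s k * \<mu> k < real n \<and> a k * \<mu> k \<le> q" if k: "k < 2 * m" for k
  proof (cases "lam k \<le> 0")
    case True
    then show ?thesis using mn q0 by (simp add: \<mu>_def)
  next
    case False
    then have muk: "\<mu> k = lam k" by (simp add: \<mu>_def)
    have "lam k < real n / s k" using lam_bd[OF k] by (simp only: s_def)
    then have 1: "s k * lam k < real n" using sp[of k] by (simp add: pos_less_divide_eq mult.commute)
    have "(lam k * (real n - 2 + real k) - (2 * real m + real n - 2)) / (real n - lam k * s k) \<le> b"
      unfolding b_def s_def using k by (intro max.coboundedI2 Max_ge) auto
    \<comment> \<open>Clearing the positive denominator and collecting the terms with b gives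
      precisely a k * lam k \<le> q.\<close>
    then have "lam k * (real n - 2 + real k) - (2 * real m + real n - 2) \<le> b * (real n - lam k * s k)"
      using 1 by (simp add: pos_divide_le_eq mult.commute)
    then have "a k * lam k \<le> q" by (simp add: a_def q_def algebra_simps)
    then show ?thesis using 1 False muk by simp
  qed
  have upper: "- poly_laplacian m u x \<le> (\<Sum>k<2 * m. (Dnorm k u x + g k x) powr \<mu> k)" if x: "x \<in> \<Omega>" for x
  proof -
    have "(\<Sum>k<2 * m. (Dnorm k u x + g k x) powr lam k) \<le> (\<Sum>k<2 * m. (Dnorm k u x + g k x) powr \<mu> k)"
    proof (rule sum_mono)
      fix k assume "k \<in> {..<2 * m}"
      then have "1 \<le> Dnorm k u x + g k x"
        using g_ge1[of k x] x by (simp add: Dnorm_def add_increasing sum_nonneg)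
      then show "(Dnorm k u x + g k x) powr lam k \<le> (Dnorm k u x + g k x) powr \<mu> k"
        by (intro powr_mono) (auto simp: \<mu>_def)
    qed
    then show ?thesis using ineq_upper[OF x] by linarith
  qed
  obtain C \<epsilon> where C: "C > 0" and eps: "(\<epsilon> \<longlongrightarrow> 0) (at_right 0)" "\<And>\<rho>. 0 < \<rho> \<Longrightarrow> \<rho> \<le> 1 / 2 \<Longrightarrow> 0 \<le> \<epsilon> \<rho> \<and> \<epsilon> \<rho> \<le> C"
    and est: "\<And>x y \<tau> F k. x \<noteq> 0 \<Longrightarrow> norm x \<le> 1 / 2 \<Longrightarrow> dist x y \<le> norm x / 4 \<Longrightarrow> k < 2 * m \<Longrightarrow>
      0 < \<tau> \<Longrightarrow> \<tau> \<le> norm x / 8 \<Longrightarrow> (\<And>z. dist y z \<le> \<tau> \<Longrightarrow> \<bar>poly_laplacian m u z\<bar> \<le> F) \<Longrightarrow>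
      Dnorm k u y \<le> C * (norm x powr (- (real n - 2 + real k)) + F * \<tau> powr (2 * real m - real k)
         + \<epsilon> (norm x) * norm x powr (- (2 * real m - 2)) * \<tau> powr (- s k))"
    using derivative_bound[OF m1(1,3,2) u_C[unfolded \<Omega>_def] u_nonneg[unfolded \<Omega>_def] ineq_lower[unfolded \<Omega>_def]]
    unfolding n_def s_def by blast
  \<comment> \<open>With the pointwise bound on \<Delta>^m u available, the radius is taken as
    \<tau> = \<sigma> |x|^(1+b) with free \<sigma>. A small \<sigma> suppresses the pointwise term,
    and the factor \<sigma>^(-s i) it costs in the mass term is later beaten by \<epsilon>(|x|)
    \<rightarrow> 0.\<close>
  have key: "\<exists>K>0. \<exists>r>0. r \<le> 1 / 2 \<and> (\<forall>i x \<sigma>. i < 2 * m \<longrightarrow> x \<noteq> 0 \<longrightarrow> norm x \<le> r \<longrightarrow> 0 < \<sigma> \<longrightarrow> \<sigma> \<le> 1 / 8 \<longrightarrow>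
      Dnorm i u x \<le> C * norm x powr (- a i) * (norm x powr (b * s i) + K * \<sigma> powr (2 * real m - real i) + \<epsilon> (norm x) * \<sigma> powr (- s i)))"
    if gO: "\<And>k. k < 2 * m \<Longrightarrow> g k \<in> O[at 0](\<lambda>x. norm x powr (- a k))"
  proof -
    obtain G d where G: "G > 0" "d > 0" "\<And>k x. k < 2 * m \<Longrightarrow> x \<noteq> 0 \<Longrightarrow> norm x < d \<Longrightarrow> \<bar>g k x\<bar> \<le> G * \<bar>norm x powr (- a k)\<bar>"
      using bigo_punctured_bound[of "2 * m" g "\<lambda>k x. norm x powr (- a k)"] gO by blast
    define r0 where "r0 = min (1 / 2) (d / 4)"
    have r0: "0 < r0" "r0 \<le> 1 / 2" "2 * r0 < d" using G(2) by (auto simp: r0_def)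
    have g: "0 \<le> g k x \<and> g k x \<le> G * norm x powr (- a k)" if "k < 2 * m" "x \<noteq> 0" "norm x \<le> 2 * r0" for k x
    proof -
      have "x \<in> \<Omega>" using that r0 by (auto simp: \<Omega>_def)
      then have "1 \<le> g k x" using g_ge1 that by blast
      moreover have "\<bar>g k x\<bar> \<le> G * \<bar>norm x powr (- a k)\<bar>" using G(3)[OF that(1,2)] that(3) r0 by linarith
      ultimately show ?thesis by simp
    qed
    obtain K where K: "K > 0" "\<And>x. x \<noteq> 0 \<Longrightarrow> norm x \<le> r0 \<Longrightarrow> \<bar>poly_laplacian m u x\<bar> \<le> K * norm x powr (- q)"
      using poly_laplacian_bound[of m u g \<mu> b r0 G C \<epsilon>, OF m1(1,2) u_C[unfolded \<Omega>_def] ineq_lower[unfolded \<Omega>_def] upper[unfolded \<Omega>_def] b0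
          mu[unfolded q_def a_def s_def n_def] r0(1,2) g[unfolded a_def s_def n_def] C eps(2) est[unfolded s_def n_def]]
      unfolding q_def n_def by blast
    show ?thesis
    \<comment> \<open>The factor 2^q and the halved radius come from points z near x with |x|/2
      \<le> |z| \<le> r0.\<close>
    proof (rule exI[of _ "K * 2 powr q"], rule conjI[rotated], rule exI[of _ "r0 / 2"], intro conjI allI impI)
      show "0 < K * 2 powr q" "0 < r0 / 2" "r0 / 2 \<le> 1 / 2" using K r0 by auto
      fix i and x :: "real^'n" and \<sigma> :: real
      assume i: "i < 2 * m" and x: "x \<noteq> 0" "norm x \<le> r0 / 2" and sg: "0 < \<sigma>" "\<sigma> \<le> 1 / 8"
      define \<rho> where "\<rho> = norm x"
      have r: "0 < \<rho>" "\<rho> \<le> 1 / 2" "\<rho> \<le> r0 / 2" "\<rho> \<le> 1" using x r0 by (auto simp: \<rho>_def)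
      define \<tau> where "\<tau> = \<sigma> * \<rho> powr (1 + b)"
      have "\<rho> powr (1 + b) \<le> \<rho> powr 1" using r b0 by (intro powr_mono') auto
      then have "\<tau> \<le> 1 / 8 * \<rho>" unfolding \<tau>_def using sg r by (intro mult_mono) auto
      then have tau: "0 < \<tau>" "\<tau> \<le> norm x / 8" using sg r by (auto simp: \<tau>_def \<rho>_def)
      have tp: "\<tau> powr z = \<sigma> powr z * \<rho> powr ((1 + b) * z)" for z
        unfolding \<tau>_def using sg r by (simp add: powr_mult powr_powr)
      have "Dnorm i u x \<le> C * (norm x powr (- (real n - 2 + real i)) + (K * 2 powr q * \<rho> powr (- q)) * \<tau> powr (2 * real m - real i)
         + \<epsilon> (norm x) * norm x powr (- (2 * real m - 2)) * \<tau> powr (- s i))"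
      proof (rule est[OF x(1) _ _ i tau])
        fix z assume z: "dist x z \<le> \<tau>"
        have "\<bar>norm x - norm z\<bar> \<le> \<rho> / 8" using z tau norm_triangle_ineq3[of x z] by (simp add: dist_norm \<rho>_def)
        then have nz: "\<rho> / 2 \<le> norm z" "norm z \<le> r0" using r unfolding \<rho>_def by linarith+
        then have "norm z > 0" using r by linarith
        then have "\<bar>poly_laplacian m u z\<bar> \<le> K * norm z powr (- q)" using K(2)[of z] nz by auto
        also have "\<dots> \<le> K * (\<rho> / 2) powr (- q)" using nz r K(1) q0 by (intro mult_left_mono powr_mono2') auto
        also have "(\<rho> / 2) powr (- q) = 2 powr q * \<rho> powr (- q)"
          unfolding powr_divide powr_minus_divide[of 2] by simp
        finally show "\<bar>poly_laplacian m u z\<bar> \<le> K * 2 powr q * \<rho> powr (- q)" by (simp add: mult.assoc)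
      qed (use r in \<open>auto simp: \<rho>_def\<close>)
      also have "norm x powr (- (real n - 2 + real i)) = \<rho> powr (- a i) * \<rho> powr (b * s i)"
        unfolding \<rho>_def[symmetric] powr_add[symmetric] by (simp add: a_def algebra_simps)
      also have "(K * 2 powr q * \<rho> powr (- q)) * \<tau> powr (2 * real m - real i) = \<rho> powr (- a i) * (K * 2 powr q * \<sigma> powr (2 * real m - real i))"
      proof -
        have e: "\<rho> powr (- q) * \<rho> powr ((1 + b) * (2 * real m - real i)) = \<rho> powr (- a i)"
          unfolding powr_add[symmetric] by (simp add: a_def q_def s_def algebra_simps)
        show ?thesis unfolding tp e[symmetric] by (simp only: mult_ac)
      qed
      also have "\<epsilon> (norm x) * norm x powr (- (2 * real m - 2)) * \<tau> powr (- s i) = \<rho> powr (- a i) * (\<epsilon> (norm x) * \<sigma> powr (- s i))"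
      proof -
        have e: "\<rho> powr (- (2 * real m - 2)) * \<rho> powr ((1 + b) * (- s i)) = \<rho> powr (- a i)"
          unfolding powr_add[symmetric] by (simp add: a_def s_def algebra_simps)
        show ?thesis unfolding tp \<rho>_def[symmetric] e[symmetric] by (simp only: mult_ac)
      qed
      finally show "Dnorm i u x \<le> C * norm x powr (- a i) * (norm x powr (b * s i) + K * 2 powr q * \<sigma> powr (2 * real m - real i) + \<epsilon> (norm x) * \<sigma> powr (- s i))"
        unfolding \<rho>_def[symmetric] by (simp add: distrib_left mult.assoc)
    qed
  qed
  have D0: "0 \<le> Dnorm i u x" for i x by (simp add: Dnorm_def sum_nonneg)
  show ?thesis
  proof (intro conjI impI allI)
    fix i assume b: "b = 0" and g: "\<forall>k<2 * m. g k \<in> O[at 0](\<lambda>x. norm x powr (- (real n - 2 + real k)))" and i: "i < 2 * m"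
    have ab: "a k = real n - 2 + real k" for k by (simp add: a_def b)
    obtain K r where K: "K > 0" "r > 0" "r \<le> 1 / 2" and bd: "\<And>i x \<sigma>. i < 2 * m \<Longrightarrow> x \<noteq> 0 \<Longrightarrow> norm x \<le> r \<Longrightarrow> 0 < \<sigma> \<Longrightarrow> \<sigma> \<le> 1 / 8 \<Longrightarrow>
      Dnorm i u x \<le> C * norm x powr (- a i) * (norm x powr (b * s i) + K * \<sigma> powr (2 * real m - real i) + \<epsilon> (norm x) * \<sigma> powr (- s i))"
      using key g unfolding ab by blast
    show "(\<lambda>x. Dnorm i u x) \<in> O[at 0](\<lambda>x. norm x powr (- (real n - 2 + real i)))"
    \<comment> \<open>For b = 0 boundedness of \<epsilon> by C suffices, so \<sigma> is fixed at its
      largest value 1/8; the first term equals 1 because |x|^0 = 1.\<close>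
    proof (rule bigoI[where c="C * (1 + K * (1 / 8) powr (2 * real m - real i) + C * (1 / 8) powr (- s i))"])
      show "\<forall>\<^sub>F x in at 0. norm (Dnorm i u x) \<le> C * (1 + K * (1 / 8) powr (2 * real m - real i) + C * (1 / 8) powr (- s i))
          * norm (norm x powr (- (real n - 2 + real i)))"
        unfolding eventually_at
      proof (intro exI[of _ r] conjI K ballI impI)
        fix x :: "real^'n" assume "x \<noteq> 0 \<and> dist x 0 < r"
        then have x: "x \<noteq> 0" "norm x \<le> r" by auto
        have "Dnorm i u x \<le> C * norm x powr (- a i) * (norm x powr (b * s i) + K * (1 / 8) powr (2 * real m - real i) + \<epsilon> (norm x) * (1 / 8) powr (- s i))"
          by (rule bd[OF i x]) auto
        also have "\<dots> \<le> C * norm x powr (- a i) * (1 + K * (1 / 8) powr (2 * real m - real i) + C * (1 / 8) powr (- s i))"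
          using C x eps(2)[of "norm x"] K by (intro mult_left_mono add_mono mult_right_mono) (auto simp: b)
        finally show "norm (Dnorm i u x) \<le> C * (1 + K * (1 / 8) powr (2 * real m - real i) + C * (1 / 8) powr (- s i))
          * norm (norm x powr (- (real n - 2 + real i)))" using D0[of i x] by (simp add: ab mult_ac)
      qed
    qed
  next
    fix i assume b: "b > 0" and g: "\<forall>k<2 * m. g k \<in> o[at 0](\<lambda>x. norm x powr (- ((real n - 2 * real m + real k) * b + (real n - 2 + real k))))" and i: "i < 2 * m"
    have gO: "g k \<in> O[at 0](\<lambda>x. norm x powr (- a k))" if "k < 2 * m" for k
      using g that unfolding a_def s_def by (intro landau_o.small_imp_big) blast
    obtain K r where K: "K > 0" "r > 0" "r \<le> 1 / 2" and bd: "\<And>i x \<sigma>. i < 2 * m \<Longrightarrow> x \<noteq> 0 \<Longrightarrow> norm x \<le> r \<Longrightarrow> 0 < \<sigma> \<Longrightarrow> \<sigma> \<le> 1 / 8 \<Longrightarrow>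
      Dnorm i u x \<le> C * norm x powr (- a i) * (norm x powr (b * s i) + K * \<sigma> powr (2 * real m - real i) + \<epsilon> (norm x) * \<sigma> powr (- s i))"
      using key[OF gO] by blast
    have "(\<lambda>x. Dnorm i u x) \<in> o[at 0](\<lambda>x. norm x powr (- a i))"
    proof (rule landau_o.smallI)
      fix c :: real assume c: "c > 0"
      \<comment> \<open>Each of the three terms in the bracket is to be at most c', and C (c' + c' +
        c') = c.\<close>
      define c' where "c' = c / (3 * C)"
      have c': "c' > 0" using c C by (simp add: c'_def)
      \<comment> \<open>Fixed before x: since 2m - i \<ge> 1 and \<sigma> \<le> 1, the choice
        \<sigma> \<le> c'/K settles the pointwise term. Only afterwards is x taken small, depending
        on \<sigma>, for the mass term.\<close>
      define \<sigma> where "\<sigma> = min (1 / 8) (c' / K)"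
      have "0 < \<sigma>" using c' K by (simp add: \<sigma>_def)
      moreover have "\<sigma> \<le> 1 / 8" "\<sigma> \<le> c' / K" unfolding \<sigma>_def by (rule min.cobounded1, rule min.cobounded2)
      ultimately have sg: "0 < \<sigma>" "\<sigma> \<le> 1 / 8" "\<sigma> \<le> c' / K" by blast+
      have "real i + 1 \<le> 2 * real m" using i by linarith
      then have "\<sigma> powr (2 * real m - real i) \<le> \<sigma> powr 1" using sg by (intro powr_mono') auto
      also have "\<dots> \<le> c' / K" using sg by simp
      finally have 1: "K * \<sigma> powr (2 * real m - real i) \<le> c'" using K by (simp add: field_simps)
      have "((\<lambda>\<rho>. \<epsilon> \<rho> * \<sigma> powr (- s i)) \<longlongrightarrow> 0 * \<sigma> powr (- s i)) (at_right 0)" by (intro tendsto_mult eps tendsto_const)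
      then have "\<forall>\<^sub>F \<rho> in at_right 0. \<epsilon> \<rho> * \<sigma> powr (- s i) < c'" using c' by (intro order_tendstoD(2)) auto
      then obtain d where d: "d > 0" "\<And>\<rho>. 0 < \<rho> \<Longrightarrow> \<rho> < d \<Longrightarrow> \<epsilon> \<rho> * \<sigma> powr (- s i) < c'"
        unfolding eventually_at_right_field by auto
      \<comment> \<open>Solves d2^(b s i) = c'; positivity of b is what makes the first term
        small.\<close>
      define d2 where "d2 = c' powr (1 / (b * s i))"
      have bs: "b * s i > 0" using b sp by simp
      have d2: "d2 > 0" using c' by (simp add: d2_def)
      show "\<forall>\<^sub>F x in at 0. norm (Dnorm i u x) \<le> c * norm (norm x powr (- a i))"
        unfolding eventually_at
      proof (intro exI[of _ "min r (min d d2)"] conjI ballI impI)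
        show "0 < min r (min d d2)" using K d d2 by simp
        fix x :: "real^'n" assume "x \<noteq> 0 \<and> dist x 0 < min r (min d d2)"
        then have x: "x \<noteq> 0" "norm x \<le> r" "norm x < d" "norm x \<le> d2" by auto
        have "norm x powr (b * s i) \<le> d2 powr (b * s i)" using x bs by (intro powr_mono2) auto
        also have "\<dots> = c'" using b sp[of i] c' by (simp add: d2_def powr_powr)
        finally have 2: "norm x powr (b * s i) \<le> c'" .
        have "Dnorm i u x \<le> C * norm x powr (- a i) * (norm x powr (b * s i) + K * \<sigma> powr (2 * real m - real i) + \<epsilon> (norm x) * \<sigma> powr (- s i))"
          by (rule bd[OF i x(1,2) sg(1,2)])
        also have "\<dots> \<le> C * norm x powr (- a i) * (c' + c' + c')"
          using C 1 2 d(2)[of "norm x"] x by (intro mult_left_mono add_mono) auto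
        also have "\<dots> = c * norm x powr (- a i)" using C by (simp add: c'_def)
        finally show "norm (Dnorm i u x) \<le> c * norm (norm x powr (- a i))" using D0[of i x] by simp
      qed
    qed
    then show "(\<lambda>x. Dnorm i u x) \<in> o[at 0](\<lambda>x. norm x powr (- ((real n - 2 * real m + real i) * b + (real n - 2 + real i))))"
      unfolding a_def s_def .
  qed
qed

end
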